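(* Let $\gamma$ be a Keplerian ellipse, i.e. a solution of $\mu\ddot\gamma(t)=-\dfrac{m}{|\gamma(t)|^3}\gamma(t)$ in $\mathbb{R}^2\setminus\{0\}$ which is periodic with prime (minimal) period $T>0$, and for $k\in\mathbb{N}^*=\{1,2,\dots\}$ let $\gamma^k$ denote its $k$-th iteration. Denoting by $\iota(\cdot)$ the Morse index, we have $$\iota(\gamma^k)=2(k-1)\qquad\text{for all } k\in\mathbb{N}^*.$$ In particular $\iota(\gamma)=0$ and $\displaystyle\lim_{k\to+\infty}\frac{\iota(\gamma^k)}{k}=2$.
   Context: Here $\mu>0$ (reduced mass) and $m>0$ are constants, $\mathbb{X}=\mathbb{R}^2\setminus\{0\}$, $U(q)=m/|q|$, and $L(q,v)=\tfrac12\mu|v|^2+U(q)$ is the Lagrangian on $T\mathbb{X}=\mathbb{X}\times\mathbb{R}^2$. Periodic solutions of the equation staying in $\mathbb{X}$ (no collisions) have nonzero angular momentum and negative energy, and are ellipses of eccentricity $e\in[0,1)$ with a focus at the origin (circles included). For $\tau>0$ the Lagrangian action on the Hilbert manifold $H^1(\mathbb{R}/\tau\mathbb{Z},\mathbb{X})$ of $\tau$-periodic $H^1$ loops in $\mathbb{X}$ is $\mathbb{A}_\tau(x)=\int_0^\tau L(x(t),\dot x(t))\,dt$. Its critical points are the $\tau$-periodic solutions of the equation. The Morse index of a critical point $x$ is the maximal dimension of a linear subspace of $H^1(\mathbb{R}/\tau\mathbb{Z},\mathbb{R}^2)$ on which the second variation $$d^2\mathbb{A}_\tau(x)[\xi,\eta]=\int_0^\tau\big[\mu\langle\dot\xi(t),\dot\eta(t)\rangle+\langle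 D^2U(x(t))\xi(t),\eta(t)\rangle\big]\,dt$$ is negative definite. The $k$-th iteration $\gamma^k$ is $\gamma$ regarded as a $kT$-periodic loop; its Morse index $\iota(\gamma^k)$ is its Morse index as a critical point of $\mathbb{A}_{kT}$. In particular $\iota(\gamma)=\iota(\gamma^1)$. *)

theory Defs
  imports "HOL-Analysis.Analysis" "HOL-Library.Function_Algebras"
    "HOL-Library.Extended_Nat" "HOL-Library.Extended_Real"
begin

text \<open>Loops are functions on the whole line. The pointwise real vector space structure on
  functions makes the library notions of linear subspace and dimension available for sets of loops.\<close>

instantiation "fun" :: (type, real_vector) real_vector
begin

definition scaleR_fun :: "real \<Rightarrow> ('a \<Rightarrow> 'b) \<Rightarrow> 'a \<Rightarrow> 'b" where
  "scaleR_fun c f = (\<lambda>t. c *\<^sub>R f t)"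

instance
  by standard (auto simp: scaleR_fun_def fun_eq_iff scaleR_add_right scaleR_add_left)

end

definition U :: "real \<Rightarrow> real ^ 2 \<Rightarrow> real" where
  "U m q = m / norm q"

text \<open>The pairing of the Hessian \<open>D\<^sup>2U(q)\<close> applied to \<open>\<xi>\<close> with \<open>\<eta>\<close>, as the derivative in direction
  \<open>\<xi>\<close> of the map \<open>p \<mapsto> DU(p)\<eta>\<close>.\<close>

definition D2U :: "real \<Rightarrow> real ^ 2 \<Rightarrow> real ^ 2 \<Rightarrow> real ^ 2 \<Rightarrow> real" where
  "D2U m q \<xi> \<eta> =
     frechet_derivative (\<lambda>p. frechet_derivative (U m) (at p) \<eta>) (at q) \<xi>"

definition kepler_solution :: "real \<Rightarrow> real \<Rightarrow> (real \<Rightarrow> real ^ 2) \<Rightarrow> bool" where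
  "kepler_solution \<mu> m x \<longleftrightarrow>
     (\<exists>v a. \<forall>t. x t \<noteq> 0
        \<and> (x has_vector_derivative v t) (at t)
        \<and> (v has_vector_derivative a t) (at t)
        \<and> \<mu> *\<^sub>R a t = - (m / norm (x t) ^ 3) *\<^sub>R x t)"

definition periodic :: "real \<Rightarrow> (real \<Rightarrow> 'a) \<Rightarrow> bool" where
  "periodic \<tau> x \<longleftrightarrow> (\<forall>t. x (t + \<tau>) = x t)"

definition prime_period :: "real \<Rightarrow> (real \<Rightarrow> 'a) \<Rightarrow> bool" where
  "prime_period T x \<longleftrightarrow>
     0 < T \<and> periodic T x \<and> (\<forall>S. 0 < S \<and> S < T \<longrightarrow> \<not> periodic S x)"

definition kepler_ellipse :: "real \<Rightarrow> real \<Rightarrow> real \<Rightarrow> (real \<Rightarrow> real ^ 2) \<Rightarrow> bool" where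
  "kepler_ellipse \<mu> m T \<gamma> \<longleftrightarrow> kepler_solution \<mu> m \<gamma> \<and> prime_period T \<gamma>"

text \<open>An \<open>H\<^sup>1\<close> function on the circle is identified with its continuous representative: a
  \<open>\<tau>\<close>-periodic function that is a primitive on \<open>[0,\<tau>]\<close> of a square-integrable function \<open>g\<close>, its
  weak derivative. Only the values of \<open>g\<close> on \<open>[0,\<tau>]\<close> matter, and there \<open>g\<close> is determined by \<open>\<xi>\<close>
  up to a null set; hence integrals over \<open>[0,\<tau>]\<close> involving \<open>weak_deriv\<close> do not depend on the
  choice.\<close>

definition is_weak_deriv :: "real \<Rightarrow> (real \<Rightarrow> real ^ 2) \<Rightarrow> (real \<Rightarrow> real ^ 2) \<Rightarrow> bool" where
  "is_weak_deriv \<tau> \<xi> g \<longleftrightarrow>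
     g \<in> borel_measurable lborel
     \<and> set_integrable lborel {0..\<tau>} (\<lambda>t. (norm (g t))\<^sup>2)
     \<and> (\<forall>t\<in>{0..\<tau>}. \<xi> t = \<xi> 0 + set_lebesgue_integral lborel {0..t} g)"

definition H1_loops :: "real \<Rightarrow> (real \<Rightarrow> real ^ 2) set" where
  "H1_loops \<tau> = {\<xi>. periodic \<tau> \<xi> \<and> (\<exists>g. is_weak_deriv \<tau> \<xi> g)}"

definition weak_deriv :: "real \<Rightarrow> (real \<Rightarrow> real ^ 2) \<Rightarrow> real \<Rightarrow> real ^ 2" where
  "weak_deriv \<tau> \<xi> = (SOME g. is_weak_deriv \<tau> \<xi> g)"

definition second_variation ::
    "real \<Rightarrow> real \<Rightarrow> real \<Rightarrow> (real \<Rightarrow> real ^ 2) \<Rightarrow> (real \<Rightarrow> real ^ 2) \<Rightarrow> (real \<Rightarrow> real ^ 2) \<Rightarrow> real" where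
  "second_variation \<mu> m \<tau> x \<xi> \<eta> =
     set_lebesgue_integral lborel {0..\<tau>}
       (\<lambda>t. \<mu> * (weak_deriv \<tau> \<xi> t \<bullet> weak_deriv \<tau> \<eta> t) + D2U m (x t) (\<xi> t) (\<eta> t))"

definition negative_definite_on ::
    "('a \<Rightarrow> 'a \<Rightarrow> real) \<Rightarrow> 'a::real_vector set \<Rightarrow> bool" where
  "negative_definite_on B V \<longleftrightarrow> (\<forall>\<xi>\<in>V. \<xi> \<noteq> 0 \<longrightarrow> B \<xi> \<xi> < 0)"

text \<open>The supremum is over finite-dimensional subspaces because \<open>dim\<close> is \<open>0\<close> on infinite-dimensional
  ones; an infinite-dimensional negative definite subspace has finite-dimensional subspaces of every
  dimension, and so makes the index \<open>\<infinity>\<close>.\<close>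

definition morse_index :: "real \<Rightarrow> real \<Rightarrow> real \<Rightarrow> (real \<Rightarrow> real ^ 2) \<Rightarrow> enat" where
  "morse_index \<mu> m \<tau> x =
     (SUP V \<in> {V. subspace V \<and> V \<subseteq> H1_loops \<tau> \<and> (\<exists>B. finite B \<and> V = span B)
                 \<and> negative_definite_on (second_variation \<mu> m \<tau> x) V}. enat (dim V))"

text \<open>The \<open>k\<close>-th iteration is the same function, regarded as a loop of period \<open>kT\<close>.\<close>

definition iteration_index :: "real \<Rightarrow> real \<Rightarrow> real \<Rightarrow> (real \<Rightarrow> real ^ 2) \<Rightarrow> nat \<Rightarrow> enat" where
  "iteration_index \<mu> m T \<gamma> k = morse_index \<mu> m (real k * T) \<gamma>"

end

theory Submission
  imports Defs
begin

text \<open>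
  In the Levi-Civita variable \<open>z\<close> with \<open>z\<^sup>2 = x\<close> and the fictitious time \<open>ds = dt / |x|\<close>, the action on
  loops of period \<open>\<tau>\<close> becomes the functional
  \<open>2/\<tau> (\<integral>|z|\<^sup>2 d\<sigma>) (\<integral>|z'|\<^sup>2 d\<sigma>) + m \<tau> / \<integral>|z|\<^sup>2 d\<sigma>\<close> (for \<open>\<mu> = 1\<close>) of loops
  parametrised by the normalised fictitious time \<open>\<sigma> = s / S\<close>, where \<open>S\<close> is the total fictitious
  time. Kepler ellipses correspond to its harmonic critical points \<open>z'' = - \<omega>\<^sup>2 z\<close>, where its
  second variation is
  \<open>4/\<tau> ((\<integral>|z|\<^sup>2) \<integral>(|\<zeta>'|\<^sup>2 - \<omega>\<^sup>2 |\<zeta>|\<^sup>2) + 12 \<omega>\<^sup>2 (\<integral>\<langle>z, \<zeta>\<rangle>)\<^sup>2)\<close>, with no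
  dependence on the eccentricity. Along the \<open>k\<close>-th iterate half the eccentric anomaly \<open>\<psi>\<close> increases
  by \<open>k \<pi>\<close> and \<open>\<zeta>\<close> changes by the factor \<open>(-1)\<^sup>k\<close>, so \<open>\<zeta>\<close> has the modes
  \<open>exp(i (1 - 2j/k) \<psi>)\<close>; the \<open>k - 1\<close> modes with \<open>0 < j < k\<close> are the negative ones, each of real
  dimension 2, and they are orthogonal to \<open>z\<close>.

  Conversely the form is nonnegative as soon as \<open>\<zeta>\<close> is antiperiodic over each single revolution, by
  the Wirtinger inequality on half a period, and this is a set of \<open>2 (k - 1)\<close> real conditions.
\<close>

section \<open>Primitives of integrable functions\<close>

text \<open>The new time depends on the loop, so varying x = z^2 by \<xi> at fixed t is not varying
  z at fixed normalised time. Since 1/|x| changes by -<x, \<xi>>/|x|^3, keeping s/S fixed moves t by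
  r n, where r = |x|, n' = <x, \<xi>>/r^3 - c/r and c is minus the relative change of S. Hence z
  changes by \<xi>/(2z) + n w with w = dz/ds. The two quadratic forms agree up to an exact
  derivative and a nonnegative multiple of c^2; as c = (2/\<tau>) times the s-integral of <z,
  \<zeta>>, that multiple is the rank-one square of the overview. It only helps the upper bound on
  the index, and the negative modes have c = 0. The motion is given merely as periodic. Its negative
  energy has to be derived, and minimality of the period is what makes half the eccentric anomaly
  advance by exactly \<pi>. A weak derivative is an unspecified representative, so the calculus runs
  on pairs of an absolutely continuous function and a given integrable derivative, with no pointwise
  differentiation.\<close>

definition primitive_on :: "real \<Rightarrow> real \<Rightarrow> (real \<Rightarrow> 'a::euclidean_space) \<Rightarrow> (real \<Rightarrow> 'a) \<Rightarrow> bool" where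
  "primitive_on a b f g \<longleftrightarrow> set_integrable lborel {a..b} g
     \<and> (\<forall>t\<in>{a..b}. f t = f a + set_lebesgue_integral lborel {a..t} g)"

lemma primitive_onD:
  assumes "primitive_on a b f g"
  shows "set_integrable lborel {a..b} g"
    and "t \<in> {a..b} \<Longrightarrow> f t = f a + set_lebesgue_integral lborel {a..t} g"
proof -
  show "set_integrable lborel {a..b} g"
    using assms unfolding primitive_on_def by (rule conjunct1)
  show "f t = f a + set_lebesgue_integral lborel {a..t} g" if "t \<in> {a..b}"
    using assms that unfolding primitive_on_def by (metis (no_types))
qed

lemma primitive_on_integrable_on:
  assumes "primitive_on a b f g" "t \<in> {a..b}"
  shows "g integrable_on {a..t}" "f t = f a + integral {a..t} g"
proof -
  have i: "set_integrable lborel {a..t} g"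
    by (rule set_integrable_subset[OF primitive_onD(1)[OF assms(1)]]) (use assms in auto)
  show "g integrable_on {a..t}" "f t = f a + integral {a..t} g"
    using set_borel_integral_eq_integral[OF i] primitive_onD(2)[OF assms] by auto
qed

lemma primitive_on_continuous_on:
  assumes "primitive_on a b f g"
  shows "continuous_on {a..b} f"
proof (cases "a \<le> b")
  case True
  have "continuous_on {a..b} (\<lambda>t. f a + integral {a..t} g)"
    by (intro continuous_intros indefinite_integral_continuous_1)
      (use primitive_on_integrable_on(1)[OF assms, of b] True in auto)
  then show ?thesis
    by (rule continuous_on_eq) (rule primitive_on_integrable_on(2)[OF assms, symmetric])
qed auto

lemma primitive_on_diff:
  assumes "primitive_on a b f g" "a \<le> s" "s \<le> t" "t \<le> b"
  shows "set_integrable lborel {s..t} g"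
    and "set_lebesgue_integral lborel {s..t} g = f t - f s"
proof -
  show i: "set_integrable lborel {s..t} g"
    by (rule set_integrable_subset[OF primitive_onD(1)[OF assms(1)]]) (use assms in auto)
  have "integral {a..s} g + integral {s..t} g = integral {a..t} g"
    by (rule Henstock_Kurzweil_Integration.integral_combine)
      (use assms primitive_on_integrable_on(1)[OF assms(1), of t] in auto)
  then show "set_lebesgue_integral lborel {s..t} g = f t - f s"
    using primitive_on_integrable_on(2)[OF assms(1), of s] primitive_on_integrable_on(2)[OF assms(1), of t]
      set_borel_integral_eq_integral(2)[OF i] assms by (auto simp: algebra_simps)
qed

lemma primitive_on_subinterval:
  assumes "primitive_on a b f g" "a \<le> c" "d \<le> b"
  shows "primitive_on c d f g"
proof (cases "c \<le> d")
  case True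
  have "f t = f c + set_lebesgue_integral lborel {c..t} g" if "t \<in> {c..d}" for t
    using primitive_on_diff(2)[OF assms(1), of c t] that assms(2,3) by auto
  then show ?thesis
    using primitive_on_diff(1)[OF assms(1), of c d] assms(2,3) True
    unfolding primitive_on_def by blast
qed (auto simp: primitive_on_def set_integrable_def)

lemma primitive_on_cong:
  assumes "primitive_on a b f g" "\<And>t. t \<in> {a..b} \<Longrightarrow> f t = f1 t" "\<And>t. t \<in> {a..b} \<Longrightarrow> g t = g1 t"
  shows "primitive_on a b f1 g1"
proof -
  have "set_integrable lborel {a..b} g1"
    using primitive_onD(1)[OF assms(1)] by (subst set_integrable_cong[OF refl refl assms(3)[symmetric]]) auto
  moreover have "set_lebesgue_integral lborel {a..t} g1 = set_lebesgue_integral lborel {a..t} g"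
    if "t \<in> {a..b}" for t
    using that assms(3) by (intro set_lebesgue_integral_cong) auto
  moreover have "f1 t = f1 a + set_lebesgue_integral lborel {a..t} g" if "t \<in> {a..b}" for t
    using primitive_onD(2)[OF assms(1) that] assms(2)[OF that] assms(2)[of a] that by auto
  ultimately show ?thesis
    unfolding primitive_on_def by metis
qed

lemma primitive_on_derivative:
  assumes "\<And>t. t \<in> {a..b} \<Longrightarrow> (f has_vector_derivative g t) (at t)" "continuous_on {a..b} g"
  shows "primitive_on a b f g"
  unfolding primitive_on_def
proof (intro conjI ballI)
  show i: "set_integrable lborel {a..b} g"
    using assms(2) by (rule borel_integrable_atLeastAtMost')
  fix t assume t: "t \<in> {a..b}"
  have it: "set_integrable lborel {a..t} g"
    by (rule set_integrable_subset[OF i]) (use t in auto)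
  have "(g has_integral (f t - f a)) {a..t}"
    by (rule fundamental_theorem_of_calculus)
      (use t assms(1) in \<open>auto intro: has_vector_derivative_at_within\<close>)
  then have "integral {a..t} g = f t - f a" by (rule integral_unique)
  then show "f t = f a + set_lebesgue_integral lborel {a..t} g"
    using set_borel_integral_eq_integral(2)[OF it] by simp
qed

lemma primitive_on_const: "primitive_on a b (\<lambda>t. c) (\<lambda>t. 0)"
  by (simp add: primitive_on_def set_integrable_def)

lemma primitive_on_add:
  assumes "primitive_on a b f f'" "primitive_on a b g g'"
  shows "primitive_on a b (\<lambda>t. f t + g t) (\<lambda>t. f' t + g' t)"
  unfolding primitive_on_def
proof (intro conjI ballI)
  show "set_integrable lborel {a..b} (\<lambda>t. f' t + g' t)"
    using primitive_onD(1)[OF assms(1)] primitive_onD(1)[OF assms(2)] by (rule set_integral_add)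
  fix t assume t: "t \<in> {a..b}"
  then have "set_lebesgue_integral lborel {a..t} (\<lambda>t. f' t + g' t)
      = set_lebesgue_integral lborel {a..t} f' + set_lebesgue_integral lborel {a..t} g'"
    using primitive_on_diff(1)[OF assms(1), of a t] primitive_on_diff(1)[OF assms(2), of a t]
    by (intro set_integral_add(2)) auto
  then show "f t + g t = f a + g a + set_lebesgue_integral lborel {a..t} (\<lambda>t. f' t + g' t)"
    using primitive_onD(2)[OF assms(1) t] primitive_onD(2)[OF assms(2) t] by simp
qed

lemma primitive_on_linear:
  assumes "primitive_on a b f g" "bounded_linear h"
  shows "primitive_on a b (\<lambda>t. h (f t)) (\<lambda>t. h (g t))"
proof -
  interpret bounded_linear h by fact
  have *: "indicat_real A x *\<^sub>R h (g x) = h (indicat_real A x *\<^sub>R g x)" for A x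
    by (simp add: scaleR)
  show ?thesis
    unfolding primitive_on_def
  proof (intro conjI ballI)
    show "set_integrable lborel {a..b} (\<lambda>t. h (g t))"
      using primitive_onD(1)[OF assms(1)] unfolding set_integrable_def *
      by (rule integrable_bounded_linear[OF assms(2)])
    fix t assume t: "t \<in> {a..b}"
    have "set_lebesgue_integral lborel {a..t} (\<lambda>t. h (g t)) = h (set_lebesgue_integral lborel {a..t} g)"
      using primitive_on_diff(1)[OF assms(1), of a t] t
      unfolding set_integrable_def set_lebesgue_integral_def *
      by (intro integral_bounded_linear[OF assms(2)]) auto
    then show "h (f t) = h (f a) + set_lebesgue_integral lborel {a..t} (\<lambda>t. h (g t))"
      using primitive_onD(2)[OF assms(1) t] by (simp add: add)
  qed
qed

lemma set_integrable_mult_continuous: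
  fixes f g :: "real \<Rightarrow> complex"
  assumes "set_integrable lborel {a..b} f" "continuous_on {a..b} g"
  shows "set_integrable lborel {a..b} (\<lambda>t. f t * g t)"
proof -
  obtain C where C: "\<And>t. t \<in> {a..b} \<Longrightarrow> norm (g t) \<le> C"
    using compact_imp_bounded[OF compact_continuous_image[OF assms(2)]]
    unfolding bounded_iff by (meson image_eqI compact_Icc)
  have "(\<lambda>t. indicator {a..b} t *\<^sub>R f t) \<in> borel_measurable lborel"
    using assms(1) by (auto simp: set_integrable_def)
  moreover have "(\<lambda>t. indicator {a..b} t *\<^sub>R g t) \<in> borel_measurable lborel"
    using borel_measurable_continuous_on_indicator[OF _ assms(2)] by simp
  ultimately have "(\<lambda>t. (indicator {a..b} t *\<^sub>R f t) * (indicator {a..b} t *\<^sub>R g t)) \<in> borel_measurable lborel"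
    by (rule borel_measurable_times)
  also have "(\<lambda>t. (indicator {a..b} t *\<^sub>R f t) * (indicator {a..b} t *\<^sub>R g t)) = (\<lambda>t. indicator {a..b} t *\<^sub>R (f t * g t))"
    by (auto simp: indicator_def)
  finally have m: "set_borel_measurable lborel {a..b} (\<lambda>t. f t * g t)"
    by (simp add: set_borel_measurable_def)
  have "set_integrable lborel {a..b} (\<lambda>t. f t * complex_of_real C)"
    using assms(1) by simp
  then show ?thesis
    by (rule set_integrable_bound[OF _ m])
      (auto simp: norm_mult intro!: AE_I2 mult_left_mono order_trans[OF C])
qed

text \<open>With derivatives that are merely integrable, the product rule comes from Fubini: f'(u)
  g'(v) is integrated over the triangle v \<le> u inside [a,t]^2 in both orders. The inner integrals
  are g(u) - g(a) and f(t) - f(v), and equating the two results is integration by parts.\<close>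

lemma primitive_on_mult:
  fixes f g :: "real \<Rightarrow> complex"
  assumes "primitive_on a b f f'" "primitive_on a b g g'"
  shows "primitive_on a b (\<lambda>t. f t * g t) (\<lambda>t. f' t * g t + f t * g' t)"
  unfolding primitive_on_def
proof (intro conjI ballI)
  note cf = primitive_on_continuous_on[OF assms(1)] and cg = primitive_on_continuous_on[OF assms(2)]
  have i1: "set_integrable lborel {a..b} (\<lambda>t. f' t * g t)"
    by (rule set_integrable_mult_continuous[OF primitive_onD(1)[OF assms(1)] cg])
  have i2: "set_integrable lborel {a..b} (\<lambda>t. f t * g' t)"
    using set_integrable_mult_continuous[OF primitive_onD(1)[OF assms(2)] cf] by (simp add: mult.commute)
  show "set_integrable lborel {a..b} (\<lambda>t. f' t * g t + f t * g' t)"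
    using i1 i2 by (rule set_integral_add)
  fix t assume t: "t \<in> {a..b}"
  define I where "I = {a..t}"
  have f'I: "set_integrable lborel I f'" and g'I: "set_integrable lborel I g'"
    and i1I: "set_integrable lborel I (\<lambda>t. f' t * g t)" and i2I: "set_integrable lborel I (\<lambda>t. f t * g' t)"
    unfolding I_def
    by (rule set_integrable_subset[of _ "{a..b}"]; use t i1 i2 primitive_onD(1)[OF assms(1)] primitive_onD(1)[OF assms(2)] in simp)+
  define F G where "F = (\<lambda>u. indicator I u *\<^sub>R f' u)" and "G = (\<lambda>v. indicator I v *\<^sub>R g' v)"
  have F: "integrable lborel F" and G: "integrable lborel G"
    using f'I g'I by (auto simp: F_def G_def set_integrable_def)
  note [measurable] = borel_measurable_integrable[OF F] borel_measurable_integrable[OF G]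
  have FG: "integrable (lborel \<Otimes>\<^sub>M lborel) (\<lambda>(u, v). F u * G v)"
    by (rule lborel_pair.Fubini_integrable) (use F G in \<open>auto simp: norm_mult\<close>)
  have "integrable (lborel \<Otimes>\<^sub>M lborel) (\<lambda>p. indicator {(u,v). v \<le> u} p *\<^sub>R (case p of (u, v) \<Rightarrow> F u * G v))"
  proof (rule integrable_mult_indicator[OF _ FG])
    have "{p \<in> space (lborel \<Otimes>\<^sub>M lborel). snd p \<le> (fst p :: real)} \<in> sets (lborel \<Otimes>\<^sub>M lborel)"
      by measurable
    then show "{(u, v). v \<le> (u :: real)} \<in> sets (lborel \<Otimes>\<^sub>M lborel)"
      by (simp add: space_pair_measure case_prod_unfold)
  qed
  then have K: "integrable (lborel \<Otimes>\<^sub>M lborel) (\<lambda>(u, v). indicator {..u} v *\<^sub>R (F u * G v))"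
    by (rule Bochner_Integration.integrable_cong[THEN iffD1, rotated 2]) (auto simp: indicator_def)
  have 1: "(\<integral>v. indicator {..u} v *\<^sub>R (F u * G v) \<partial>lborel) = indicator I u *\<^sub>R (f' u * (g u - g a))" for u
  proof (cases "u \<in> I")
    case True
    have "(\<integral>v. indicator {..u} v *\<^sub>R (F u * G v) \<partial>lborel) = (\<integral>v. f' u * (indicator {a..u} v *\<^sub>R g' v) \<partial>lborel)"
      by (rule Bochner_Integration.integral_cong) (use True in \<open>auto simp: F_def G_def I_def indicator_def\<close>)
    also have "\<dots> = f' u * set_lebesgue_integral lborel {a..u} g'"
      by (simp only: set_lebesgue_integral_def integral_mult_right_zero)
    also have "\<dots> = f' u * (g u - g a)"
      using primitive_onD(2)[OF assms(2), of u] True t by (simp add: I_def)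
    finally show ?thesis using True by simp
  qed (simp add: F_def)
  have 2: "(\<integral>u. indicator {..u} v *\<^sub>R (F u * G v) \<partial>lborel) = indicator I v *\<^sub>R ((f t - f v) * g' v)" for v
  proof (cases "v \<in> I")
    case True
    have "(\<integral>u. indicator {..u} v *\<^sub>R (F u * G v) \<partial>lborel) = (\<integral>u. (indicator {v..t} u *\<^sub>R f' u) * g' v \<partial>lborel)"
      by (rule Bochner_Integration.integral_cong) (use True in \<open>auto simp: F_def G_def I_def indicator_def\<close>)
    also have "\<dots> = set_lebesgue_integral lborel {v..t} f' * g' v"
      by (simp only: set_lebesgue_integral_def integral_mult_left_zero)
    also have "\<dots> = (f t - f v) * g' v"
      using primitive_on_diff(2)[OF assms(1), of v t] True t by (simp add: I_def)
    finally show ?thesis using True by simp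
  qed (simp add: G_def)
  have "(LINT u:I|lborel. f' u * (g u - g a)) = (LINT v:I|lborel. (f t - f v) * g' v)"
    using lborel_pair.Fubini_integral[OF K] unfolding 1 2 set_lebesgue_integral_def by simp
  moreover have "(LINT u:I|lborel. f' u * (g u - g a)) = (LINT u:I|lborel. f' u * g u) - (f t - f a) * g a"
  proof -
    have "(LINT u:I|lborel. f' u * (g u - g a)) = (LINT u:I|lborel. f' u * g u) - (LINT u:I|lborel. f' u * g a)"
      using i1I f'I by (subst set_integral_diff(2)[symmetric]) (auto simp: algebra_simps)
    also have "(LINT u:I|lborel. f' u * g a) = (LINT u:I|lborel. f' u) * g a" by simp
    also have "(LINT u:I|lborel. f' u) = f t - f a"
      using primitive_onD(2)[OF assms(1) t] by (simp add: I_def)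
    finally show ?thesis .
  qed
  moreover have "(LINT v:I|lborel. (f t - f v) * g' v) = f t * (g t - g a) - (LINT v:I|lborel. f v * g' v)"
  proof -
    have "(LINT v:I|lborel. (f t - f v) * g' v) = (LINT v:I|lborel. f t * g' v) - (LINT v:I|lborel. f v * g' v)"
      using i2I g'I by (subst set_integral_diff(2)[symmetric]) (auto simp: algebra_simps)
    also have "(LINT v:I|lborel. f t * g' v) = f t * (LINT v:I|lborel. g' v)" by simp
    also have "(LINT v:I|lborel. g' v) = g t - g a"
      using primitive_onD(2)[OF assms(2) t] by (simp add: I_def)
    finally show ?thesis .
  qed
  ultimately have "(LINT u:I|lborel. f' u * g u) - (f t - f a) * g a = f t * (g t - g a) - (LINT u:I|lborel. f u * g' u)"
    by metis
  then have "(LINT u:I|lborel. f' u * g u) + (LINT u:I|lborel. f u * g' u) = f t * g t - f a * g a"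
    by (simp add: algebra_simps)
  then show "f t * g t = f a * g a + (LINT t:{a..t}|lborel. f' t * g t + f t * g' t)"
    using set_integral_add(2)[OF i1I i2I] by (simp add: I_def)
qed

text \<open>The difference of the two derivatives integrates to 0 over every half-line, because both
  integrals are the same increment of \<open>f\<close>. Half-lines are stable under intersection and
  generate the Borel sets, so the integral vanishes on every Borel set.\<close>

lemma primitive_on_AE_unique:
  fixes g h :: "real \<Rightarrow> 'a::euclidean_space"
  assumes "primitive_on a b f g" "primitive_on a b f h" "a \<le> b"
  shows "AE t in lborel. t \<in> {a..b} \<longrightarrow> g t = h t"
proof -
  define e where "e = (\<lambda>t. indicator {a..b} t *\<^sub>R (g t - h t))"
  have i: "integrable lborel e"
    using primitive_onD(1)[OF assms(1)] primitive_onD(1)[OF assms(2)]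
    by (auto simp: e_def set_integrable_def scaleR_diff_right)
  have zero: "(LINT t:A|lborel. e t) = 0" if "A \<in> sets borel" for A
  proof -
    have *: "A \<in> sigma_sets UNIV (range atMost)"
      using that by (simp add: borel_eq_atMost sets_measure_of)
    have "Int_stable (range (atMost :: real \<Rightarrow> real set))"
      unfolding Int_stable_def by (metis (no_types, lifting) Int_atMost imageE rangeI)
    then show ?thesis
      using Pow_UNIV[THEN equalityD2, THEN subset_trans[OF subset_UNIV]] *
    proof (induction rule: sigma_sets_induct_disjoint)
      case (basic A)
      then obtain t where A: "A = {..t}" by auto
      have "(LINT t:A|lborel. e t) = (LINT s:{a..min b t}|lborel. g s - h s)"
        unfolding set_lebesgue_integral_def e_def A
        by (rule Bochner_Integration.integral_cong) (auto simp: indicator_def)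
      also have "\<dots> = 0"
      proof (cases "a \<le> min b t")
        case True
        then show ?thesis
          using primitive_on_diff[OF assms(1), of a "min b t"] primitive_on_diff[OF assms(2), of a "min b t"]
          by (simp add: set_integral_diff)
      qed (simp add: set_lebesgue_integral_def)
      finally show ?case .
    next
      case empty
      show ?case by (simp add: set_lebesgue_integral_def)
    next
      case (compl A)
      have "A \<in> sets borel" using compl(1) by (simp add: borel_eq_atMost sets_measure_of)
      have s: "set_integrable lborel B e" if "B \<in> sets borel" for B
        unfolding set_integrable_def by (rule integrable_mult_indicator[OF _ i]) (use that in simp)
      have "(LINT t:UNIV|lborel. e t) = (LINT t:A \<union> (UNIV - A)|lborel. e t)" by simp
      also have "\<dots> = (LINT t:A|lborel. e t) + (LINT t:UNIV - A|lborel. e t)"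
        by (rule set_integral_Un) (use \<open>A \<in> sets borel\<close> in \<open>auto intro!: s\<close>)
      moreover have "(LINT t:UNIV|lborel. e t) = (LINT s:{a..b}|lborel. g s - h s)"
        unfolding set_lebesgue_integral_def e_def by simp
      moreover have "\<dots> = 0"
        using primitive_on_diff[OF assms(1), of a b] primitive_on_diff[OF assms(2), of a b] assms(3)
        by (simp add: set_integral_diff)
      ultimately show ?case using compl(2) by simp
    next
      case (union A)
      have A: "A i \<in> sets borel" for i using union(2) by (auto simp: borel_eq_atMost sets_measure_of)
      have "(LINT t:\<Union>(range A)|lborel. e t) = (\<Sum>i. LINT t:A i|lborel. e t)"
      proof (rule lebesgue_integral_countable_add)
        show "A i \<inter> A j = {}" if "i \<noteq> j" for i j
          using union(1) that by (auto simp: disjoint_family_on_def)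
        show "set_integrable lborel (\<Union>(range A)) e"
          unfolding set_integrable_def by (rule integrable_mult_indicator[OF _ i]) (use A in simp)
      qed (use A in simp)
      then show ?case using union(3) by simp
    qed
  qed
  have "AE t in lborel. e t = 0"
    by (rule sigma_finite_measure.density_zero[OF sigma_finite_lborel i]) (use zero in simp)
  then show ?thesis by eventually_elim (auto simp: e_def)
qed

lemma primitive_on_cnj:
  assumes "primitive_on a b f f'"
  shows "primitive_on a b (\<lambda>t. cnj (f t)) (\<lambda>t. cnj (f' t))"
  using primitive_on_linear[OF assms bounded_linear_cnj] .

lemma primitive_on_Re:
  assumes "primitive_on a b f f'"
  shows "primitive_on a b (\<lambda>t. Re (f t)) (\<lambda>t. Re (f' t))"
  using primitive_on_linear[OF assms bounded_linear_Re] .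

lemma primitive_on_of_real:
  assumes "primitive_on a b f f'"
  shows "primitive_on a b (\<lambda>t. complex_of_real (f t)) (\<lambda>t. complex_of_real (f' t))"
  using primitive_on_linear[OF assms bounded_linear_of_real] .

lemma primitive_on_uminus:
  assumes "primitive_on a b f f'"
  shows "primitive_on a b (\<lambda>t. - f t) (\<lambda>t. - f' t)"
  using primitive_on_linear[OF assms bounded_linear_minus[OF bounded_linear_ident]] .

lemma primitive_on_minus:
  assumes "primitive_on a b f f'" "primitive_on a b g g'"
  shows "primitive_on a b (\<lambda>t. f t - g t) (\<lambda>t. f' t - g' t)"
  using primitive_on_add[OF assms(1) primitive_on_uminus[OF assms(2)]] by simp

lemma primitive_on_cmult:
  fixes f :: "real \<Rightarrow> complex"
  assumes "primitive_on a b f f'"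
  shows "primitive_on a b (\<lambda>t. c * f t) (\<lambda>t. c * f' t)"
  using primitive_on_linear[OF assms bounded_linear_mult_right] .

lemma primitive_on_real_derivative:
  assumes "\<And>t. t \<in> {a..b} \<Longrightarrow> (f has_real_derivative g t) (at t)" "continuous_on {a..b} g"
  shows "primitive_on a b f g"
  by (rule primitive_on_derivative) (use assms in \<open>auto simp: has_real_derivative_iff_has_vector_derivative\<close>)

lemma primitive_on_integral:
  assumes "primitive_on a b f g" "a \<le> b"
  shows "set_lebesgue_integral lborel {a..b} g = f b - f a"
  using primitive_onD(2)[OF assms(1), of b] assms(2) by simp

lemma set_integrable_continuous_real:
  fixes f :: "real \<Rightarrow> 'a::euclidean_space"
  assumes "continuous_on {a..b} f"
  shows "set_integrable lborel {a..b} f"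
  by (rule borel_integrable_atLeastAtMost'[OF assms])

lemma set_integral_nonneg:
  fixes f :: "real \<Rightarrow> real"
  assumes "\<And>t. t \<in> A \<Longrightarrow> 0 \<le> f t"
  shows "0 \<le> set_lebesgue_integral M A f"
  unfolding set_lebesgue_integral_def
  by (rule Bochner_Integration.integral_nonneg) (use assms in \<open>auto simp: indicator_def\<close>)

section \<open>The Wirtinger inequality on half a period\<close>

lemma nonneg_if_ge_all_small_multiples:
  fixes L M :: real
  assumes "\<And>e. 0 < e \<Longrightarrow> e \<le> 1 \<Longrightarrow> 0 \<le> L + e * M" "0 \<le> M"
  shows "0 \<le> L"
proof (rule tendsto_lowerbound)
  show "((\<lambda>e. L + e * M) \<longlongrightarrow> L) (at_right 0)"
    by (auto intro!: tendsto_eq_intros)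
  show "\<forall>\<^sub>F e in at_right 0. 0 \<le> L + e * M"
    unfolding eventually_at_right_field using assms(1) by (intro exI[of _ 1]) auto
qed simp

text \<open>Completing the square. Primed letters stand for conjugates and are treated as
  independent variables. With the derivative rules dF = G, dS = p C, dC = - p S and d\<Phi> = - (al
  + \<Phi>^2) p, the last bracket is the derivative of \<Phi> F F' - (A' F + A F') S - A A' S
  C.\<close>

lemma riccati_identity:
  fixes F F' G G' A A' p S C \<Phi> al :: complex
  assumes "p \<noteq> 0"
  shows "(G - A * p * S) * (G' - A' * p * S) / p - p * ((F + A * C) * (F' + A' * C))
      = (G - \<Phi> * p * F) * (G' - \<Phi> * p * F') / p - (1 - al) * p * (F * F')
      + ((- (al + \<Phi> * \<Phi>) * p * (F * F') + \<Phi> * (G * F' + F * G'))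
        - ((A' * G + A * G') * S + (A' * F + A * F') * (p * C))
        - A * A' * (p * C * C + S * (- p * S)))"
  using assms by (simp add: field_simps)

text \<open>The Riccati function \<open>-\<alpha> tan(\<alpha>(\<psi> - \<pi>/2))\<close> with \<open>\<alpha> < 1\<close> stays bounded on the closed
  interval, in contrast to its limit \<open>cot \<psi>\<close>; this costs the error term \<open>1 - \<alpha>\<^sup>2\<close>.\<close>

lemma antiperiodic_wirtinger:
  fixes f f' :: "real \<Rightarrow> complex" and \<psi> p :: "real \<Rightarrow> real"
  assumes f: "primitive_on a b f f'" and ab: "a \<le> b"
    and \<psi>: "\<And>t. t \<in> {a..b} \<Longrightarrow> (\<psi> has_real_derivative p t) (at t)"
    and p: "continuous_on {a..b} p" "\<And>t. t \<in> {a..b} \<Longrightarrow> 0 < p t"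
    and half: "\<psi> b = \<psi> a + pi" and anti: "f b = - f a"
    and int: "set_integrable lborel {a..b} (\<lambda>t. (norm (f' t))\<^sup>2 / p t)"
  shows "0 \<le> (LINT t:{a..b}|lborel. (norm (f' t))\<^sup>2 / p t - p t * (norm (f t))\<^sup>2)"
proof -
  define \<theta> where "\<theta> = (\<lambda>t. \<psi> t - \<psi> a)"
  have \<theta>_deriv: "(\<theta> has_real_derivative p t) (at t)" if "t \<in> {a..b}" for t
    unfolding \<theta>_def using \<psi>[OF that] by (auto intro!: derivative_eq_intros)
  have cont_\<theta>: "continuous_on {a..b} \<theta>"
    using \<theta>_deriv by (meson DERIV_isCont continuous_at_imp_continuous_on)
  have mono: "\<theta> s \<le> \<theta> t" if "a \<le> s" "s \<le> t" "t \<le> b" for s t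
  proof (rule DERIV_nonneg_imp_nondecreasing[OF that(2)])
    fix x assume "s \<le> x" "x \<le> t"
    then have "x \<in> {a..b}" using that by simp
    then show "\<exists>y. (\<theta> has_real_derivative y) (at x) \<and> 0 \<le> y"
      using \<theta>_deriv p(2) less_imp_le by blast
  qed
  have \<theta>_range: "0 \<le> \<theta> t" "\<theta> t \<le> pi" if "t \<in> {a..b}" for t
    using mono[of a t] mono[of t b] that half by (auto simp: \<theta>_def)
  define S C where "S = (\<lambda>t. complex_of_real (sin (\<theta> t)))" and "C = (\<lambda>t. complex_of_real (cos (\<theta> t)))"
  define P where "P = (\<lambda>t. complex_of_real (p t))"
  have S: "primitive_on a b S (\<lambda>t. P t * C t)"
  proof -
    have "primitive_on a b (\<lambda>t. sin (\<theta> t)) (\<lambda>t. p t * cos (\<theta> t))"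
      by (rule primitive_on_real_derivative)
        (use \<theta>_deriv p(1) cont_\<theta> in \<open>auto intro!: derivative_eq_intros continuous_intros\<close>)
    from primitive_on_of_real[OF this] show ?thesis by (simp add: S_def P_def C_def)
  qed
  have C: "primitive_on a b C (\<lambda>t. - P t * S t)"
  proof -
    have "primitive_on a b (\<lambda>t. cos (\<theta> t)) (\<lambda>t. - p t * sin (\<theta> t))"
      by (rule primitive_on_real_derivative)
        (use \<theta>_deriv p(1) cont_\<theta> in \<open>auto intro!: derivative_eq_intros continuous_intros\<close>)
    from primitive_on_of_real[OF this] show ?thesis by (simp add: S_def P_def C_def)
  qed
  \<comment> \<open>The cosine is itself antiperiodic over half a period, so subtracting its
    multiple with the same initial value turns the antiperiodic condition into vanishing at both
    ends.\<close>
  define F where "F = (\<lambda>t. f t - f a * C t)"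
  define G where "G = (\<lambda>t. f' t + f a * P t * S t)"
  have F: "primitive_on a b F G"
    using primitive_on_minus[OF f primitive_on_cmult[OF C, of "f a"]] by (simp add: F_def G_def algebra_simps)
  have ends: "F a = 0" "F b = 0" "S a = 0" "S b = 0"
    using half anti by (auto simp: F_def S_def C_def \<theta>_def)
  define M where "M = (LINT t:{a..b}|lborel. p t * (norm (F t))\<^sup>2)"
  define L where "L = (LINT t:{a..b}|lborel. (norm (f' t))\<^sup>2 / p t - p t * (norm (f t))\<^sup>2)"
  have M: "set_integrable lborel {a..b} (\<lambda>t. p t * (norm (F t))\<^sup>2)"
    by (intro set_integrable_continuous_real continuous_intros p(1) primitive_on_continuous_on[OF F])
  have Lint: "set_integrable lborel {a..b} (\<lambda>t. (norm (f' t))\<^sup>2 / p t - p t * (norm (f t))\<^sup>2)"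
    by (intro set_integral_diff(1)[OF int] set_integrable_continuous_real continuous_intros p(1) primitive_on_continuous_on[OF f])
  have main: "0 \<le> L + (1 - \<alpha>\<^sup>2) * M" if \<alpha>: "0 \<le> \<alpha>" "\<alpha> < 1" for \<alpha> :: real
  proof -
    define \<phi> where "\<phi> = (\<lambda>t. - \<alpha> * tan (\<alpha> * (\<theta> t - pi / 2)))"
    have cos_pos: "cos (\<alpha> * (\<theta> t - pi / 2)) > 0" if "t \<in> {a..b}" for t
    proof -
      have "\<bar>\<theta> t - pi / 2\<bar> \<le> pi / 2"
        unfolding abs_le_iff using \<theta>_range[OF that] by linarith
      then have "\<bar>\<alpha> * (\<theta> t - pi / 2)\<bar> \<le> \<alpha> * (pi / 2)"
        unfolding abs_mult using \<alpha> by (intro mult_mono) auto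
      also have "\<dots> < 1 * (pi / 2)" using \<alpha> by (intro mult_strict_right_mono) auto
      finally show ?thesis by (intro cos_gt_zero_pi) auto
    qed
    have cont_\<phi>: "continuous_on {a..b} \<phi>"
      unfolding \<phi>_def by (intro continuous_intros cont_\<theta> ballI) (use cos_pos in \<open>metis less_irrefl\<close>)
    have "primitive_on a b \<phi> (\<lambda>t. - (\<alpha>\<^sup>2 + \<phi> t * \<phi> t) * p t)"
    proof (rule primitive_on_real_derivative)
      fix t assume t: "t \<in> {a..b}"
      note cp = cos_pos[OF t]
      have "(\<phi> has_real_derivative - \<alpha> * (inverse ((cos (\<alpha> * (\<theta> t - pi / 2)))\<^sup>2) * (\<alpha> * p t))) (at t)"
        unfolding \<phi>_def using cp
        by (auto intro!: derivative_eq_intros DERIV_tan[THEN DERIV_chain2] \<theta>_deriv[OF t])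
      also have "inverse ((cos (\<alpha> * (\<theta> t - pi / 2)))\<^sup>2) = 1 + (tan (\<alpha> * (\<theta> t - pi / 2)))\<^sup>2"
        using tan_sec[of "\<alpha> * (\<theta> t - pi / 2)"] cp by (simp add: power_inverse)
      also have "- \<alpha> * ((1 + (tan (\<alpha> * (\<theta> t - pi / 2)))\<^sup>2) * (\<alpha> * p t)) = - (\<alpha>\<^sup>2 + \<phi> t * \<phi> t) * p t"
        by (simp add: \<phi>_def power2_eq_square algebra_simps)
      finally show "(\<phi> has_real_derivative - (\<alpha>\<^sup>2 + \<phi> t * \<phi> t) * p t) (at t)" .
    qed (intro continuous_intros cont_\<phi> p(1))
    from primitive_on_of_real[OF this]
    have \<Phi>: "primitive_on a b (\<lambda>t. complex_of_real (\<phi> t)) (\<lambda>t. - (of_real (\<alpha>\<^sup>2) + of_real (\<phi> t) * of_real (\<phi> t)) * P t)"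
      by (simp add: P_def)
    \<comment> \<open>The exact part of \<open>riccati_identity\<close>. Its primitive contains a
      factor \<open>F\<close> or \<open>S\<close> in every term, hence vanishes at both ends, and
      \<open>Re (D t)\<close> integrates to 0.\<close>
    define D where "D = (\<lambda>t. (- (of_real (\<alpha>\<^sup>2) + of_real (\<phi> t) * of_real (\<phi> t)) * P t * (F t * cnj (F t))
            + of_real (\<phi> t) * (G t * cnj (F t) + F t * cnj (G t)))
          - ((cnj (f a) * G t + f a * cnj (G t)) * S t + (cnj (f a) * F t + f a * cnj (F t)) * (P t * C t))
          - f a * cnj (f a) * (P t * C t * C t + S t * (- P t * S t)))"
    have B: "primitive_on a b (\<lambda>t. of_real (\<phi> t) * (F t * cnj (F t))
          - (cnj (f a) * F t + f a * cnj (F t)) * S t - f a * cnj (f a) * (S t * C t)) D"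
      unfolding D_def
      by (intro primitive_on_minus primitive_on_mult[OF \<Phi>] primitive_on_mult primitive_on_cmult
          primitive_on_add F primitive_on_cnj S C)
    have "primitive_on a b (\<lambda>t. Re (of_real (\<phi> t) * (F t * cnj (F t))
          - (cnj (f a) * F t + f a * cnj (F t)) * S t - f a * cnj (f a) * (S t * C t))) (\<lambda>t. Re (D t))"
      by (rule primitive_on_Re[OF B])
    from primitive_onD(1)[OF this] primitive_on_integral[OF this ab]
    have D: "set_integrable lborel {a..b} (\<lambda>t. Re (D t))" "(LINT t:{a..b}|lborel. Re (D t)) = 0"
      by (simp_all add: ends)
    have pt: "(norm (f' t))\<^sup>2 / p t - p t * (norm (f t))\<^sup>2 + (1 - \<alpha>\<^sup>2) * (p t * (norm (F t))\<^sup>2) - Re (D t)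
        = (norm (G t - of_real (\<phi> t) * P t * F t))\<^sup>2 / p t" if "t \<in> {a..b}" for t
    proof -
      have "P t \<noteq> 0" using p(2)[OF that] by (simp add: P_def)
      have "complex_of_real ((norm (f' t))\<^sup>2 / p t - p t * (norm (f t))\<^sup>2)
         = f' t * cnj (f' t) / P t - P t * (f t * cnj (f t))"
        by (simp only: of_real_diff of_real_divide of_real_mult complex_norm_square P_def)
      also have "\<dots> = (G t - f a * P t * S t) * (cnj (G t) - cnj (f a) * P t * S t) / P t
          - P t * ((F t + f a * C t) * (cnj (F t) + cnj (f a) * C t))"
        by (simp add: G_def F_def P_def S_def C_def)
      also have "\<dots> = (G t - of_real (\<phi> t) * P t * F t) * cnj (G t - of_real (\<phi> t) * P t * F t) / P t
         - (1 - of_real (\<alpha>\<^sup>2)) * P t * (F t * cnj (F t)) + D t"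
        unfolding D_def riccati_identity[OF \<open>P t \<noteq> 0\<close>, where al = "of_real (\<alpha>\<^sup>2)" and \<Phi> = "of_real (\<phi> t)"]
        by (simp add: P_def)
      also have "(G t - of_real (\<phi> t) * P t * F t) * cnj (G t - of_real (\<phi> t) * P t * F t) / P t
         - (1 - of_real (\<alpha>\<^sup>2)) * P t * (F t * cnj (F t))
         = of_real ((norm (G t - of_real (\<phi> t) * P t * F t))\<^sup>2 / p t - (1 - \<alpha>\<^sup>2) * p t * (norm (F t))\<^sup>2)"
        by (simp only: of_real_diff of_real_divide of_real_mult complex_norm_square P_def of_real_1)
      finally have "(norm (f' t))\<^sup>2 / p t - p t * (norm (f t))\<^sup>2
         = (norm (G t - of_real (\<phi> t) * P t * F t))\<^sup>2 / p t - (1 - \<alpha>\<^sup>2) * p t * (norm (F t))\<^sup>2 + Re (D t)"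
        by (metis Re_complex_of_real plus_complex.sel(1))
      then show ?thesis by (simp only: mult.assoc)
    qed
    have "0 \<le> (LINT t:{a..b}|lborel. (norm (f' t))\<^sup>2 / p t - p t * (norm (f t))\<^sup>2
        + (1 - \<alpha>\<^sup>2) * (p t * (norm (F t))\<^sup>2) - Re (D t))"
    proof (rule set_integral_nonneg)
      fix t assume t: "t \<in> {a..b}"
      show "0 \<le> (norm (f' t))\<^sup>2 / p t - p t * (norm (f t))\<^sup>2 + (1 - \<alpha>\<^sup>2) * (p t * (norm (F t))\<^sup>2) - Re (D t)"
        unfolding pt[OF t] using p(2)[OF t] by simp
    qed
    also have "\<dots> = L + (1 - \<alpha>\<^sup>2) * M"
      using Lint M D by (simp add: set_integral_diff set_integral_add L_def M_def)
    finally show ?thesis .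
  qed
  have "0 \<le> L"
  proof (rule nonneg_if_ge_all_small_multiples)
    show "0 \<le> M" unfolding M_def
      by (intro set_integral_nonneg mult_nonneg_nonneg) (use p(2) in \<open>auto intro: less_imp_le\<close>)
    fix e :: real assume "0 < e" "e \<le> 1"
    \<comment> \<open>With this \<alpha> the coefficient \<open>1 - \<alpha>\<^sup>2\<close> equals
      \<open>e\<close>, so letting \<open>e\<close> tend to 0 removes the error term.\<close>
    then show "0 \<le> L + e * M" using main[of "sqrt (1 - e)"] by (simp add: real_sqrt_lt_1_iff)
  qed
  then show ?thesis by (simp add: L_def)
qed

section \<open>The second variation in Levi-Civita coordinates\<close>

text \<open>Conjugates are separate variables here, which makes the claim a rational identity. In
  the application \<open>y\<close> is \<xi>/(2z), \<open>Y\<close> its time derivative,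
  \<open>b\<close> is \<beta>^2, \<open>K\<close> is \<kappa> by the energy relation and
  \<open>N\<close> is the derivative of \<open>n\<close>. The right side consists of the oscillator
  form in the variation y + n w, an exact derivative, and the remainder in c^2.\<close>

lemma kepler_identity:
  fixes z zb w wb y yb Y Yb n c b N K :: complex
  assumes nz: "z \<noteq> 0" "zb \<noteq> 0"
    and N: "N = ((z * yb + zb * y) / (z * zb) - c) / (z * zb)"
    and K: "K = 2 * w * wb + 2 * b * z * zb"
  shows "(2 * w * y / (z * zb) + 2 * z * Y) * (2 * wb * yb / (z * zb) + 2 * zb * Yb)
      + K * (3 * (z * yb + zb * y)^2 / (z * zb)^3 - 4 * y * yb / (z * zb)^2)
    = 4 * (z * zb * ((Y + N * w - n * b / zb) * (Yb + N * wb - n * b / z))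
        - b * ((y + n * w) * (yb + n * wb)) / (z * zb))
    + 4 * (- ((- b * y^2 / z^2 - w * wb * y^2 / (z^3 * zb) + 2 * wb * y * Y / z)
            + (- b * yb^2 / zb^2 - w * wb * yb^2 / (zb^3 * z) + 2 * w * yb * Yb / zb)) / 2
        + b * (N * (y * zb + yb * z) + n * (Y * zb + y * wb / (z * zb) + Yb * z + yb * w / (z * zb))
            + n * N * (z * wb + zb * w) + n^2 * (w * wb / (z * zb) - b))
        + c * (Y * wb - y * b / z + Yb * w - yb * b / zb) + c * K * N)
    + 4 * c^2 * (w * wb + 2 * b * z * zb) / (z * zb)"
  unfolding N K using nz
  by (simp add: divide_simps) algebra

lemma primitive_on_cong_derivative:
  assumes "primitive_on a b f g" "\<And>t. t \<in> {a..b} \<Longrightarrow> g t = g1 t"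
  shows "primitive_on a b f g1"
  by (rule primitive_on_cong[OF assms(1) refl assms(2)])

text \<open>\<open>w\<close> is the derivative of \<open>z\<close> in the fictitious time ds =
  dt/|z|^2, so the two differential equations say z'' = - \<beta>^2 z. The last assumption is
  conservation of the Kepler energy -2 \<beta>^2 = |v|^2/2 - \<kappa>/|x|, rewritten with x = z^2
  and |v|^2 = 4 |w|^2/|z|^2.\<close>

locale kepler_frame =
  fixes z w :: "real \<Rightarrow> complex" and \<beta> \<kappa> :: real
  assumes z_nonzero: "z t \<noteq> 0"
    and z_deriv: "(z has_vector_derivative w t / of_real ((norm (z t))\<^sup>2)) (at t)"
    and w_deriv: "(w has_vector_derivative - of_real (\<beta>\<^sup>2) * z t / of_real ((norm (z t))\<^sup>2)) (at t)"
    and energy: "2 * (norm (w t))\<^sup>2 + 2 * \<beta>\<^sup>2 * (norm (z t))\<^sup>2 = \<kappa>"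
begin

definition r :: "real \<Rightarrow> real" where "r t = (norm (z t))\<^sup>2"

lemma r_pos: "0 < r t"
  using z_nonzero[of t] by (simp add: r_def)

lemma of_real_r: "complex_of_real (r t) = z t * cnj (z t)"
  unfolding r_def by (rule complex_norm_square)

lemma continuous_z: "continuous_on A z"
  using z_deriv by (meson has_vector_derivative_continuous continuous_at_imp_continuous_on)

lemma continuous_w: "continuous_on A w"
  using w_deriv by (meson has_vector_derivative_continuous continuous_at_imp_continuous_on)

lemma continuous_r: "continuous_on A r"
  unfolding r_def by (intro continuous_intros continuous_z)

lemma primitive_z: "primitive_on a b z (\<lambda>t. w t / (z t * cnj (z t)))"
  by (rule primitive_on_derivative)
    (use z_deriv[unfolded complex_norm_square] z_nonzero in \<open>auto intro!: continuous_intros continuous_w continuous_z\<close>)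

lemma primitive_w: "primitive_on a b w (\<lambda>t. - of_real (\<beta>\<^sup>2) / cnj (z t))"
proof (rule primitive_on_derivative)
  fix t
  have "- of_real (\<beta>\<^sup>2) * z t / of_real ((norm (z t))\<^sup>2) = - of_real (\<beta>\<^sup>2) / cnj (z t)"
    using z_nonzero[of t] by (simp add: complex_norm_square[of "z t"] del: of_real_power)
  then show "(w has_vector_derivative - of_real (\<beta>\<^sup>2) / cnj (z t)) (at t)"
    using w_deriv[of t] by metis
qed (use z_nonzero in \<open>auto intro!: continuous_intros continuous_z\<close>)

lemma primitive_inverse_z: "primitive_on a b (\<lambda>t. 1 / z t) (\<lambda>t. - w t / (z t ^ 3 * cnj (z t)))"
proof (rule primitive_on_derivative)
  fix t
  have "((inverse \<circ> z) has_vector_derivative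
      w t / of_real ((norm (z t))\<^sup>2) * - (inverse (z t) ^ Suc (Suc 0))) (at t)"
    by (rule field_vector_diff_chain_at[OF z_deriv DERIV_inverse]) (rule z_nonzero)
  moreover have "w t / of_real ((norm (z t))\<^sup>2) * - (inverse (z t) ^ Suc (Suc 0)) = - w t / (z t ^ 3 * cnj (z t))"
    unfolding complex_norm_square[of "z t"] using z_nonzero[of t]
    by (simp add: divide_simps power3_eq_cube)
  moreover have "inverse \<circ> z = (\<lambda>t. 1 / z t)" by (auto simp: divide_simps)
  ultimately show "((\<lambda>t. 1 / z t) has_vector_derivative - w t / (z t ^ 3 * cnj (z t))) (at t)"
    by simp
qed (use z_nonzero in \<open>auto intro!: continuous_intros continuous_z continuous_w\<close>)

text \<open>For a variation \<open>\<xi>\<close> of \<open>x = z\<^sup>2\<close>, \<open>zeta\<close> is the induced variation of \<open>z\<close> at fixed normalised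
  Levi-Civita time \<open>s / S\<close>, where \<open>ds = dt / |x|\<close> and \<open>S\<close> is the total \<open>s\<close>-time; here \<open>r n\<close> is the
  variation of \<open>t\<close> and \<open>c\<close> accounts for the variation of \<open>S\<close>.\<close>

definition n_deriv :: "(real \<Rightarrow> complex) \<Rightarrow> real \<Rightarrow> real \<Rightarrow> real" where
  "n_deriv \<xi> c t = Re (cnj (z t ^ 2) * \<xi> t) / r t ^ 3 - c / r t"

definition zeta :: "(real \<Rightarrow> complex) \<Rightarrow> (real \<Rightarrow> real) \<Rightarrow> real \<Rightarrow> complex" where
  "zeta \<xi> n t = \<xi> t / (2 * z t) + of_real (n t) * w t"

definition zeta_deriv ::
    "(real \<Rightarrow> complex) \<Rightarrow> (real \<Rightarrow> complex) \<Rightarrow> (real \<Rightarrow> real) \<Rightarrow> real \<Rightarrow> real \<Rightarrow> complex" where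
  "zeta_deriv \<xi> g n c t = g t / (2 * z t) - \<xi> t * w t / (2 * z t ^ 3 * cnj (z t))
     + of_real (n_deriv \<xi> c t) * w t - of_real (n t) * of_real (\<beta>\<^sup>2) / cnj (z t)"

lemma primitive_zeta:
  assumes "primitive_on a b \<xi> g" "primitive_on a b n (n_deriv \<xi> c)"
  shows "primitive_on a b (zeta \<xi> n) (zeta_deriv \<xi> g n c)"
proof -
  have "primitive_on a b (\<lambda>t. (1/2) * (\<xi> t * (1 / z t)) + of_real (n t) * w t)
    (\<lambda>t. (1/2) * (g t * (1 / z t) + \<xi> t * (- w t / (z t ^ 3 * cnj (z t))))
       + (of_real (n_deriv \<xi> c t) * w t + of_real (n t) * (- of_real (\<beta>\<^sup>2) / cnj (z t))))"
    by (intro primitive_on_add primitive_on_cmult primitive_on_mult primitive_on_of_real assms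
        primitive_inverse_z primitive_w)
  then show ?thesis
    by (rule primitive_on_cong) (auto simp: zeta_def zeta_deriv_def algebra_simps diff_divide_distrib add_divide_distrib)
qed

text \<open>For x = z^2 and \<kappa> = m/\<mu> this is the integrand of the second variation divided
  by \<mu>.\<close>

definition index_form :: "real \<Rightarrow> (real \<Rightarrow> complex) \<Rightarrow> complex \<Rightarrow> real" where
  "index_form t \<xi> g = (norm g)\<^sup>2 + \<kappa> * (3 * (Re (cnj (z t ^ 2) * \<xi> t))\<^sup>2 / r t ^ 5 - (norm (\<xi> t))\<^sup>2 / r t ^ 3)"

text \<open>\<open>kepler_identity\<close> is integrated over the period. Although \<open>c\<close>
  is left free in the statement, the condition \<open>n \<tau> = n 0\<close> forces it to be the
  ratio of the integrals of <x, \<xi>>/r^3 and 1/r, that is, minus the relative change of the total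
  fictitious time.\<close>

lemma index_form_identity:
  assumes \<xi>: "primitive_on 0 \<tau> \<xi> g" and n: "primitive_on 0 \<tau> n (n_deriv \<xi> c)" and \<tau>: "0 \<le> \<tau>"
    and per: "\<xi> \<tau> = \<xi> 0" "n \<tau> = n 0" "z \<tau> = z 0 \<and> w \<tau> = w 0 \<or> z \<tau> = - z 0 \<and> w \<tau> = - w 0"
    and g2: "set_integrable lborel {0..\<tau>} (\<lambda>t. (norm (g t))\<^sup>2)"
  shows "set_integrable lborel {0..\<tau>} (\<lambda>t. r t * (norm (zeta_deriv \<xi> g n c t))\<^sup>2)"
    and "(LINT t:{0..\<tau>}|lborel. index_form t \<xi> (g t))
      = 4 * (LINT t:{0..\<tau>}|lborel. r t * (norm (zeta_deriv \<xi> g n c t))\<^sup>2 - \<beta>\<^sup>2 * (norm (zeta \<xi> n t))\<^sup>2 / r t)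
      + 4 * c\<^sup>2 * (LINT t:{0..\<tau>}|lborel. ((norm (w t))\<^sup>2 + 2 * \<beta>\<^sup>2 * r t) / r t)"
proof -
  define y where "y = (\<lambda>t. \<xi> t / (2 * z t))"
  define Y where "Y = (\<lambda>t. g t / (2 * z t) - \<xi> t * w t / (2 * z t ^ 3 * cnj (z t)))"
  define N where "N = (\<lambda>t. complex_of_real (n_deriv \<xi> c t))"
  have y: "primitive_on 0 \<tau> y Y"
  proof -
    have "primitive_on 0 \<tau> (\<lambda>t. (1/2) * (\<xi> t * (1 / z t)))
      (\<lambda>t. (1/2) * (g t * (1 / z t) + \<xi> t * (- w t / (z t ^ 3 * cnj (z t)))))"
      by (intro primitive_on_cmult primitive_on_mult \<xi> primitive_inverse_z)
    then show ?thesis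
      by (rule primitive_on_cong) (auto simp: y_def Y_def algebra_simps diff_divide_distrib)
  qed
  have nN: "primitive_on 0 \<tau> (\<lambda>t. complex_of_real (n t)) N"
    using primitive_on_of_real[OF n] by (simp add: N_def)
  define b where "b = complex_of_real (\<beta>\<^sup>2)"
  have w: "primitive_on 0 \<tau> w (\<lambda>t. - b / cnj (z t))"
    unfolding b_def by (rule primitive_w)
  \<comment> \<open>The potential of the exact part of \<open>kepler_identity\<close>;
    \<open>B'\<close> repeats that part verbatim so that the identity applies literally.\<close>
  define B where "B = (\<lambda>t. - ((cnj (w t) * (1 / z t)) * (y t * y t) + (w t * cnj (1 / z t)) * (cnj (y t) * cnj (y t))) / 2
     + b * (of_real (n t) * (y t * cnj (z t) + cnj (y t) * z t)
          + (of_real (n t) * of_real (n t)) * (z t * cnj (w t) + cnj (z t) * w t) / 2)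
     + of_real c * (y t * cnj (w t) + cnj (y t) * w t) + of_real c * of_real \<kappa> * of_real (n t))"
  define B' where "B' = (\<lambda>t. - ((- b * y t ^ 2 / z t ^ 2 - w t * cnj (w t) * y t ^ 2 / (z t ^ 3 * cnj (z t)) + 2 * cnj (w t) * y t * Y t / z t)
            + (- b * cnj (y t)^2 / cnj (z t)^2 - w t * cnj (w t) * cnj (y t)^2 / (cnj (z t)^3 * z t) + 2 * w t * cnj (y t) * cnj (Y t) / cnj (z t))) / 2
        + b * (N t * (y t * cnj (z t) + cnj (y t) * z t) + of_real (n t) * (Y t * cnj (z t) + y t * cnj (w t) / (z t * cnj (z t)) + cnj (Y t) * z t + cnj (y t) * w t / (z t * cnj (z t)))
            + of_real (n t) * N t * (z t * cnj (w t) + cnj (z t) * w t) + of_real (n t)^2 * (w t * cnj (w t) / (z t * cnj (z t)) - b))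
        + of_real c * (Y t * cnj (w t) - y t * b / z t + cnj (Y t) * w t - cnj (y t) * b / cnj (z t)) + of_real c * of_real \<kappa> * N t)"
  have B: "primitive_on 0 \<tau> B B'"
  proof -
    have half: "primitive_on 0 \<tau> (\<lambda>t. f t / 2) (\<lambda>t. f' t / 2)" if "primitive_on 0 \<tau> f f'" for f f' :: "real \<Rightarrow> complex"
      using primitive_on_cmult[OF that, of "1/2"] by simp
    note rules = y nN w primitive_z primitive_inverse_z primitive_on_const half primitive_on_mult
          primitive_on_add primitive_on_uminus primitive_on_cnj
    have nz: "z t \<noteq> 0" "cnj (z t) \<noteq> 0" for t using z_nonzero by auto
    have "primitive_on 0 \<tau> (\<lambda>t. (cnj (w t) * (1 / z t)) * (y t * y t))
       (\<lambda>t. - b * y t ^ 2 / z t ^ 2 - w t * cnj (w t) * y t ^ 2 / (z t ^ 3 * cnj (z t)) + 2 * cnj (w t) * y t * Y t / z t)"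
      apply (rule primitive_on_cong_derivative)
       apply (rule rules)+
      using nz by (simp add: b_def field_simps power2_eq_square power3_eq_cube)
    note p1 = this primitive_on_cnj[OF this]
    have p2: "primitive_on 0 \<tau> (\<lambda>t. of_real (n t) * (y t * cnj (z t) + cnj (y t) * z t))
      (\<lambda>t. N t * (y t * cnj (z t) + cnj (y t) * z t) + of_real (n t) * (Y t * cnj (z t) + y t * cnj (w t) / (z t * cnj (z t)) + cnj (Y t) * z t + cnj (y t) * w t / (z t * cnj (z t))))"
      apply (rule primitive_on_cong_derivative)
       apply (rule rules)+
      using nz by (simp add: field_simps)
    have p3: "primitive_on 0 \<tau> (\<lambda>t. (of_real (n t) * of_real (n t)) * (z t * cnj (w t) + cnj (z t) * w t) / 2)
      (\<lambda>t. of_real (n t) * N t * (z t * cnj (w t) + cnj (z t) * w t) + of_real (n t)^2 * (w t * cnj (w t) / (z t * cnj (z t)) - b))"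
      apply (rule primitive_on_cong_derivative)
       apply (rule rules)+
      using nz by (simp add: b_def field_simps power2_eq_square)
    have p4: "primitive_on 0 \<tau> (\<lambda>t. y t * cnj (w t) + cnj (y t) * w t)
      (\<lambda>t. Y t * cnj (w t) - y t * b / z t + cnj (Y t) * w t - cnj (y t) * b / cnj (z t))"
      apply (rule primitive_on_cong_derivative)
       apply (rule rules)+
      using nz by (simp add: b_def field_simps)
    have "primitive_on 0 \<tau> (\<lambda>t. - ((cnj (w t) * (1 / z t)) * (y t * y t) + cnj ((cnj (w t) * (1 / z t)) * (y t * y t))) / 2
     + b * (of_real (n t) * (y t * cnj (z t) + cnj (y t) * z t)
          + (of_real (n t) * of_real (n t)) * (z t * cnj (w t) + cnj (z t) * w t) / 2)
     + of_real c * (y t * cnj (w t) + cnj (y t) * w t) + of_real c * of_real \<kappa> * of_real (n t)) B'"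
      apply (rule primitive_on_cong_derivative)
       apply (rule p1 p2 p3 p4 nN half primitive_on_uminus primitive_on_cmult primitive_on_add)+
      by (simp add: B'_def b_def mult.commute mult.left_commute)
    then show ?thesis by (rule primitive_on_cong) (simp_all add: B_def)
  qed
  define E where "E = (\<lambda>t. ((norm (w t))\<^sup>2 + 2 * \<beta>\<^sup>2 * r t) / r t)"
  define A where "A = (\<lambda>t. \<beta>\<^sup>2 * (norm (zeta \<xi> n t))\<^sup>2 / r t)"
  have pt: "index_form t \<xi> (g t) = 4 * (r t * (norm (zeta_deriv \<xi> g n c t))\<^sup>2 - A t) + 4 * Re (B' t) + 4 * c\<^sup>2 * E t" for t
  proof -
    have nz: "z t \<noteq> 0" "cnj (z t) \<noteq> 0" using z_nonzero by auto
    have \<xi>_eq: "\<xi> t = 2 * z t * y t" using nz by (simp add: y_def)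
    have g_eq: "g t = 2 * w t * y t / (z t * cnj (z t)) + 2 * z t * Y t"
      using nz by (simp add: y_def Y_def field_simps power3_eq_cube)
    have Re_eq: "complex_of_real (Re u) = (u + cnj u) / 2" for u
      by (simp add: complex_add_cnj)
    have re: "complex_of_real (Re (cnj (z t ^ 2) * \<xi> t)) = (z t * cnj (z t)) * (z t * cnj (y t) + cnj (z t) * y t)"
      unfolding Re_eq \<xi>_eq by (simp add: power2_eq_square algebra_simps)
    have N_eq: "N t = ((z t * cnj (y t) + cnj (z t) * y t) / (z t * cnj (z t)) - of_real c) / (z t * cnj (z t))"
      unfolding N_def n_deriv_def of_real_diff of_real_divide re of_real_power of_real_r
      using nz by (simp add: divide_simps power3_eq_cube)
    have K_eq: "complex_of_real \<kappa> = 2 * w t * cnj (w t) + 2 * b * z t * cnj (z t)"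
      unfolding energy[of t, symmetric] of_real_add of_real_mult complex_norm_square b_def by simp
    have xi2: "complex_of_real ((norm (\<xi> t))\<^sup>2) = 4 * (z t * cnj (z t)) * (y t * cnj (y t))"
      unfolding complex_norm_square \<xi>_eq by simp
    have idx: "complex_of_real (index_form t \<xi> (g t)) = g t * cnj (g t)
       + of_real \<kappa> * (3 * (z t * cnj (y t) + cnj (z t) * y t)^2 / (z t * cnj (z t))^3 - 4 * y t * cnj (y t) / (z t * cnj (z t))^2)"
    proof -
      have "complex_of_real (index_form t \<xi> (g t)) = complex_of_real ((norm (g t))\<^sup>2)
         + of_real \<kappa> * (3 * (complex_of_real (Re (cnj (z t ^ 2) * \<xi> t)))\<^sup>2 / complex_of_real (r t) ^ 5
           - complex_of_real ((norm (\<xi> t))\<^sup>2) / complex_of_real (r t) ^ 3)"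
        by (simp add: index_form_def)
      also have "\<dots> = g t * cnj (g t)
         + of_real \<kappa> * (3 * (z t * cnj (y t) + cnj (z t) * y t)^2 / (z t * cnj (z t))^3 - 4 * y t * cnj (y t) / (z t * cnj (z t))^2)"
        unfolding re xi2 of_real_r complex_norm_square[of "g t"]
      proof -
        have "3 * (R * u)\<^sup>2 / R ^ 5 - 4 * R * v / R ^ 3 = 3 * u\<^sup>2 / R ^ 3 - 4 * v / R\<^sup>2" if "R \<noteq> 0" for R u v :: complex
          using that by (simp add: field_simps power_numeral_reduce)
        from this[of "z t * cnj (z t)" "z t * cnj (y t) + cnj (z t) * y t" "y t * cnj (y t)"] nz
        show "g t * cnj (g t) + of_real \<kappa> * (3 * (z t * cnj (z t) * (z t * cnj (y t) + cnj (z t) * y t))\<^sup>2 / (z t * cnj (z t)) ^ 5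
            - 4 * (z t * cnj (z t)) * (y t * cnj (y t)) / (z t * cnj (z t)) ^ 3)
          = g t * cnj (g t) + of_real \<kappa> * (3 * (z t * cnj (y t) + cnj (z t) * y t)^2 / (z t * cnj (z t))^3
            - 4 * y t * cnj (y t) / (z t * cnj (z t))^2)"
          by (simp only: mult.assoc) simp
      qed
      finally show ?thesis .
    qed
    have gg: "g t * cnj (g t) = (2 * w t * y t / (z t * cnj (z t)) + 2 * z t * Y t)
      * (2 * cnj (w t) * cnj (y t) / (z t * cnj (z t)) + 2 * cnj (z t) * cnj (Y t))"
      unfolding g_eq by simp
    have zeta_eqs: "Y t + N t * w t - of_real (n t) * b / cnj (z t) = zeta_deriv \<xi> g n c t"
      "cnj (Y t) + N t * cnj (w t) - of_real (n t) * b / z t = cnj (zeta_deriv \<xi> g n c t)"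
      "y t + of_real (n t) * w t = zeta \<xi> n t"
      "cnj (y t) + of_real (n t) * cnj (w t) = cnj (zeta \<xi> n t)"
      by (simp_all add: zeta_deriv_def zeta_def y_def Y_def N_def b_def)
    note identity = kepler_identity[OF nz N_eq K_eq, where Y = "Y t" and Yb = "cnj (Y t)" and n = "of_real (n t)",
        unfolded zeta_eqs]
    have "complex_of_real (index_form t \<xi> (g t))
      = 4 * (z t * cnj (z t) * (zeta_deriv \<xi> g n c t * cnj (zeta_deriv \<xi> g n c t))
          - b * (zeta \<xi> n t * cnj (zeta \<xi> n t)) / (z t * cnj (z t))) + 4 * B' t
        + 4 * (of_real c)\<^sup>2 * (w t * cnj (w t) + 2 * b * z t * cnj (z t)) / (z t * cnj (z t))"
      unfolding idx gg B'_def by (rule identity)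
    also have "4 * (z t * cnj (z t) * (zeta_deriv \<xi> g n c t * cnj (zeta_deriv \<xi> g n c t))
          - b * (zeta \<xi> n t * cnj (zeta \<xi> n t)) / (z t * cnj (z t)))
      = of_real (4 * (r t * (norm (zeta_deriv \<xi> g n c t))\<^sup>2 - A t))"
      unfolding A_def b_def of_real_mult of_real_diff of_real_divide of_real_r complex_norm_square by simp
    also have "4 * (of_real c)\<^sup>2 * (w t * cnj (w t) + 2 * b * z t * cnj (z t)) / (z t * cnj (z t)) = of_real (4 * c\<^sup>2 * E t)"
      unfolding E_def b_def of_real_mult of_real_add of_real_divide of_real_r complex_norm_square by simp
    finally have "complex_of_real (index_form t \<xi> (g t))
      = of_real (4 * (r t * (norm (zeta_deriv \<xi> g n c t))\<^sup>2 - A t)) + 4 * B' t + of_real (4 * c\<^sup>2 * E t)" .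
    then have "Re (complex_of_real (index_form t \<xi> (g t)))
      = Re (of_real (4 * (r t * (norm (zeta_deriv \<xi> g n c t))\<^sup>2 - A t)) + 4 * B' t + of_real (4 * c\<^sup>2 * E t))"
      by (rule arg_cong)
    then show ?thesis by simp
  qed
  have cont: "continuous_on {0..\<tau>} \<xi>" "continuous_on {0..\<tau>} (zeta \<xi> n)"
    by (rule primitive_on_continuous_on[OF \<xi>] primitive_on_continuous_on[OF primitive_zeta[OF \<xi> n]])+
  have rnz: "r t \<noteq> 0" for t using r_pos[of t] by simp
  have I1: "set_integrable lborel {0..\<tau>} (\<lambda>t. index_form t \<xi> (g t))"
    unfolding index_form_def
    by (intro set_integral_add(1) g2 set_integrable_continuous_real continuous_intros continuous_z continuous_r cont)
      (use rnz in auto)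
  have I2: "set_integrable lborel {0..\<tau>} A" "set_integrable lborel {0..\<tau>} E"
    unfolding A_def E_def
    by (intro set_integrable_continuous_real continuous_intros continuous_r continuous_w cont; use rnz in auto)+
  have I3: "set_integrable lborel {0..\<tau>} (\<lambda>t. Re (B' t))" "(LINT t:{0..\<tau>}|lborel. Re (B' t)) = 0"
  proof -
    note p = primitive_on_Re[OF B]
    show "set_integrable lborel {0..\<tau>} (\<lambda>t. Re (B' t))" by (rule primitive_onD(1)[OF p])
    \<comment> \<open>Reversing the signs of \<open>z\<close> and \<open>w\<close> reverses that of
      \<open>y\<close>, and each term of \<open>B\<close> is even in these three together. The
      boundary term therefore cancels for odd iterates too, where \<open>z\<close> returns to
      \<open>- z 0\<close>.\<close>
    have "B \<tau> = B 0"
      using per unfolding B_def y_def by auto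
    then show "(LINT t:{0..\<tau>}|lborel. Re (B' t)) = 0"
      using primitive_on_integral[OF p \<tau>] by simp
  qed
  \<comment> \<open>Solving the pointwise identity for the kinetic term yields its integrability
    from that of the other terms, with no estimate of \<open>zeta_deriv\<close>.\<close>
  have eq: "r t * (norm (zeta_deriv \<xi> g n c t))\<^sup>2 = index_form t \<xi> (g t) / 4 + A t - Re (B' t) - c\<^sup>2 * E t" for t
    unfolding pt by (simp add: field_simps)
  show I4: "set_integrable lborel {0..\<tau>} (\<lambda>t. r t * (norm (zeta_deriv \<xi> g n c t))\<^sup>2)"
    unfolding eq using I1 I2 I3(1) by (intro set_integral_add(1) set_integral_diff(1)) auto
  have "(LINT t:{0..\<tau>}|lborel. index_form t \<xi> (g t))
      = (LINT t:{0..\<tau>}|lborel. 4 * (r t * (norm (zeta_deriv \<xi> g n c t))\<^sup>2 - A t)) + (LINT t:{0..\<tau>}|lborel. 4 * Re (B' t))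
        + (LINT t:{0..\<tau>}|lborel. 4 * c\<^sup>2 * E t)"
    unfolding pt using I2 I3(1) I4
    by (subst set_integral_add(2), (intro set_integral_add(1) set_integrable_mult_right set_integral_diff(1); simp),
        simp, subst set_integral_add(2), (intro set_integrable_mult_right set_integral_diff(1); simp), simp_all)
  then show "(LINT t:{0..\<tau>}|lborel. index_form t \<xi> (g t))
      = 4 * (LINT t:{0..\<tau>}|lborel. r t * (norm (zeta_deriv \<xi> g n c t))\<^sup>2 - \<beta>\<^sup>2 * (norm (zeta \<xi> n t))\<^sup>2 / r t)
      + 4 * c\<^sup>2 * (LINT t:{0..\<tau>}|lborel. ((norm (w t))\<^sup>2 + 2 * \<beta>\<^sup>2 * r t) / r t)"
    by (simp only: set_integral_mult_right I3(2) A_def E_def mult_zero_right add_0_right)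
qed
end

section \<open>Periodic Kepler motions in eccentric anomaly\<close>

text \<open>In the time with rate 1/\<rho>, \<open>f - c\<close> is an oscillator of frequency 2
  \<beta>. \<open>G\<close> and \<open>J\<close> are its phase coordinates rotated back by the angle
  2 \<psi>, hence constant.\<close>

lemma harmonic_in_fictitious_time:
  fixes f fd \<rho> \<psi> :: "real \<Rightarrow> real" and \<beta> c :: real
  assumes "\<And>t. (f has_real_derivative fd t / \<rho> t) (at t)"
    and "\<And>t. (fd has_real_derivative - 4 * \<beta>\<^sup>2 * (f t - c) / \<rho> t) (at t)"
    and "\<And>t. (\<psi> has_real_derivative \<beta> / \<rho> t) (at t)" and "\<psi> 0 = 0" and "\<beta> > 0" and "\<And>t. \<rho> t > 0"
  shows "f t = c + (f 0 - c) * cos (2 * \<psi> t) + fd 0 / (2 * \<beta>) * sin (2 * \<psi> t)"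
proof -
  define G where "G = (\<lambda>t. (f t - c) * cos (2 * \<psi> t) - fd t / (2 * \<beta>) * sin (2 * \<psi> t))"
  define J where "J = (\<lambda>t. (f t - c) * sin (2 * \<psi> t) + fd t / (2 * \<beta>) * cos (2 * \<psi> t))"
  have "(G has_real_derivative 0) (at t)" for t
    unfolding G_def using assms(5) assms(6)[of t]
    by (auto intro!: derivative_eq_intros assms(1-3) simp: field_simps power2_eq_square)
  then have G: "G t = f 0 - c"
    using DERIV_isconst_all[where f = G and x = t and y = 0] by (simp add: G_def assms)
  have "(J has_real_derivative 0) (at t)" for t
    unfolding J_def using assms(5) assms(6)[of t]
    by (auto intro!: derivative_eq_intros assms(1-3) simp: field_simps power2_eq_square)
  then have J: "J t = fd 0 / (2 * \<beta>)"
    using DERIV_isconst_all[where f = J and x = t and y = 0] by (simp add: J_def assms)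
  have "(f t - c) * ((sin (2 * \<psi> t))\<^sup>2 + (cos (2 * \<psi> t))\<^sup>2) = G t * cos (2 * \<psi> t) + J t * sin (2 * \<psi> t)"
    unfolding G_def J_def by algebra
  then show ?thesis by (simp add: G J)
qed

section \<open>Conserved quantities and reduction to a linear oscillator\<close>

locale periodic_kepler_motion =
  fixes x v :: "real \<Rightarrow> complex" and \<kappa> T :: real
  assumes x_nonzero: "x t \<noteq> 0"
    and x_deriv: "(x has_vector_derivative v t) (at t)"
    and v_deriv: "(v has_vector_derivative - (\<kappa> / norm (x t) ^ 3) *\<^sub>R x t) (at t)"
    and \<kappa>_pos: "\<kappa> > 0"
    and T_pos: "T > 0" and x_periodic: "x (t + T) = x t"
    and T_minimal: "0 < S \<Longrightarrow> S < T \<Longrightarrow> \<exists>t. x (t + S) \<noteq> x t"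
begin

definition xr where "xr t = Re (x t)"
definition xi where "xi t = Im (x t)"
definition vr where "vr t = Re (v t)"
definition vi where "vi t = Im (v t)"

definition \<rho> :: "real \<Rightarrow> real" where "\<rho> t = norm (x t)"
definition D :: "real \<Rightarrow> real" where "D t = xr t * vr t + xi t * vi t"
definition H :: "real \<Rightarrow> real" where "H t = (norm (v t))\<^sup>2 / 2 - \<kappa> / \<rho> t"

lemma \<rho>_pos: "\<rho> t > 0"
  using x_nonzero[of t] by (simp add: \<rho>_def)

lemma \<rho>_square: "(\<rho> t)\<^sup>2 = (xr t)\<^sup>2 + (xi t)\<^sup>2"
  by (simp add: \<rho>_def cmod_power2 xr_def xi_def)

lemma norm_v_square: "(norm (v t))\<^sup>2 = (vr t)\<^sup>2 + (vi t)\<^sup>2"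
  by (simp add: cmod_power2 vr_def vi_def)

lemma coordinate_derivs:
  "(xr has_real_derivative vr t) (at t)"
  "(xi has_real_derivative vi t) (at t)"
  "(vr has_real_derivative - \<kappa> * xr t / \<rho> t ^ 3) (at t)"
  "(vi has_real_derivative - \<kappa> * xi t / \<rho> t ^ 3) (at t)"
  using bounded_linear.has_vector_derivative[OF bounded_linear_Re x_deriv[of t]]
    bounded_linear.has_vector_derivative[OF bounded_linear_Im x_deriv[of t]]
    bounded_linear.has_vector_derivative[OF bounded_linear_Re v_deriv[of t]]
    bounded_linear.has_vector_derivative[OF bounded_linear_Im v_deriv[of t]]
  by (simp_all add: has_real_derivative_iff_has_vector_derivative \<rho>_def xr_def[abs_def] xi_def[abs_def] vr_def[abs_def] vi_def[abs_def])

lemma \<rho>_deriv: "(\<rho> has_real_derivative D t / \<rho> t) (at t)"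
proof -
  have e: "\<rho> = (\<lambda>t. sqrt ((xr t)\<^sup>2 + (xi t)\<^sup>2))"
    by (simp add: \<rho>_def cmod_def fun_eq_iff xr_def xi_def)
  have p: "(xr t)\<^sup>2 + (xi t)\<^sup>2 > 0" using \<rho>_pos[of t] \<rho>_square[of t] by (metis zero_less_power)
  have "((\<lambda>t. (xr t)\<^sup>2 + (xi t)\<^sup>2) has_real_derivative 2 * D t) (at t)"
    by (auto intro!: derivative_eq_intros coordinate_derivs simp: D_def)
  note * = DERIV_chain2[OF DERIV_real_sqrt[OF p] this]
  have "inverse s / 2 * (2 * d) = d / s" for s d :: real
    by (simp add: field_simps)
  from *[unfolded this]
  have "((\<lambda>t. sqrt ((xr t)\<^sup>2 + (xi t)\<^sup>2)) has_real_derivative D t / sqrt ((xr t)\<^sup>2 + (xi t)\<^sup>2)) (at t)" .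
  then show ?thesis unfolding e .
qed

lemma H_const: "H t = H 0"
proof (rule DERIV_isconst_all[where f = H])
  show "\<forall>t. (H has_real_derivative 0) (at t)"
  proof
    fix t
    have "((\<lambda>t. ((vr t)\<^sup>2 + (vi t)\<^sup>2) / 2 - \<kappa> / \<rho> t) has_real_derivative 0) (at t)"
      using \<rho>_pos[of t]
      by (auto intro!: derivative_eq_intros coordinate_derivs \<rho>_deriv simp: D_def field_simps power2_eq_square power3_eq_cube)
    then show "(H has_real_derivative 0) (at t)"
      by (simp add: H_def[abs_def] norm_v_square)
  qed
qed

lemma v_periodic: "v (t + T) = v t"
proof -
  have "((\<lambda>t. x (t + T)) has_vector_derivative v (t + T)) (at t)"
  proof -
    have "((\<lambda>t. t + T) has_vector_derivative 1) (at t)"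
      unfolding has_real_derivative_iff_has_vector_derivative[symmetric]
      by (auto intro!: derivative_eq_intros)
    from vector_diff_chain_at[OF this x_deriv] show ?thesis by (simp add: o_def)
  qed
  then have "(x has_vector_derivative v (t + T)) (at t)" by (simp add: x_periodic)
  then show ?thesis using x_deriv[of t] vector_derivative_unique_at by blast
qed

text \<open>The Lagrange-Jacobi identity: the derivative is |v|^2 - \<kappa>/\<rho>, and the energy
  expresses |v|^2 as 2 H + 2 \<kappa>/\<rho>.\<close>

lemma D_deriv: "(D has_real_derivative 2 * H t + \<kappa> / \<rho> t) (at t)"
proof -
  have "((\<lambda>t. xr t * vr t + xi t * vi t) has_real_derivative
      (vr t)\<^sup>2 + (vi t)\<^sup>2 - \<kappa> * ((xr t)\<^sup>2 + (xi t)\<^sup>2) / \<rho> t ^ 3) (at t)"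
    using \<rho>_pos[of t]
    by (auto intro!: derivative_eq_intros coordinate_derivs simp: field_simps power2_eq_square)
  also have "(vr t)\<^sup>2 + (vi t)\<^sup>2 - \<kappa> * ((xr t)\<^sup>2 + (xi t)\<^sup>2) / \<rho> t ^ 3 = 2 * H t + \<kappa> / \<rho> t"
    unfolding \<rho>_square[symmetric] H_def norm_v_square using \<rho>_pos[of t]
    by (simp add: field_simps power2_eq_square power3_eq_cube)
  finally show ?thesis by (simp add: D_def[abs_def])
qed

text \<open>Nonnegative energy would make \<open>D\<close> strictly increasing by the
  Lagrange-Jacobi identity, which its periodicity excludes.\<close>

lemma H_neg: "H t < 0"
proof (rule ccontr)
  assume "\<not> H t < 0"
  then have h: "H s \<ge> 0" for s using H_const[of t] H_const[of s] by simp
  have "D 0 < D T"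
  proof (rule DERIV_pos_imp_increasing[OF T_pos])
    fix s
    have "2 * H s + \<kappa> / \<rho> s > 0" using h[of s] \<rho>_pos[of s] \<kappa>_pos by (simp add: add_nonneg_pos)
    then show "\<exists>y. (D has_real_derivative y) (at s) \<and> 0 < y" using D_deriv by blast
  qed
  moreover have "D T = D 0" using x_periodic[of 0] v_periodic[of 0] by (simp add: D_def xr_def xi_def vr_def vi_def)
  ultimately show False by simp
qed

text \<open>Minus the Laplace-Runge-Lenz vector. With this sign it points from the focus to the
  centre of the ellipse, and dividing it by -2 H = 4 \<beta>^2 gives the centre itself.\<close>

definition LRL :: "real \<Rightarrow> complex" where
  "LRL t = of_real (D t) * v t - of_real ((norm (v t))\<^sup>2) * x t + of_real (\<kappa> / \<rho> t) * x t"

lemma LRL_const: "LRL t = LRL 0"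
proof (rule complex_eqI)
  have V: "(norm (v t))\<^sup>2 = 2 * H 0 + 2 * \<kappa> / \<rho> t" for t
    using H_const[of t] by (simp add: H_def)
  have R: "Re (LRL t) = D t * vr t - 2 * H 0 * xr t - \<kappa> * xr t / \<rho> t"
    and I: "Im (LRL t) = D t * vi t - 2 * H 0 * xi t - \<kappa> * xi t / \<rho> t" for t
    unfolding LRL_def V by (simp_all add: algebra_simps xr_def xi_def vr_def vi_def)
  have "((\<lambda>t. D t * vr t - 2 * H 0 * xr t - \<kappa> * xr t / \<rho> t) has_real_derivative 0) (at t)" for t
    using \<rho>_pos[of t]
    by (auto intro!: derivative_eq_intros coordinate_derivs \<rho>_deriv D_deriv simp: H_const[of t] field_simps power2_eq_square power3_eq_cube)
  then show "Re (LRL t) = Re (LRL 0)"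
    unfolding R using DERIV_isconst_all by blast
  have "((\<lambda>t. D t * vi t - 2 * H 0 * xi t - \<kappa> * xi t / \<rho> t) has_real_derivative 0) (at t)" for t
    using \<rho>_pos[of t]
    by (auto intro!: derivative_eq_intros coordinate_derivs \<rho>_deriv D_deriv simp: H_const[of t] field_simps power2_eq_square power3_eq_cube)
  then show "Im (LRL t) = Im (LRL 0)"
    unfolding I using DERIV_isconst_all by blast
qed

text \<open>Normalised so that the energy is -2 \<beta>^2: in fictitious time the position
  oscillates with frequency 2 \<beta> and its complex square root with frequency \<beta>.\<close>

definition \<beta> :: real where "\<beta> = sqrt (- H 0 / 2)"

lemma \<beta>_pos: "\<beta> > 0" and \<beta>_square: "2 * \<beta>\<^sup>2 = - H 0"
  using H_neg[of 0] by (simp_all add: \<beta>_def)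

text \<open>\<psi> is half the eccentric anomaly, counted from the position at time 0 rather than
  from the pericentre. No apsidal direction has to be chosen, so circles need no separate
  case.\<close>

lemma eccentric_anomaly_exists:
  "\<exists>\<psi>. \<psi> 0 = 0 \<and> (\<forall>t. (\<psi> has_real_derivative \<beta> / \<rho> t) (at t))"
proof -
  have "isCont (\<lambda>t. \<beta> / \<rho> t) t" for t
    using \<rho>_pos[of t] DERIV_isCont[OF \<rho>_deriv] by (intro continuous_intros) auto
  then obtain F where "\<And>t. (F has_vector_derivative \<beta> / \<rho> t) (at t)"
    using einterval_antiderivative[of "-\<infinity>" "\<infinity>" "\<lambda>t. \<beta> / \<rho> t"] by auto
  then have F: "(F has_real_derivative \<beta> / \<rho> t) (at t)" for t
    by (simp add: has_real_derivative_iff_has_vector_derivative)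
  show ?thesis
    by (rule exI[of _ "\<lambda>t. F t - F 0"]) (auto intro!: derivative_eq_intros F)
qed

definition x_center :: complex where "x_center = LRL 0 / of_real (4 * \<beta>\<^sup>2)"

text \<open>The conserved vector linearises the motion: \<rho> (\<rho> v)' = D v - \<kappa> x/\<rho>
  = \<open>LRL\<close> + 2 H x, which is 4 \<beta>^2 times the difference of the centre and x. Both
  coordinates are then oscillators about the centre.\<close>

lemma motion_in_eccentric_anomaly:
  assumes "\<psi> 0 = 0" "\<And>t. (\<psi> has_real_derivative \<beta> / \<rho> t) (at t)"
  shows "x t = x_center + (x 0 - x_center) * of_real (cos (2 * \<psi> t))
    + of_real (\<rho> 0) * v 0 / of_real (2 * \<beta>) * of_real (sin (2 * \<psi> t))"
proof (rule complex_eqI)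
  have b2: "H 0 = - (2 * \<beta>\<^sup>2)" using \<beta>_square by simp
  have V: "(vr t)\<^sup>2 + (vi t)\<^sup>2 = 2 * H 0 + 2 * \<kappa> / \<rho> t" for t
    unfolding H_const[of t, symmetric] norm_v_square[symmetric] by (simp add: H_def)
  have xc: "x_center = LRL t / of_real (4 * \<beta>\<^sup>2)" for t
    by (simp add: x_center_def LRL_const[of t])
  have cr: "4 * \<beta>\<^sup>2 * Re x_center = D t * vr t - 2 * H 0 * xr t - \<kappa> * xr t / \<rho> t"
    and ci: "4 * \<beta>\<^sup>2 * Im x_center = D t * vi t - 2 * H 0 * xi t - \<kappa> * xi t / \<rho> t" for t
    using \<beta>_pos unfolding xc[of t] LRL_def norm_v_square V
    by (simp_all add: xr_def xi_def vr_def vi_def Re_divide_of_real Im_divide_of_real field_simps)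
  have "Re (x t) = Re x_center + (Re (x 0) - Re x_center) * cos (2 * \<psi> t) + (\<rho> 0 * vr 0) / (2 * \<beta>) * sin (2 * \<psi> t)"
  proof (rule harmonic_in_fictitious_time[where f = "\<lambda>t. Re (x t)" and fd = "\<lambda>t. \<rho> t * vr t"])
    fix t
    show "((\<lambda>t. Re (x t)) has_real_derivative \<rho> t * vr t / \<rho> t) (at t)"
      using coordinate_derivs(1)[of t] \<rho>_pos[of t] by (simp add: xr_def[abs_def])
    have "- 4 * \<beta>\<^sup>2 * (Re (x t) - Re x_center) / \<rho> t = (2 * H 0 * xr t + 4 * \<beta>\<^sup>2 * Re x_center) / \<rho> t"
      by (simp add: b2 xr_def algebra_simps)
    also have "\<dots> = D t / \<rho> t * vr t + (- \<kappa> * xr t / \<rho> t ^ 3) * \<rho> t"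
      unfolding cr[of t] using \<rho>_pos[of t] by (simp add: field_simps power3_eq_cube)
    finally show "((\<lambda>t. \<rho> t * vr t) has_real_derivative - 4 * \<beta>\<^sup>2 * (Re (x t) - Re x_center) / \<rho> t) (at t)"
      by (auto intro!: derivative_eq_intros coordinate_derivs \<rho>_deriv)
  qed (use assms \<beta>_pos \<rho>_pos in auto)
  then show "Re (x t) = Re (x_center + (x 0 - x_center) * of_real (cos (2 * \<psi> t))
    + of_real (\<rho> 0) * v 0 / of_real (2 * \<beta>) * of_real (sin (2 * \<psi> t)))"
    by (simp add: vr_def Re_divide_of_real del: of_real_mult)
  have "Im (x t) = Im x_center + (Im (x 0) - Im x_center) * cos (2 * \<psi> t) + (\<rho> 0 * vi 0) / (2 * \<beta>) * sin (2 * \<psi> t)"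
  proof (rule harmonic_in_fictitious_time[where f = "\<lambda>t. Im (x t)" and fd = "\<lambda>t. \<rho> t * vi t"])
    fix t
    show "((\<lambda>t. Im (x t)) has_real_derivative \<rho> t * vi t / \<rho> t) (at t)"
      using coordinate_derivs(2)[of t] \<rho>_pos[of t] by (simp add: xi_def[abs_def])
    have "- 4 * \<beta>\<^sup>2 * (Im (x t) - Im x_center) / \<rho> t = (2 * H 0 * xi t + 4 * \<beta>\<^sup>2 * Im x_center) / \<rho> t"
      by (simp add: b2 xi_def algebra_simps)
    also have "\<dots> = D t / \<rho> t * vi t + (- \<kappa> * xi t / \<rho> t ^ 3) * \<rho> t"
      unfolding ci[of t] using \<rho>_pos[of t] by (simp add: field_simps power3_eq_cube)
    finally show "((\<lambda>t. \<rho> t * vi t) has_real_derivative - 4 * \<beta>\<^sup>2 * (Im (x t) - Im x_center) / \<rho> t) (at t)"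
      by (auto intro!: derivative_eq_intros coordinate_derivs \<rho>_deriv)
  qed (use assms \<beta>_pos \<rho>_pos in auto)
  then show "Im (x t) = Im (x_center + (x 0 - x_center) * of_real (cos (2 * \<psi> t))
    + of_real (\<rho> 0) * v 0 / of_real (2 * \<beta>) * of_real (sin (2 * \<psi> t)))"
    by (simp add: vi_def Im_divide_of_real del: of_real_mult)
qed

text \<open>The origin is a focus of the ellipse.\<close>

lemma center_focus_relation:
  "(x 0)\<^sup>2 + (of_real (\<rho> 0) * v 0 / of_real (2 * \<beta>))\<^sup>2 = 2 * x_center * x 0"
proof -
  have b: "of_real (4 * \<beta>\<^sup>2) \<noteq> (0 :: complex)" using \<beta>_pos by simp
  have D: "2 * complex_of_real (D 0) = x 0 * cnj (v 0) + cnj (x 0) * v 0"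
    by (simp add: complex_eq_iff D_def xr_def xi_def vr_def vi_def algebra_simps)
  have b4: "complex_of_real (4 * \<beta>\<^sup>2) = of_real (2 * (\<kappa> / \<rho> 0)) - of_real ((norm (v 0))\<^sup>2)"
    using \<beta>_square unfolding of_real_diff[symmetric] of_real_eq_iff H_def by simp
  have r: "(complex_of_real (\<rho> 0))\<^sup>2 = x 0 * cnj (x 0)"
    unfolding \<rho>_def of_real_power[symmetric] by (rule complex_norm_square)
  have "of_real (4 * \<beta>\<^sup>2) * ((x 0)\<^sup>2 + (of_real (\<rho> 0) * v 0 / of_real (2 * \<beta>))\<^sup>2)
      = of_real (4 * \<beta>\<^sup>2) * (x 0)\<^sup>2 + (of_real (\<rho> 0))\<^sup>2 * (v 0)\<^sup>2"
    using \<beta>_pos by (simp add: field_simps power2_eq_square)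
  also have "\<dots> = 2 * LRL 0 * x 0"
    unfolding b4 r LRL_def complex_norm_square[of "v 0"] of_real_mult[of 2] of_real_numeral using D by algebra
  also have "\<dots> = of_real (4 * \<beta>\<^sup>2) * (2 * x_center * x 0)"
    using b by (simp add: x_center_def)
  finally show ?thesis using b by (simp only: mult_cancel_left) blast
qed

text \<open>The square of p cos \<theta> + q sin \<theta> is a harmonic of frequency 2 about (p^2 +
  q^2)/2. The focus condition is exactly what makes the Kepler motion such a square. The advance of
  \<psi> in time \<open>T\<close> is first shown to be a multiple of \<pi>, then to be \<pi> by
  minimality of \<open>T\<close>.\<close>

lemma levi_civita_parametrization:
  "\<exists>z w \<psi> P Q. kepler_frame z w \<beta> \<kappa> \<and> (\<forall>t. (z t)\<^sup>2 = x t)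
    \<and> (\<forall>t. (\<psi> has_real_derivative \<beta> / (norm (z t))\<^sup>2) (at t))
    \<and> (\<forall>t. \<psi> (t + T) = \<psi> t + pi)
    \<and> (\<forall>t. z t = P * cis (\<psi> t) + Q * cis (- \<psi> t))
    \<and> (\<forall>t. w t = of_real \<beta> * (\<i> * P * cis (\<psi> t) - \<i> * Q * cis (- \<psi> t)))"
proof -
  obtain \<psi> where \<psi>0: "\<psi> 0 = 0" and \<psi>: "\<And>t. (\<psi> has_real_derivative \<beta> / \<rho> t) (at t)"
    using eccentric_anomaly_exists by blast
  define p where "p = csqrt (x 0)"
  define B where "B = of_real (\<rho> 0) * v 0 / of_real (2 * \<beta>)"
  define q where "q = B / p"
  have p2: "p\<^sup>2 = x 0" by (simp add: p_def)
  have p0: "p \<noteq> 0" using p2 x_nonzero[of 0] by auto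
  have pq: "p * q = B" using p0 by (simp add: q_def)
  \<comment> \<open>\<open>p\<close> is a square root of \<open>x 0\<close>, and \<open>q\<close> is
    fixed by the sine coefficient 2 p q = 2 B. The mean (p^2 + q^2)/2 is then the centre only thanks
    to \<open>center_focus_relation\<close>.\<close>
  have q2: "q\<^sup>2 = 2 * x_center - x 0"
  proof -
    have "x 0 * (x 0 + q\<^sup>2) = x 0 * (2 * x_center)"
      using center_focus_relation p2 pq unfolding B_def[symmetric] by algebra
    then have "x 0 + q\<^sup>2 = 2 * x_center"
      using x_nonzero[of 0] by (simp only: mult_cancel_left) blast
    then show ?thesis by algebra
  qed
  define zz where "zz = (\<lambda>\<theta>. p * of_real (cos \<theta>) + q * of_real (sin \<theta>))"
  define ww where "ww = (\<lambda>\<theta>. of_real \<beta> * (q * of_real (cos \<theta>) - p * of_real (sin \<theta>)))"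
  have zz2: "(zz \<theta>)\<^sup>2 = x_center + (x 0 - x_center) * of_real (cos (2 * \<theta>)) + B * of_real (sin (2 * \<theta>))" for \<theta>
  proof -
    have "(complex_of_real (cos \<theta>))\<^sup>2 + (of_real (sin \<theta>))\<^sup>2 = 1"
      unfolding of_real_power[symmetric] of_real_add[symmetric] by simp
    then show ?thesis
      unfolding zz_def cos_double sin_double of_real_mult of_real_diff of_real_power of_real_numeral
      using p2 pq q2 by algebra
  qed
  have z2: "(zz (\<psi> t))\<^sup>2 = x t" for t
    using motion_in_eccentric_anomaly[OF \<psi>0 \<psi>, of t] unfolding zz2 B_def by simp
  have nz: "(norm (zz (\<psi> t)))\<^sup>2 = \<rho> t" for t
    by (simp add: \<rho>_def norm_power[symmetric] z2)
  have dz: "((\<lambda>t. zz (\<psi> t)) has_vector_derivative ww (\<psi> t) / of_real (\<rho> t)) (at t)" for t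
  proof -
    have "((\<lambda>\<theta>. zz \<theta>) has_vector_derivative q * of_real (cos \<theta>) - p * of_real (sin \<theta>)) (at \<theta>)" for \<theta>
      unfolding zz_def
      by (auto intro!: derivative_eq_intros has_vector_derivative_mult_right has_vector_derivative_of_real simp: has_real_derivative_iff_has_vector_derivative[symmetric] algebra_simps)
    from vector_diff_chain_at[OF \<psi>[of t, unfolded has_real_derivative_iff_has_vector_derivative] this]
    show ?thesis by (simp add: o_def scaleR_conv_of_real ww_def)
  qed
  have dw: "((\<lambda>t. ww (\<psi> t)) has_vector_derivative - of_real (\<beta>\<^sup>2) * zz (\<psi> t) / of_real (\<rho> t)) (at t)" for t
  proof -
    have "((\<lambda>\<theta>. ww \<theta>) has_vector_derivative - of_real \<beta> * zz \<theta>) (at \<theta>)" for \<theta>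
      unfolding zz_def ww_def
      by (auto intro!: derivative_eq_intros has_vector_derivative_mult_right has_vector_derivative_of_real simp: has_real_derivative_iff_has_vector_derivative[symmetric] algebra_simps)
    from vector_diff_chain_at[OF \<psi>[of t, unfolded has_real_derivative_iff_has_vector_derivative] this]
    show ?thesis by (simp add: o_def scaleR_conv_of_real power2_eq_square mult.assoc)
  qed
  have energy: "2 * (norm (ww (\<psi> t)))\<^sup>2 + 2 * \<beta>\<^sup>2 * (norm (zz (\<psi> t)))\<^sup>2 = \<kappa>" for t
  proof -
    have "((\<lambda>t. zz (\<psi> t) * zz (\<psi> t)) has_vector_derivative
        zz (\<psi> t) * (ww (\<psi> t) / of_real (\<rho> t)) + ww (\<psi> t) / of_real (\<rho> t) * zz (\<psi> t)) (at t)"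
      by (rule has_vector_derivative_mult[OF dz dz])
    moreover have "(\<lambda>t. zz (\<psi> t) * zz (\<psi> t)) = x" using z2 by (simp add: power2_eq_square fun_eq_iff)
    ultimately have "v t = 2 * zz (\<psi> t) * ww (\<psi> t) / of_real (\<rho> t)"
      using vector_derivative_unique_at[OF x_deriv[of t]] by auto
    then have "(norm (v t))\<^sup>2 = 4 * (norm (zz (\<psi> t)))\<^sup>2 * (norm (ww (\<psi> t)))\<^sup>2 / (\<rho> t)\<^sup>2"
      using \<rho>_pos[of t] by (simp add: norm_mult norm_divide power_mult_distrib power_divide)
    then have v2: "(norm (v t))\<^sup>2 = 4 * (norm (ww (\<psi> t)))\<^sup>2 / \<rho> t"
      using \<rho>_pos[of t] unfolding nz by (simp add: power2_eq_square[of "\<rho> t"])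
    have "2 * \<beta>\<^sup>2 = \<kappa> / \<rho> t - (norm (v t))\<^sup>2 / 2"
      using \<beta>_square H_const[of t] by (simp add: H_def)
    then show ?thesis unfolding nz v2 using \<rho>_pos[of t] by (simp add: field_simps)
  qed
  have frame: "kepler_frame (\<lambda>t. zz (\<psi> t)) (\<lambda>t. ww (\<psi> t)) \<beta> \<kappa>"
  proof
    show "zz (\<psi> t) \<noteq> 0" for t using z2[of t] x_nonzero[of t] by auto
  qed (use dz dw energy in \<open>simp_all only: nz\<close>)
  define a where "a = (norm p)\<^sup>2"
  define b where "b = (norm q)\<^sup>2"
  define l where "l = Re (p * cnj q)"
  have R: "(norm (zz \<theta>))\<^sup>2 = a * (cos \<theta>)\<^sup>2 + b * (sin \<theta>)\<^sup>2 + 2 * l * (sin \<theta> * cos \<theta>)" for \<theta>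
    unfolding a_def b_def l_def cmod_power2 zz_def by (simp add: power2_eq_square algebra_simps)
  \<comment> \<open>An antiderivative of \<open>(norm (zz \<theta>))\<^sup>2\<close>, so that the
    fact \<open>\<Phi> (\<psi> t) = \<Phi> 0 + \<beta> * t\<close> proved below is Kepler's
    equation.\<close>
  define \<Phi> where "\<Phi> = (\<lambda>\<theta>. (a + b) / 2 * \<theta> + (a - b) / 2 * (sin \<theta> * cos \<theta>) + l * (sin \<theta>)\<^sup>2)"
  have \<Phi>: "(\<Phi> has_real_derivative (norm (zz \<theta>))\<^sup>2) (at \<theta>)" for \<theta>
  proof -
    have "(\<Phi> has_real_derivative (a + b) / 2 + (a - b) / 2 * ((cos \<theta>)\<^sup>2 - (sin \<theta>)\<^sup>2) + 2 * l * (sin \<theta> * cos \<theta>)) (at \<theta>)"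
      unfolding \<Phi>_def by (auto intro!: derivative_eq_intros simp: power2_eq_square field_simps)
    also have "(a + b) / 2 + (a - b) / 2 * ((cos \<theta>)\<^sup>2 - (sin \<theta>)\<^sup>2) + 2 * l * (sin \<theta> * cos \<theta>) = (norm (zz \<theta>))\<^sup>2"
      unfolding R sin_squared_eq by (simp add: field_simps)
    finally show ?thesis .
  qed
  have \<Phi>\<psi>: "\<Phi> (\<psi> t) = \<Phi> 0 + \<beta> * t" for t
  proof -
    have "((\<lambda>t. \<Phi> (\<psi> t) - \<beta> * t) has_real_derivative 0) (at t)" for t
      using \<rho>_pos[of t]
      by (auto intro!: derivative_eq_intros DERIV_chain2[OF \<Phi> \<psi>] simp: nz)
    then show ?thesis
      using DERIV_isconst_all[where f = "\<lambda>t. \<Phi> (\<psi> t) - \<beta> * t" and x = t and y = 0] by (simp add: \<psi>0)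
  qed
  define \<delta> where "\<delta> = \<psi> T"
  have shift: "\<psi> (t + T) = \<psi> t + \<delta>" for t
  proof -
    have "((\<lambda>t. \<psi> (t + T) - \<psi> t) has_real_derivative 0) (at t)" for t
    proof -
      have "((\<lambda>t. \<psi> (t + T)) has_real_derivative \<beta> / \<rho> (t + T)) (at t)"
        using \<psi>[of "t + T"] by (simp add: DERIV_shift)
      then show ?thesis
        by (auto intro!: derivative_eq_intros \<psi> simp: \<rho>_def x_periodic)
    qed
    then show ?thesis
      using DERIV_isconst_all[where f = "\<lambda>t. \<psi> (t + T) - \<psi> t" and x = t and y = 0] by (simp add: \<psi>0 \<delta>_def)
  qed
  have \<delta>_pos: "\<delta> > 0"
  proof -
    have "\<psi> 0 < \<psi> T"
    proof (rule DERIV_pos_imp_increasing[OF T_pos])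
      fix t
      have "\<beta> / \<rho> t > 0" using \<beta>_pos \<rho>_pos by simp
      then show "\<exists>y. (\<psi> has_real_derivative y) (at t) \<and> 0 < y" using \<psi> by blast
    qed
    then show ?thesis by (simp add: \<delta>_def \<psi>0)
  qed
  \<comment> \<open>Surjectivity of \<psi> turns periodicity in t into an identity valid for every
    angle, which can then be evaluated at 0 and \<pi>/4.\<close>
  have surj: "\<exists>t. \<psi> t = y" for y
  proof -
    have up: "\<psi> (real n * T) = real n * \<delta>" for n
    proof (induction n)
      case (Suc n)
      then show ?case using shift[of "real n * T"] by (simp add: algebra_simps)
    qed (simp add: \<psi>0)
    have down: "\<psi> (- (real n * T)) = - (real n * \<delta>)" for n
    proof (induction n)
      case (Suc n)
      then show ?case using shift[of "- (real (Suc n) * T)"] by (simp add: algebra_simps)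
    qed (simp add: \<psi>0)
    obtain n :: nat where n: "\<bar>y\<bar> < real n * \<delta>"
      using \<delta>_pos reals_Archimedean3 by blast
    have "\<exists>t\<ge>- (real n * T). t \<le> real n * T \<and> \<psi> t = y"
    proof (rule IVT')
      show "\<psi> (- (real n * T)) \<le> y" "y \<le> \<psi> (real n * T)" using n up down by auto
      show "- (real n * T) \<le> real n * T" using T_pos by simp
      show "continuous_on {- (real n * T)..real n * T} \<psi>"
        using \<psi> by (meson DERIV_isCont continuous_at_imp_continuous_on)
    qed
    then show ?thesis by blast
  qed
  have zz_period: "(zz (\<theta> + \<delta>))\<^sup>2 = (zz \<theta>)\<^sup>2" for \<theta>
  proof -
    obtain t where "\<psi> t = \<theta>" using surj by blast
    then show ?thesis using z2[of t] z2[of "t + T"] by (simp add: shift x_periodic)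
  qed
  have "\<exists>n::int. \<delta> = of_int n * pi"
  proof -
    define A where "A = x 0 - x_center"
    define C S where "C = complex_of_real (cos (2 * \<delta>))" and "S = complex_of_real (sin (2 * \<delta>))"
    have 1: "A * C + B * S = A"
      using zz_period[of 0] unfolding zz2 by (simp add: A_def C_def S_def algebra_simps)
    have 2: "- A * S + B * C = B"
    proof -
      have "cos (2 * (pi / 4 + \<delta>)) = - sin (2 * \<delta>)" "sin (2 * (pi / 4 + \<delta>)) = cos (2 * \<delta>)"
        "cos (2 * (pi / 4)) = 0" "sin (2 * (pi / 4)) = 1"
        by (simp_all add: distrib_left cos_add sin_add)
      with zz_period[of "pi / 4"] show ?thesis
        unfolding zz2 A_def C_def S_def by (simp only:) (simp add: algebra_simps)
    qed
    \<comment> \<open>Facts \<open>1\<close> and \<open>2\<close> form a homogeneous linear system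
      for \<open>A\<close> and \<open>B\<close> with determinant (C - 1)^2 + S^2. A nontrivial
      solution makes it vanish, and since \<open>C\<close> and \<open>S\<close> are real this means
      that 2 \<delta> is a full turn.\<close>
    have "A * ((C - 1)\<^sup>2 + S\<^sup>2) = (C - 1) * (A * C + B * S - A) - S * (- A * S + B * C - B)"
      "B * ((C - 1)\<^sup>2 + S\<^sup>2) = S * (A * C + B * S - A) + (C - 1) * (- A * S + B * C - B)"
      by (simp_all add: power2_eq_square algebra_simps)
    then have "A * ((C - 1)\<^sup>2 + S\<^sup>2) = 0" "B * ((C - 1)\<^sup>2 + S\<^sup>2) = 0"
      by (simp_all only: 1 2 diff_self mult_zero_right add_0_right)
    moreover have "\<not> (A = 0 \<and> B = 0)"
    proof
      assume "A = 0 \<and> B = 0"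
      then have "q = 0" "x 0 = x_center" using pq p0 by (auto simp: A_def)
      then show False using q2 x_nonzero[of 0] by simp
    qed
    ultimately have "(C - 1)\<^sup>2 + S\<^sup>2 = 0" by auto
    then have "complex_of_real ((cos (2 * \<delta>) - 1)\<^sup>2 + (sin (2 * \<delta>))\<^sup>2) = 0"
      by (simp add: C_def S_def)
    then have "cos (2 * \<delta>) = 1"
      unfolding of_real_eq_0_iff sum_power2_eq_zero_iff by simp
    then show ?thesis by (auto simp: cos_one_2pi_int)
  qed
  then obtain n :: int where n: "\<delta> = of_int n * pi" by blast
  have n_pos: "n \<ge> 1"
    using \<delta>_pos unfolding n by (simp add: zero_less_mult_iff)
  have \<Phi>_shift: "\<Phi> (\<theta> + pi) = \<Phi> \<theta> + (a + b) / 2 * pi" for \<theta>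
    by (simp add: \<Phi>_def field_simps)
  \<comment> \<open>The time in which Kepler's equation lets \<psi> advance by \<pi>.
    \<open>zz\<close> only changes sign then, so \<open>S\<close> is already a period of
    \<open>x\<close>; as \<open>T\<close> is \<open>n\<close> times \<open>S\<close>, minimality of
    \<open>T\<close> leaves only n = 1.\<close>
  define S where "S = (a + b) / 2 * pi / \<beta>"
  have S_pos: "S > 0"
    using p0 \<beta>_pos by (simp add: S_def a_def b_def add_pos_nonneg)
  have \<Phi>_inj: "\<theta> = \<eta>" if "\<Phi> \<theta> = \<Phi> \<eta>" for \<theta> \<eta>
  proof -
    have "\<Phi> \<theta> < \<Phi> \<eta>" if "\<theta> < \<eta>" for \<theta> \<eta>
    proof (rule DERIV_pos_imp_increasing[OF that])
      fix s
      obtain t where "\<psi> t = s" using surj by blast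
      then have "(norm (zz s))\<^sup>2 > 0" using nz[of t] \<rho>_pos[of t] by simp
      then show "\<exists>y. (\<Phi> has_real_derivative y) (at s) \<and> 0 < y" using \<Phi> by blast
    qed
    from this[of \<theta> \<eta>] this[of \<eta> \<theta>] show ?thesis using that by linarith
  qed
  have "\<psi> (t + S) = \<psi> t + pi" for t
  proof (rule \<Phi>_inj)
    show "\<Phi> (\<psi> (t + S)) = \<Phi> (\<psi> t + pi)"
      unfolding \<Phi>_shift \<Phi>\<psi> using \<beta>_pos by (simp add: S_def field_simps)
  qed
  moreover have "zz (\<theta> + pi) = - zz \<theta>" for \<theta>
    by (simp add: zz_def)
  ultimately have "x (t + S) = x t" for t
    unfolding z2[symmetric] by simp
  then have "\<not> S < T" using T_minimal S_pos by blast
  moreover have "\<beta> * T = of_int n * (\<beta> * S)"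
  proof -
    have "sin (of_int n * pi) = 0" by (auto simp: sin_zero_iff_int2)
    then have "\<beta> * T = (a + b) / 2 * (of_int n * pi)"
      using \<Phi>\<psi>[of T] unfolding \<delta>_def[symmetric] n by (simp add: \<Phi>_def)
    also have "\<dots> = of_int n * (\<beta> * S)" using \<beta>_pos by (simp add: S_def)
    finally show ?thesis .
  qed
  then have "T = of_int n * S" using \<beta>_pos by simp
  ultimately have "n = 1"
    using S_pos n_pos by (metis linorder_not_less mult_less_cancel_right1 of_int_1_less_iff order_less_le)
  then have \<delta>: "\<delta> = pi" using n by simp
  show ?thesis
  proof (intro exI conjI allI)
    show "kepler_frame (\<lambda>t. zz (\<psi> t)) (\<lambda>t. ww (\<psi> t)) \<beta> \<kappa>" by (rule frame)
    show "(zz (\<psi> t))\<^sup>2 = x t" for t by (rule z2)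
    show "(\<psi> has_real_derivative \<beta> / (norm (zz (\<psi> t)))\<^sup>2) (at t)" for t unfolding nz by (rule \<psi>)
    show "\<psi> (t + T) = \<psi> t + pi" for t using shift \<delta> by simp
    show "zz (\<psi> t) = ((p - \<i> * q) / 2) * cis (\<psi> t) + ((p + \<i> * q) / 2) * cis (- \<psi> t)" for t
      by (simp add: zz_def complex_eq_iff field_simps)
    show "ww (\<psi> t) = of_real \<beta> * (\<i> * ((p - \<i> * q) / 2) * cis (\<psi> t) - \<i> * ((p + \<i> * q) / 2) * cis (- \<psi> t))" for t
      by (simp add: ww_def complex_eq_iff field_simps)
  qed
qed

end

section \<open>Bounds for the index of the iterates\<close>

lemma primitive_on_indefinite_integral:
  assumes "set_integrable lborel {a..b} f" "a \<le> b"
  shows "primitive_on a b (\<lambda>t. set_lebesgue_integral lborel {a..t} f) f"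
proof -
  have "set_lebesgue_integral lborel {a..a} f = integral {a..a} f"
    by (rule set_borel_integral_eq_integral(2), rule set_integrable_subset[OF assms(1)]) (use assms(2) in auto)
  then show ?thesis using assms(1) unfolding primitive_on_def by simp
qed

locale kepler_orbit = kepler_frame +
  fixes \<psi> :: "real \<Rightarrow> real" and T :: real and P Q :: complex
  assumes \<beta>_pos: "\<beta> > 0" and T_pos: "T > 0"
    and \<psi>_deriv: "(\<psi> has_real_derivative \<beta> / (norm (z t))\<^sup>2) (at t)"
    and \<psi>_shift: "\<psi> (t + T) = \<psi> t + pi"
    and z_eq: "z t = P * cis (\<psi> t) + Q * cis (- \<psi> t)"
    and w_eq: "w t = of_real \<beta> * (\<i> * P * cis (\<psi> t) - \<i> * Q * cis (- \<psi> t))"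
begin

section \<open>Upper bound: sign changes over one revolution and nonnegativity\<close>

lemma \<psi>_deriv_r: "(\<psi> has_real_derivative \<beta> / r t) (at t)"
  unfolding r_def by (rule \<psi>_deriv)

lemma \<psi>_shift_nat: "\<psi> (t + real j * T) = \<psi> t + real j * pi"
proof (induction j)
  case (Suc j)
  then show ?case using \<psi>_shift[of "t + real j * T"] by (simp add: algebra_simps)
qed simp

lemma z_shift: "z (t + T) = - z t" and w_shift: "w (t + T) = - w t"
proof -
  have "cis (\<psi> t + pi) = - cis (\<psi> t)" "cis (- (\<psi> t + pi)) = - cis (- \<psi> t)"
    by (simp_all add: complex_eq_iff)
  then show "z (t + T) = - z t" "w (t + T) = - w t"
    unfolding z_eq w_eq \<psi>_shift by (simp_all add: algebra_simps)
qed

lemma z_shift_nat: "z (t + real j * T) = (- 1) ^ j * z t"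
  and w_shift_nat: "w (t + real j * T) = (- 1) ^ j * w t"
proof -
  have "z (t + real j * T) = (- 1) ^ j * z t \<and> w (t + real j * T) = (- 1) ^ j * w t"
  proof (induction j)
    case (Suc j)
    then show ?case using z_shift[of "t + real j * T"] w_shift[of "t + real j * T"] by (simp add: algebra_simps)
  qed simp
  then show "z (t + real j * T) = (- 1) ^ j * z t" "w (t + real j * T) = (- 1) ^ j * w t" by auto
qed

lemma r_shift_nat: "r (t + real j * T) = r t"
  by (simp add: r_def z_shift_nat norm_mult norm_power)

lemma z_w_at_period:
  "z (real k * T) = z 0 \<and> w (real k * T) = w 0 \<or> z (real k * T) = - z 0 \<and> w (real k * T) = - w 0"
  using z_shift_nat[of 0 k] w_shift_nat[of 0 k] by (cases "even k") auto

lemma r_nonzero: "r t \<noteq> 0"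
  using r_pos[of t] by simp

text \<open>Minus the first variation of the fictitious time elapsed up to t, since 1/|x| varies by
  -<x, \<xi>>/|x|^3.\<close>

definition M :: "(real \<Rightarrow> complex) \<Rightarrow> real \<Rightarrow> real" where
  "M \<xi> t = (LINT s:{0..t}|lborel. Re (cnj (z s ^ 2) * \<xi> s) / r s ^ 3)"

definition s_time :: "real \<Rightarrow> real" where
  "s_time t = (LINT s:{0..t}|lborel. 1 / r s)"

lemma primitive_M:
  assumes "continuous_on {0..\<tau>} \<xi>" "0 \<le> \<tau>"
  shows "primitive_on 0 \<tau> (M \<xi>) (\<lambda>s. Re (cnj (z s ^ 2) * \<xi> s) / r s ^ 3)"
  unfolding M_def
  by (rule primitive_on_indefinite_integral)
    (use assms r_nonzero in \<open>auto intro!: set_integrable_continuous_real continuous_intros continuous_z continuous_r\<close>)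

lemma primitive_s_time:
  assumes "0 \<le> \<tau>"
  shows "primitive_on 0 \<tau> s_time (\<lambda>s. 1 / r s)"
  unfolding s_time_def
  by (rule primitive_on_indefinite_integral)
    (use assms r_nonzero in \<open>auto intro!: set_integrable_continuous_real continuous_intros continuous_r\<close>)

lemma M_0: "M \<xi> 0 = 0" and s_time_0: "s_time 0 = 0"
  unfolding M_def s_time_def
  by (subst set_borel_integral_eq_integral(2);
      auto intro!: set_integrable_continuous_real)+

lemma s_time_pos:
  assumes "0 < t"
  shows "s_time t > 0"
proof -
  have "primitive_on 0 t \<psi> (\<lambda>s. \<beta> / r s)"
    by (rule primitive_on_real_derivative)
      (use \<psi>_deriv_r r_nonzero in \<open>auto intro!: continuous_intros continuous_r\<close>)
  from primitive_on_integral[OF this] assms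
  have "\<beta> * s_time t = \<psi> t - \<psi> 0"
    unfolding s_time_def set_integral_mult_right[symmetric] by simp
  moreover have "\<psi> 0 < \<psi> t"
  proof (rule DERIV_pos_imp_increasing[OF assms])
    fix s
    have "\<beta> / r s > 0" using \<beta>_pos r_pos by simp
    then show "\<exists>y. (\<psi> has_real_derivative y) (at s) \<and> 0 < y" using \<psi>_deriv_r by blast
  qed
  ultimately show ?thesis using \<beta>_pos by (metis diff_gt_0_iff_gt zero_less_mult_pos)
qed

text \<open>The vanishing of this functional says that \<open>zeta\<close> changes by the sign \<open>(-1)\<^sup>j\<close> from time \<open>0\<close>
  to time \<open>j T\<close>.\<close>

definition anti_defect :: "nat \<Rightarrow> nat \<Rightarrow> (real \<Rightarrow> complex) \<Rightarrow> complex" where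
  "anti_defect k j \<xi> = \<xi> (real j * T) - \<xi> 0
     + of_real (M \<xi> (real j * T) - M \<xi> (real k * T) / s_time (real k * T) * s_time (real j * T)) * (2 * z 0 * w 0)"

lemma M_add:
  assumes "continuous_on {0..t} \<xi>" "continuous_on {0..t} \<eta>"
  shows "M (\<lambda>s. \<xi> s + \<eta> s) t = M \<xi> t + M \<eta> t"
  unfolding M_def
  by (subst set_integral_add(2)[symmetric])
    (use assms r_nonzero in \<open>auto intro!: set_integrable_continuous_real continuous_intros continuous_z continuous_r
      simp: algebra_simps add_divide_distrib diff_divide_distrib\<close>)

lemma M_scale: "M (\<lambda>s. of_real a * \<xi> s) t = a * M \<xi> t"
  unfolding M_def set_integral_mult_right[symmetric] by (simp add: algebra_simps diff_divide_distrib)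

lemma anti_defect_add:
  assumes "continuous_on {0..real k * T} \<xi>" "continuous_on {0..real k * T} \<eta>" "j \<le> k"
  shows "anti_defect k j (\<lambda>s. \<xi> s + \<eta> s) = anti_defect k j \<xi> + anti_defect k j \<eta>"
proof -
  have sub: "{0..real j * T} \<subseteq> {0..real k * T}" using assms(3) T_pos by auto
  show ?thesis
    unfolding anti_defect_def M_add[OF assms(1,2)]
      M_add[OF continuous_on_subset[OF assms(1) sub] continuous_on_subset[OF assms(2) sub]]
    by (simp add: algebra_simps add_divide_distrib)
qed

lemma anti_defect_scale: "anti_defect k j (\<lambda>s. of_real a * \<xi> s) = of_real a * anti_defect k j \<xi>"
  unfolding anti_defect_def M_scale by (simp add: algebra_simps)

text \<open>The defects are prescribed for 0 < j < k only: at j = 0 and j = k the sign rule holds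
  automatically because \<xi> is periodic and \<open>n\<close> vanishes at both ends. Every
  revolution then contributes a nonnegative amount, and so does the remainder in c^2.\<close>

lemma index_form_nonneg:
  assumes \<xi>: "primitive_on 0 (real k * T) \<xi> g" and per: "\<xi> (real k * T) = \<xi> 0" and k: "k \<ge> 1"
    and g2: "set_integrable lborel {0..real k * T} (\<lambda>t. (norm (g t))\<^sup>2)"
    and defect: "\<And>j. j \<in> {1..<k} \<Longrightarrow> anti_defect k j \<xi> = 0"
  shows "0 \<le> (LINT t:{0..real k * T}|lborel. index_form t \<xi> (g t))"
proof -
  define \<tau> where "\<tau> = real k * T"
  have \<tau>: "0 < \<tau>" using k T_pos by (simp add: \<tau>_def)
  \<comment> \<open>The only value for which \<open>n\<close>, which starts at 0, also ends at
    0.\<close>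
  define c where "c = M \<xi> \<tau> / s_time \<tau>"
  define n where "n = (\<lambda>t. M \<xi> t - c * s_time t)"
  have n: "primitive_on 0 \<tau> n (n_deriv \<xi> c)"
  proof -
    have "primitive_on 0 \<tau> (\<lambda>t. M \<xi> t - c *\<^sub>R s_time t) (\<lambda>t. Re (cnj (z t ^ 2) * \<xi> t) / r t ^ 3 - c *\<^sub>R (1 / r t))"
      by (intro primitive_on_minus primitive_M primitive_on_continuous_on[OF \<xi>[folded \<tau>_def]]
          primitive_on_linear[OF primitive_s_time] bounded_linear_scaleR_right) (use \<tau> in auto)
    then show ?thesis by (rule primitive_on_cong) (auto simp: n_def n_deriv_def)
  qed
  have n_ends: "n 0 = 0" "n \<tau> = 0"
    using s_time_pos[OF \<tau>] by (auto simp: n_def M_0 s_time_0 c_def)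
  note zeta = primitive_zeta[OF \<xi>[folded \<tau>_def] n]
  have alternate: "zeta \<xi> n (real j * T) = (- 1) ^ j * zeta \<xi> n 0" if "j \<le> k" for j
  proof -
    \<comment> \<open>Multiplying \<open>zeta\<close> by 2 z clears the alternating sign, because z
      w takes the same value at every multiple of \<open>T\<close>.\<close>
    have "\<xi> (real j * T) + of_real (n (real j * T)) * (2 * z 0 * w 0) = \<xi> 0"
    proof (cases "j = 0 \<or> j = k")
      case True
      then show ?thesis using per n_ends by (auto simp: \<tau>_def)
    next
      case False
      then show ?thesis
        using defect[of j] that by (simp add: anti_defect_def n_def c_def \<tau>_def algebra_simps)
    qed
    then have "(\<xi> (real j * T) + of_real (n (real j * T)) * (2 * z 0 * w 0)) / (2 * z 0) = \<xi> 0 / (2 * z 0)" by simp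
    moreover have "(\<xi> (real j * T) + of_real (n (real j * T)) * (2 * z 0 * w 0)) / (2 * z 0)
       = \<xi> (real j * T) / (2 * z 0) + of_real (n (real j * T)) * w 0"
      using z_nonzero[of 0] by (simp add: field_simps)
    moreover have "zeta \<xi> n (real j * T) = (- 1) ^ j * (\<xi> (real j * T) / (2 * z 0) + of_real (n (real j * T)) * w 0)"
      unfolding zeta_def using z_shift_nat[of 0 j] w_shift_nat[of 0 j]
      by (cases "even j") (auto simp: algebra_simps)
    ultimately show ?thesis by (simp add: zeta_def n_ends)
  qed
  note identity = index_form_identity[OF \<xi>[folded \<tau>_def] n less_imp_le[OF \<tau>] per[folded \<tau>_def] _
      z_w_at_period[of k, folded \<tau>_def] g2[folded \<tau>_def]]
  have n_per: "n \<tau> = n 0" using n_ends by simp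
  define A where "A = (\<lambda>t. r t * (norm (zeta_deriv \<xi> g n c t))\<^sup>2 - \<beta>\<^sup>2 * (norm (zeta \<xi> n t))\<^sup>2 / r t)"
  have A: "set_integrable lborel {0..\<tau>} A"
    unfolding A_def
    by (intro set_integral_diff(1) identity(1)[OF n_per] set_integrable_continuous_real continuous_intros
        primitive_on_continuous_on[OF zeta] continuous_r) (use r_nonzero in auto)
  define f where "f = (\<lambda>t. LINT s:{0..t}|lborel. A s)"
  have f: "primitive_on 0 \<tau> f A"
    unfolding f_def by (rule primitive_on_indefinite_integral[OF A]) (use \<tau> in simp)
  \<comment> \<open>Induction over revolutions: on each one the Wirtinger inequality with p =
    \<beta>/r has integrand \<open>A t\<close> divided by \<beta>, so \<open>f\<close> does not
    decrease from one multiple of \<open>T\<close> to the next.\<close>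
  have "0 \<le> f (real j * T)" if "j \<le> k" for j
    using that
  proof (induction j)
    case 0
    show ?case unfolding f_def
      by (subst set_borel_integral_eq_integral(2)) (use set_integrable_subset[OF A, of "{0..0}"] \<tau> in auto)
  next
    case (Suc j)
    define a b where "a = real j * T" and "b = real (Suc j) * T"
    have ab: "0 \<le> a" "a \<le> b" "b \<le> \<tau>"
      using Suc(2) T_pos by (auto simp: a_def b_def \<tau>_def mult_right_mono)
    have "0 \<le> (LINT t:{a..b}|lborel. (norm (zeta_deriv \<xi> g n c t))\<^sup>2 / (\<beta> / r t) - \<beta> / r t * (norm (zeta \<xi> n t))\<^sup>2)"
    proof (rule antiperiodic_wirtinger[where \<psi> = \<psi>])
      show "primitive_on a b (zeta \<xi> n) (zeta_deriv \<xi> g n c)"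
        by (rule primitive_on_subinterval[OF zeta]) (use ab in auto)
      show "\<psi> b = \<psi> a + pi" using \<psi>_shift[of a] by (simp add: a_def b_def algebra_simps)
      show "zeta \<xi> n b = - zeta \<xi> n a"
        using alternate[of j] alternate[of "Suc j"] Suc(2) by (simp add: a_def b_def)
      have "set_integrable lborel {a..b} (\<lambda>t. (1 / \<beta>) * (r t * (norm (zeta_deriv \<xi> g n c t))\<^sup>2))"
        by (intro set_integrable_mult_right set_integrable_subset[OF identity(1)[OF n_per]]) (use ab in auto)
      then show "set_integrable lborel {a..b} (\<lambda>t. (norm (zeta_deriv \<xi> g n c t))\<^sup>2 / (\<beta> / r t))"
        by (simp add: mult.commute)
    qed (use ab \<psi>_deriv_r r_nonzero r_pos \<beta>_pos in \<open>auto intro!: continuous_intros continuous_r\<close>)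
    also have "(\<lambda>t. (norm (zeta_deriv \<xi> g n c t))\<^sup>2 / (\<beta> / r t) - \<beta> / r t * (norm (zeta \<xi> n t))\<^sup>2) = (\<lambda>t. A t * (1 / \<beta>))"
      using \<beta>_pos by (auto simp: A_def field_simps power2_eq_square)
    finally have "0 \<le> (LINT t:{a..b}|lborel. A t)"
      using \<beta>_pos by (simp add: zero_le_divide_iff)
    then have "f a \<le> f b" using primitive_on_diff(2)[OF f ab] by simp
    then show ?case using Suc by (simp add: a_def b_def)
  qed
  from this[of k] have "0 \<le> (LINT t:{0..\<tau>}|lborel. A t)" by (simp add: f_def \<tau>_def)
  moreover have "0 \<le> (LINT t:{0..\<tau>}|lborel. ((norm (w t))\<^sup>2 + 2 * \<beta>\<^sup>2 * r t) / r t)"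
    by (intro set_integral_nonneg divide_nonneg_nonneg add_nonneg_nonneg mult_nonneg_nonneg less_imp_le[OF r_pos]) auto
  ultimately show ?thesis
    unfolding \<tau>_def[symmetric] identity(2)[OF n_per] A_def[symmetric] by simp
qed

section \<open>Lower bound: explicit negative modes\<close>

lemma cis_deriv:
  "((\<lambda>t. cis (a * \<psi> t)) has_vector_derivative of_real (\<beta> / r t) * (\<i> * of_real a * cis (a * \<psi> t))) (at t)"
proof -
  have "((\<lambda>t. a * \<psi> t) has_real_derivative a * (\<beta> / r t)) (at t)"
    by (auto intro!: derivative_eq_intros \<psi>_deriv_r)
  then have "((\<lambda>t. \<i> * of_real (a * \<psi> t)) has_vector_derivative \<i> * of_real (a * (\<beta> / r t))) (at t)"
    by (intro has_vector_derivative_mult_right has_vector_derivative_of_real)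
  from field_vector_diff_chain_at[OF this DERIV_exp]
  show ?thesis by (simp add: o_def cis_conv_exp mult_ac)
qed

lemma continuous_\<psi>: "continuous_on A \<psi>"
  using \<psi>_deriv by (meson DERIV_isCont continuous_at_imp_continuous_on)

lemma r_deriv: "(r has_real_derivative 2 * Re (cnj (z t) * w t) / r t) (at t)"
proof -
  have re: "((\<lambda>t. Re (z t)) has_real_derivative Re (w t) / r t) (at t)"
    and im: "((\<lambda>t. Im (z t)) has_real_derivative Im (w t) / r t) (at t)"
    using bounded_linear.has_vector_derivative[OF bounded_linear_Re z_deriv[of t]]
      bounded_linear.has_vector_derivative[OF bounded_linear_Im z_deriv[of t]]
    by (simp_all add: has_real_derivative_iff_has_vector_derivative r_def Re_divide_of_real Im_divide_of_real del: of_real_power)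
  have "((\<lambda>t. (Re (z t))\<^sup>2 + (Im (z t))\<^sup>2) has_real_derivative 2 * Re (cnj (z t) * w t) / r t) (at t)"
    using DERIV_add[OF DERIV_power[OF re, of 2] DERIV_power[OF im, of 2]] by (simp add: add_divide_distrib mult_ac)
  then show ?thesis by (simp add: r_def[abs_def] cmod_power2)
qed

definition freq :: "nat \<Rightarrow> nat \<Rightarrow> real" where "freq k j = 1 - 2 * real j / real k"

lemma freq_bounds: "j \<in> {1..<k} \<Longrightarrow> - 1 < freq k j \<and> freq k j < 1"
  by (auto simp: freq_def field_simps)

definition mode :: "nat \<Rightarrow> (nat \<Rightarrow> complex) \<Rightarrow> real \<Rightarrow> complex" where
  "mode k c t = (\<Sum>j\<in>{1..<k}. c j * cis (freq k j * \<psi> t))"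

definition mode_deriv :: "nat \<Rightarrow> (nat \<Rightarrow> complex) \<Rightarrow> real \<Rightarrow> complex" where
  "mode_deriv k c t = (\<Sum>j\<in>{1..<k}. c j * (of_real (\<beta> / r t) * (\<i> * of_real (freq k j) * cis (freq k j * \<psi> t))))"

text \<open>An antiderivative of \<open>cnj z * mode k c\<close> with respect to \<open>\<psi>\<close>.\<close>

definition mode_potential :: "nat \<Rightarrow> (nat \<Rightarrow> complex) \<Rightarrow> real \<Rightarrow> complex" where
  "mode_potential k c t = (\<Sum>j\<in>{1..<k}. c j *
     (cnj P / (\<i> * of_real (freq k j - 1)) * cis ((freq k j - 1) * \<psi> t)
      + cnj Q / (\<i> * of_real (freq k j + 1)) * cis ((freq k j + 1) * \<psi> t)))"

text \<open>Prescribing \<open>zeta\<close> gives \<xi> = 2 z (zeta - n w), and inserting this into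
  n' = \<open>n_deriv \<xi> 0\<close> leaves a linear equation for n with integrating factor r,
  namely (r n)' = 2 Re(cnj z zeta)/r. The solution below is periodic with c = 0 because
  \<open>freq k j - 1\<close> and \<open>freq k j + 1\<close> are nonzero for 0 < j < k, so the
  potential has no term growing with \<psi>.\<close>

definition mode_n :: "nat \<Rightarrow> (nat \<Rightarrow> complex) \<Rightarrow> real \<Rightarrow> real" where
  "mode_n k c t = 2 * Re (mode_potential k c t) / (\<beta> * r t)"

definition mode_loop :: "nat \<Rightarrow> (nat \<Rightarrow> complex) \<Rightarrow> real \<Rightarrow> complex" where
  "mode_loop k c t = 2 * z t * (mode k c t - of_real (mode_n k c t) * w t)"

lemma mode_has_derivative: "(mode k c has_vector_derivative mode_deriv k c t) (at t)"
  unfolding mode_def[abs_def] mode_deriv_def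
  by (intro has_vector_derivative_sum has_vector_derivative_mult_right cis_deriv)

lemma mode_potential_has_derivative:
  "(mode_potential k c has_vector_derivative of_real (\<beta> / r t) * (cnj (z t) * mode k c t)) (at t)"
proof -
  have "(mode_potential k c has_vector_derivative (\<Sum>j\<in>{1..<k}. c j *
     (cnj P / (\<i> * of_real (freq k j - 1)) * (of_real (\<beta> / r t) * (\<i> * of_real (freq k j - 1) * cis ((freq k j - 1) * \<psi> t)))
      + cnj Q / (\<i> * of_real (freq k j + 1)) * (of_real (\<beta> / r t) * (\<i> * of_real (freq k j + 1) * cis ((freq k j + 1) * \<psi> t)))))) (at t)"
    unfolding mode_potential_def[abs_def]
    by (intro has_vector_derivative_sum has_vector_derivative_mult_right has_vector_derivative_add cis_deriv)
  also have "(\<Sum>j\<in>{1..<k}. c j *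
     (cnj P / (\<i> * of_real (freq k j - 1)) * (of_real (\<beta> / r t) * (\<i> * of_real (freq k j - 1) * cis ((freq k j - 1) * \<psi> t)))
      + cnj Q / (\<i> * of_real (freq k j + 1)) * (of_real (\<beta> / r t) * (\<i> * of_real (freq k j + 1) * cis ((freq k j + 1) * \<psi> t)))))
    = of_real (\<beta> / r t) * (cnj (z t) * mode k c t)"
    unfolding mode_def sum_distrib_left
  proof (rule sum.cong[OF refl])
    fix j assume "j \<in> {1..<k}"
    from freq_bounds[OF this] have ne: "\<i> * complex_of_real (freq k j - 1) \<noteq> 0" "\<i> * complex_of_real (freq k j + 1) \<noteq> 0"
      by (simp_all del: of_real_diff of_real_add)
    have cz: "cnj (z t) = cnj P * cis (- \<psi> t) + cnj Q * cis (\<psi> t)"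
      by (simp add: z_eq cis_cnj)
    have e: "cis ((freq k j - 1) * \<psi> t) = cis (- \<psi> t) * cis (freq k j * \<psi> t)"
      "cis ((freq k j + 1) * \<psi> t) = cis (\<psi> t) * cis (freq k j * \<psi> t)"
      by (simp_all add: cis_mult algebra_simps)
    have cancel: "a / d * (e * (d * f)) = e * (a * f)" if "d \<noteq> 0" for a d e f :: complex
      using that by simp
    show "c j * (cnj P / (\<i> * of_real (freq k j - 1)) * (of_real (\<beta> / r t) * (\<i> * of_real (freq k j - 1) * cis ((freq k j - 1) * \<psi> t)))
      + cnj Q / (\<i> * of_real (freq k j + 1)) * (of_real (\<beta> / r t) * (\<i> * of_real (freq k j + 1) * cis ((freq k j + 1) * \<psi> t))))
      = of_real (\<beta> / r t) * (cnj (z t) * (c j * cis (freq k j * \<psi> t)))"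
      unfolding cancel[OF ne(1)] cancel[OF ne(2)] cz e by (simp only: algebra_simps)
  qed
  finally show ?thesis .
qed

lemma mode_n_has_derivative: "(mode_n k c has_real_derivative n_deriv (mode_loop k c) 0 t) (at t)"
proof -
  have W: "((\<lambda>t. Re (mode_potential k c t)) has_real_derivative \<beta> / r t * Re (cnj (z t) * mode k c t)) (at t)"
    using bounded_linear.has_vector_derivative[OF bounded_linear_Re mode_potential_has_derivative[of k c t]]
    unfolding has_real_derivative_iff_has_vector_derivative by simp
  define u where "u = Re (cnj (z t) * mode k c t)"
  define v where "v = Re (cnj (z t) * w t)"
  have "(mode_n k c has_real_derivative (2 * (\<beta> / r t * u) * (\<beta> * r t) - 2 * Re (mode_potential k c t) * (\<beta> * (2 * v / r t)))
      / ((\<beta> * r t) * (\<beta> * r t))) (at t)"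
    unfolding mode_n_def[abs_def] u_def v_def
    by (intro DERIV_divide DERIV_cmult W r_deriv) (use \<beta>_pos r_nonzero in simp)
  also have "(2 * (\<beta> / r t * u) * (\<beta> * r t) - 2 * Re (mode_potential k c t) * (\<beta> * (2 * v / r t))) / ((\<beta> * r t) * (\<beta> * r t))
     = 2 * u / (r t)\<^sup>2 - 2 * mode_n k c t * v / (r t)\<^sup>2"
  proof -
    have "(2 * (b / R * u) * (b * R) - 2 * A * (b * (2 * v / R))) / ((b * R) * (b * R)) = 2 * u / R\<^sup>2 - 2 * (2 * A / (b * R)) * v / R\<^sup>2"
      if "b \<noteq> 0" "R \<noteq> 0" for b R A :: real
      using that by (simp add: field_simps power2_eq_square)
    then show ?thesis unfolding mode_n_def using \<beta>_pos r_nonzero by simp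
  qed
  also have "2 * u / (r t)\<^sup>2 - 2 * mode_n k c t * v / (r t)\<^sup>2 = n_deriv (mode_loop k c) 0 t"
  proof -
    have "cnj (z t ^ 2) * mode_loop k c t
       = of_real (2 * r t) * (cnj (z t) * mode k c t) - of_real (2 * r t * mode_n k c t) * (cnj (z t) * w t)"
      by (simp add: mode_loop_def of_real_r power2_eq_square algebra_simps)
    moreover have "Re (complex_of_real a * x) = a * Re x" for a x by simp
    ultimately have "Re (cnj (z t ^ 2) * mode_loop k c t) = 2 * r t * u - 2 * r t * mode_n k c t * v"
      unfolding u_def v_def by (simp only: minus_complex.sel)
    then show ?thesis
      unfolding n_deriv_def by (simp only:) (use r_pos[of t] in \<open>simp add: field_simps power2_eq_square power3_eq_cube\<close>)
  qed
  finally show ?thesis .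
qed

lemma zeta_mode_loop: "zeta (mode_loop k c) (mode_n k c) = mode k c"
  using z_nonzero by (auto simp: fun_eq_iff zeta_def mode_loop_def)

lemma mode_loop_C1:
  "\<exists>g. continuous_on UNIV g \<and> (\<forall>t. (mode_loop k c has_vector_derivative g t) (at t))"
proof -
  have n: "((\<lambda>t. complex_of_real (mode_n k c t)) has_vector_derivative of_real (n_deriv (mode_loop k c) 0 t)) (at t)" for t
    by (rule has_vector_derivative_of_real[OF mode_n_has_derivative])
  have cont: "continuous_on UNIV (mode k c)" "continuous_on UNIV (mode_n k c)"
    using mode_has_derivative mode_n_has_derivative
    by (meson has_vector_derivative_continuous DERIV_isCont continuous_at_imp_continuous_on)+
  have cont_loop: "continuous_on UNIV (mode_loop k c)"
    unfolding mode_loop_def[abs_def] by (intro continuous_intros cont continuous_z continuous_w)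
  have "(mode_loop k c has_vector_derivative
      2 * z t * (mode_deriv k c t - (of_real (mode_n k c t) * (- of_real (\<beta>\<^sup>2) * z t / of_real ((norm (z t))\<^sup>2))
          + of_real (n_deriv (mode_loop k c) 0 t) * w t))
      + 2 * (w t / of_real ((norm (z t))\<^sup>2)) * (mode k c t - of_real (mode_n k c t) * w t)) (at t)" for t
    unfolding mode_loop_def[of k c, abs_def]
    by (intro has_vector_derivative_mult has_vector_derivative_diff has_vector_derivative_mult_right mode_has_derivative
        n[unfolded mode_loop_def[abs_def]] w_deriv z_deriv)
  moreover have "continuous_on UNIV (\<lambda>t. 2 * z t * (mode_deriv k c t - (of_real (mode_n k c t) * (- of_real (\<beta>\<^sup>2) * z t / of_real ((norm (z t))\<^sup>2))
          + of_real (n_deriv (mode_loop k c) 0 t) * w t))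
      + 2 * (w t / of_real ((norm (z t))\<^sup>2)) * (mode k c t - of_real (mode_n k c t) * w t))"
    unfolding n_deriv_def mode_deriv_def
    by (intro continuous_intros cont cont_loop continuous_z continuous_w continuous_r continuous_\<psi>)
      (use r_nonzero z_nonzero in auto)
  ultimately show ?thesis by blast
qed

text \<open>Over k revolutions the angles with frequencies \<open>freq k j - 1\<close> and
  \<open>freq k j + 1\<close> make whole turns, while \<open>mode\<close>, \<open>z\<close> and
  \<open>w\<close> all acquire the same sign (-1)^k, which cancels in the loop.\<close>

lemma
  assumes "k \<ge> 1"
  shows mode_n_periodic: "mode_n k c (t + real k * T) = mode_n k c t"
    and mode_loop_periodic: "mode_loop k c (t + real k * T) = mode_loop k c t"
proof -
  have fk: "freq k j * (real k * pi) = real k * pi - 2 * pi * real j" for j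
    using assms by (simp add: freq_def field_simps)
  have cis_npi: "cis (real n * pi) = (- 1) ^ n" for n
    by (induction n) (simp_all add: distrib_right cis_mult[symmetric])
  have cis_n: "cis (2 * pi * real n) = 1" for n
    by (simp add: cis_multiple_2pi)
  have shift: "cis (freq k j * (\<psi> t + real k * pi)) = (- 1) ^ k * cis (freq k j * \<psi> t)" for j
    unfolding distrib_left fk using cis_npi[of k] cis_n[of j]
    by (simp add: cis_mult[symmetric] cis_divide[symmetric])
  have mode: "mode k c (t + real k * T) = (- 1) ^ k * mode k c t"
    unfolding mode_def \<psi>_shift_nat shift sum_distrib_left by (simp add: mult_ac)
  have minus: "cis ((freq k j - 1) * (\<psi> t + real k * pi)) = cis ((freq k j - 1) * \<psi> t)" for j
  proof -
    have "(freq k j - 1) * (\<psi> t + real k * pi) = (freq k j - 1) * \<psi> t - 2 * pi * real j"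
      using fk[of j] by (simp add: algebra_simps)
    then show ?thesis using cis_n[of j] by (simp add: cis_divide[symmetric])
  qed
  have plus: "cis ((freq k j + 1) * (\<psi> t + real k * pi)) = cis ((freq k j + 1) * \<psi> t)" for j
  proof -
    have "(freq k j + 1) * (\<psi> t + real k * pi) = (freq k j + 1) * \<psi> t + 2 * pi * real k - 2 * pi * real j"
      using fk[of j] by (simp add: algebra_simps)
    then show ?thesis using cis_n[of j] cis_n[of k] by (simp add: cis_divide[symmetric] cis_mult[symmetric])
  qed
  show "mode_n k c (t + real k * T) = mode_n k c t"
    by (simp add: mode_n_def mode_potential_def \<psi>_shift_nat minus plus r_shift_nat)
  then show "mode_loop k c (t + real k * T) = mode_loop k c t"
    unfolding mode_loop_def mode z_shift_nat w_shift_nat by (cases "even k") (simp_all add: algebra_simps)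
qed

text \<open>Parseval in the variable \<psi>, with d\<psi> = (\<beta>/r) dt and total advance k
  \<pi>.\<close>

lemma mode_energy:
  assumes "k \<ge> 1"
  shows "(LINT t:{0..real k * T}|lborel. r t * (norm (mode_deriv k c t))\<^sup>2 - \<beta>\<^sup>2 * (norm (mode k c t))\<^sup>2 / r t)
    = \<beta> * real k * pi * (\<Sum>j\<in>{1..<k}. (norm (c j))\<^sup>2 * ((freq k j)\<^sup>2 - 1))"
proof -
  define \<tau> where "\<tau> = real k * T"
  have \<tau>: "0 \<le> \<tau>" using T_pos by (simp add: \<tau>_def)
  define h where "h = (\<lambda>j l. complex_of_real \<beta> * (of_real (freq k j) * of_real (freq k l) - 1) * (c j * cnj (c l)))"
  define D where "D = (\<lambda>t. \<Sum>j\<in>{1..<k}. \<Sum>l\<in>{1..<k}. h j l * (of_real (\<beta> / r t) * cis ((freq k j - freq k l) * \<psi> t)))"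
  \<comment> \<open>An antiderivative of \<open>D\<close>: the diagonal terms grow like \<psi>,
    whereas the off-diagonal ones return to their initial values, since frequency differences are
    multiples of 2/k.\<close>
  define V where "V = (\<lambda>t. \<Sum>j\<in>{1..<k}. \<Sum>l\<in>{1..<k}. h j l *
     (if j = l then of_real (\<psi> t) else cis ((freq k j - freq k l) * \<psi> t) / (\<i> * of_real (freq k j - freq k l))))"
  have freq_inj: "freq k j \<noteq> freq k l" if "j \<noteq> l" for j l
    using that assms by (simp add: freq_def)
  have V: "(V has_vector_derivative D t) (at t)" for t
    unfolding V_def D_def
  proof (intro has_vector_derivative_sum has_vector_derivative_mult_right)
    fix j l
    show "((\<lambda>t. if j = l then complex_of_real (\<psi> t) else cis ((freq k j - freq k l) * \<psi> t) / (\<i> * of_real (freq k j - freq k l)))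
      has_vector_derivative of_real (\<beta> / r t) * cis ((freq k j - freq k l) * \<psi> t)) (at t)"
    proof (cases "j = l")
      case True
      then show ?thesis using has_vector_derivative_of_real[OF \<psi>_deriv_r[of t], where 'a = complex] by simp
    next
      case False
      have "((\<lambda>t. 1 / (\<i> * of_real (freq k j - freq k l)) * cis ((freq k j - freq k l) * \<psi> t)) has_vector_derivative
         1 / (\<i> * of_real (freq k j - freq k l)) *
         (of_real (\<beta> / r t) * (\<i> * of_real (freq k j - freq k l) * cis ((freq k j - freq k l) * \<psi> t)))) (at t)"
        by (intro has_vector_derivative_mult_right cis_deriv)
      moreover have "1 / d * (e * (d * f)) = e * f" if "d \<noteq> 0" for d e f :: complex
        using that by simp
      moreover have "\<i> * complex_of_real (freq k j - freq k l) \<noteq> 0"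
        using freq_inj[OF False] by (simp del: of_real_diff)
      ultimately show ?thesis using False by simp
    qed
  qed
  have pV: "primitive_on 0 \<tau> V D"
    by (rule primitive_on_derivative[OF V])
      (use r_nonzero in \<open>auto simp: D_def intro!: continuous_intros continuous_r continuous_\<psi>\<close>)
  have cnj_D: "cnj (\<Sum>j\<in>{1..<k}. a j * cis (b j)) = (\<Sum>j\<in>{1..<k}. cnj (a j) * cis (- b j))" for a b
    by (simp add: cis_cnj)
  have pt: "r t * (norm (mode_deriv k c t))\<^sup>2 - \<beta>\<^sup>2 * (norm (mode k c t))\<^sup>2 / r t = Re (D t)" for t
  proof -
    define s where "s = complex_of_real (r t)"
    define b where "b = complex_of_real \<beta>"
    have s0: "s \<noteq> 0" using r_nonzero by (simp add: s_def)
    have md: "mode_deriv k c t = b / s * \<i> * (\<Sum>j\<in>{1..<k}. (c j * of_real (freq k j)) * cis (freq k j * \<psi> t))"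
      unfolding mode_deriv_def sum_distrib_left by (simp add: b_def s_def mult_ac)
    have "complex_of_real (r t * (norm (mode_deriv k c t))\<^sup>2 - \<beta>\<^sup>2 * (norm (mode k c t))\<^sup>2 / r t)
      = s * (mode_deriv k c t * cnj (mode_deriv k c t)) - b * b * (mode k c t * cnj (mode k c t)) / s"
      unfolding of_real_diff of_real_mult of_real_divide complex_norm_square s_def b_def
      by (simp add: power2_eq_square)
    also have "\<dots> = b * b / s * ((\<Sum>j\<in>{1..<k}. (c j * of_real (freq k j)) * cis (freq k j * \<psi> t))
          * (\<Sum>l\<in>{1..<k}. (cnj (c l) * of_real (freq k l)) * cis (- (freq k l * \<psi> t)))
        - (\<Sum>j\<in>{1..<k}. c j * cis (freq k j * \<psi> t)) * (\<Sum>l\<in>{1..<k}. cnj (c l) * cis (- (freq k l * \<psi> t))))"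
      unfolding md mode_def complex_cnj_mult complex_cnj_divide cnj_D using s0
      by (simp add: b_def s_def field_simps)
    also have "\<dots> = D t"
      unfolding D_def h_def sum_product unfolding sum_subtractf[symmetric] unfolding sum_distrib_left
      by (intro sum.cong refl) (simp add: b_def s_def cis_divide[symmetric] left_diff_distrib cis_inverse[symmetric] field_simps)
    finally show ?thesis by (metis Re_complex_of_real)
  qed
  have "(LINT t:{0..\<tau>}|lborel. Re (D t)) = Re (V \<tau>) - Re (V 0)"
    by (rule primitive_on_integral[OF primitive_on_Re[OF pV] \<tau>])
  also have "\<dots> = Re (V \<tau> - V 0)" by simp
  also have "V \<tau> - V 0 = (\<Sum>j\<in>{1..<k}. \<Sum>l\<in>{1..<k}. if j = l then h j l * of_real (real k * pi) else 0)"
    unfolding V_def sum_subtractf[symmetric]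
  proof (intro sum.cong refl)
    fix j l
    have \<psi>\<tau>: "\<psi> \<tau> = \<psi> 0 + real k * pi" using \<psi>_shift_nat[of 0 k] by (simp add: \<tau>_def)
    have "(freq k j - freq k l) * \<psi> \<tau> = (freq k j - freq k l) * \<psi> 0 + 2 * pi * (real l - real j)"
      unfolding \<psi>\<tau> using assms by (simp add: freq_def field_simps)
    then have "(freq k j - freq k l) * \<psi> \<tau> = (freq k j - freq k l) * \<psi> 0 + 2 * pi * real l - 2 * pi * real j"
      by (simp add: algebra_simps)
    then have "cis ((freq k j - freq k l) * \<psi> \<tau>) = cis ((freq k j - freq k l) * \<psi> 0)"
      by (simp add: cis_divide[symmetric] cis_mult[symmetric] cis_multiple_2pi)
    then show "h j l * (if j = l then of_real (\<psi> \<tau>) else cis ((freq k j - freq k l) * \<psi> \<tau>) / (\<i> * of_real (freq k j - freq k l)))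
       - h j l * (if j = l then of_real (\<psi> 0) else cis ((freq k j - freq k l) * \<psi> 0) / (\<i> * of_real (freq k j - freq k l)))
       = (if j = l then h j l * of_real (real k * pi) else 0)"
      by (auto simp: \<psi>\<tau> algebra_simps)
  qed
  also have "\<dots> = (\<Sum>j\<in>{1..<k}. h j j * of_real (real k * pi))"
    by (intro sum.cong refl) simp
  also have "\<dots> = of_real (\<beta> * real k * pi * (\<Sum>j\<in>{1..<k}. (norm (c j))\<^sup>2 * ((freq k j)\<^sup>2 - 1)))"
    unfolding sum_distrib_left of_real_sum
  proof (intro sum.cong refl)
    fix j
    show "h j j * of_real (real k * pi) = of_real (\<beta> * real k * pi * ((norm (c j))\<^sup>2 * ((freq k j)\<^sup>2 - 1)))"
      unfolding h_def of_real_mult complex_norm_square of_real_diff by (simp add: power2_eq_square)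
  qed
  finally show ?thesis unfolding pt \<tau>_def[symmetric] by simp
qed

text \<open>Stated for every admissible derivative \<open>g\<close>, because
  \<open>weak_deriv\<close> is some unspecified one. As c = 0, the square in
  \<open>index_form_identity\<close> disappears and only the Parseval sum with its factors
  \<open>freq\<close> squared minus 1 remains.\<close>

lemma mode_loop_negative:
  assumes k: "k \<ge> 1" and g: "primitive_on 0 (real k * T) (mode_loop k c) g"
    and g2: "set_integrable lborel {0..real k * T} (\<lambda>t. (norm (g t))\<^sup>2)"
    and nz: "\<exists>j\<in>{1..<k}. c j \<noteq> 0"
  shows "(LINT t:{0..real k * T}|lborel. index_form t (mode_loop k c) (g t)) < 0"
proof -
  define \<tau> where "\<tau> = real k * T"
  have \<tau>: "0 \<le> \<tau>" using T_pos by (simp add: \<tau>_def)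
  have cont: "continuous_on A (mode_loop k c)" for A
    using mode_loop_C1 by (meson has_vector_derivative_continuous continuous_at_imp_continuous_on)
  have n: "primitive_on 0 \<tau> (mode_n k c) (n_deriv (mode_loop k c) 0)"
    by (rule primitive_on_real_derivative[OF mode_n_has_derivative])
      (use r_nonzero in \<open>auto simp: n_deriv_def intro!: continuous_intros cont continuous_z continuous_r\<close>)
  have per: "mode_loop k c \<tau> = mode_loop k c 0"
    using mode_loop_periodic[OF k, of c 0] by (simp add: \<tau>_def)
  have n_per: "mode_n k c \<tau> = mode_n k c 0"
    using mode_n_periodic[OF k, of c 0] by (simp add: \<tau>_def)
  note identity = index_form_identity[OF g[folded \<tau>_def] n \<tau> per n_per z_w_at_period[of k, folded \<tau>_def] g2[folded \<tau>_def]]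
  have "primitive_on 0 \<tau> (mode k c) (zeta_deriv (mode_loop k c) g (mode_n k c) 0)"
    using primitive_zeta[OF g[folded \<tau>_def] n] by (simp add: zeta_mode_loop)
  moreover have "primitive_on 0 \<tau> (mode k c) (mode_deriv k c)"
    by (rule primitive_on_derivative[OF mode_has_derivative])
      (use r_nonzero in \<open>auto simp: mode_deriv_def intro!: continuous_intros continuous_r continuous_\<psi>\<close>)
  \<comment> \<open>Both functions are derivatives of the same \<open>mode k c\<close>, but
    \<open>g\<close> is arbitrary, so they can agree only almost everywhere.\<close>
  ultimately have AE: "AE t in lborel. t \<in> {0..\<tau>} \<longrightarrow> zeta_deriv (mode_loop k c) g (mode_n k c) 0 t = mode_deriv k c t"
    using \<tau> by (rule primitive_on_AE_unique)
  have "(LINT t:{0..\<tau>}|lborel. index_form t (mode_loop k c) (g t))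
      = 4 * (LINT t:{0..\<tau>}|lborel. r t * (norm (zeta_deriv (mode_loop k c) g (mode_n k c) 0 t))\<^sup>2 - \<beta>\<^sup>2 * (norm (mode k c t))\<^sup>2 / r t)"
    unfolding identity(2) zeta_mode_loop by simp
  also have "(LINT t:{0..\<tau>}|lborel. r t * (norm (zeta_deriv (mode_loop k c) g (mode_n k c) 0 t))\<^sup>2 - \<beta>\<^sup>2 * (norm (mode k c t))\<^sup>2 / r t)
     = (LINT t:{0..\<tau>}|lborel. r t * (norm (mode_deriv k c t))\<^sup>2 - \<beta>\<^sup>2 * (norm (mode k c t))\<^sup>2 / r t)"
  proof -
    have m: "set_integrable lborel {0..\<tau>} (\<lambda>t. \<beta>\<^sup>2 * (norm (mode k c t))\<^sup>2 / r t)"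
      "set_integrable lborel {0..\<tau>} (\<lambda>t. r t * (norm (mode_deriv k c t))\<^sup>2)"
      using r_nonzero unfolding mode_def mode_deriv_def
      by (auto intro!: set_integrable_continuous_real continuous_intros continuous_r continuous_\<psi>)
    show ?thesis
      unfolding set_lebesgue_integral_def
    proof (rule integral_cong_AE)
      show "AE t in lborel. indicat_real {0..\<tau>} t *\<^sub>R (r t * (norm (zeta_deriv (mode_loop k c) g (mode_n k c) 0 t))\<^sup>2 - \<beta>\<^sup>2 * (norm (mode k c t))\<^sup>2 / r t)
        = indicat_real {0..\<tau>} t *\<^sub>R (r t * (norm (mode_deriv k c t))\<^sup>2 - \<beta>\<^sup>2 * (norm (mode k c t))\<^sup>2 / r t)"
        using AE by eventually_elim (auto simp: indicator_def)
    qed (use set_integral_diff(1)[OF identity(1) m(1)] set_integral_diff(1)[OF m(2) m(1)] in \<open>auto simp: set_integrable_def\<close>)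
  qed
  also have "4 * \<dots> < 0"
  proof -
    obtain j0 where j0: "j0 \<in> {1..<k}" "c j0 \<noteq> 0" using nz by blast
    have f: "(freq k j)\<^sup>2 - 1 < 0" if "j \<in> {1..<k}" for j
      using freq_bounds[OF that] by (simp add: abs_square_less_1 abs_less_iff)
    have "(\<Sum>j\<in>{1..<k}. (norm (c j))\<^sup>2 * ((freq k j)\<^sup>2 - 1)) < (\<Sum>j\<in>{1..<k}. 0)"
    proof (rule sum_strict_mono_ex1)
      show "\<forall>j\<in>{1..<k}. (norm (c j))\<^sup>2 * ((freq k j)\<^sup>2 - 1) \<le> 0"
        by (intro ballI mult_nonneg_nonpos less_imp_le[OF f]) auto
      show "\<exists>j\<in>{1..<k}. (norm (c j))\<^sup>2 * ((freq k j)\<^sup>2 - 1) < 0"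
        by (rule bexI[OF _ j0(1)], rule mult_pos_neg[OF _ f[OF j0(1)]]) (use j0(2) in simp)
    qed simp
    moreover have "\<beta> * real k * pi > 0" using \<beta>_pos k by simp
    ultimately show ?thesis
      unfolding mode_energy[OF k, folded \<tau>_def] by (simp only: sum.neutral_const) (simp add: mult_pos_neg)
  qed
  finally show ?thesis by (simp add: \<tau>_def)
qed

end

section \<open>The Morse index\<close>

text \<open>Dimension count for functionals that are linear on \<open>V\<close> only, as
  \<open>anti_defect\<close> is additive for continuous functions but not for all functions. They
  are restricted to a basis of \<open>V\<close> and extended to one global linear map \<Phi>. If its
  kernel met \<open>V\<close> only in 0, the image of the basis would be too large an independent
  set in the span of \<open>card I\<close> coordinate functions.\<close>

lemma common_kernel:
  fixes V :: "'a::real_vector set" and F :: "'i \<Rightarrow> 'a \<Rightarrow> real"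
  assumes V: "subspace V" "finite B0" "V = span B0" and I: "finite I" "card I < dim V"
    and add: "\<And>i u v. i \<in> I \<Longrightarrow> u \<in> V \<Longrightarrow> v \<in> V \<Longrightarrow> F i (u + v) = F i u + F i v"
    and scale: "\<And>i a u. i \<in> I \<Longrightarrow> u \<in> V \<Longrightarrow> F i (a *\<^sub>R u) = a * F i u"
  shows "\<exists>v\<in>V. v \<noteq> 0 \<and> (\<forall>i\<in>I. F i v = 0)"
proof (rule ccontr)
  assume neg: "\<not> ?thesis"
  obtain B where B: "B \<subseteq> V" "independent B" "V \<subseteq> span B" "card B = dim V"
    using real_vector.basis_exists by blast
  have spanB: "span B = V"
    using B(1,3) V(1) by (metis real_vector.span_minimal subset_antisym)
  define G :: "'a \<Rightarrow> 'i \<Rightarrow> real" where "G v = (\<lambda>i. if i \<in> I then F i v else 0)" for v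
  obtain \<Phi> where \<Phi>: "linear \<Phi>" "\<forall>b\<in>B. \<Phi> b = G b"
    using linear_independent_extend[OF B(2), of G] by blast
  have eq: "v \<in> V \<and> \<Phi> v = G v" if "v \<in> span B" for v
    using that
  proof (induction rule: real_vector.span_induct)
    show "subspace {v. v \<in> V \<and> \<Phi> v = G v}"
    proof (rule real_vector.subspaceI)
      have "F i 0 = 0" if "i \<in> I" for i
        using scale[OF that real_vector.subspace_0[OF V(1)], of 0] by simp
      then show "0 \<in> {v. v \<in> V \<and> \<Phi> v = G v}"
        using real_vector.subspace_0[OF V(1)] linear_0[OF \<Phi>(1)] by (auto simp: G_def fun_eq_iff zero_fun_def)
    qed (use add scale V(1) in \<open>auto simp: G_def fun_eq_iff plus_fun_def scaleR_fun_def linear_add[OF \<Phi>(1)] linear_scale[OF \<Phi>(1)]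
        intro: real_vector.subspace_add real_vector.subspace_scale\<close>)
  qed (use B(1) \<Phi>(2) in auto)
  have "inj_on \<Phi> (span B)"
  proof (rule inj_onI)
    fix u v assume uv: "u \<in> span B" "v \<in> span B" "\<Phi> u = \<Phi> v"
    then have d: "u - v \<in> span B" by (intro real_vector.span_diff)
    have "\<Phi> (u - v) = 0" using uv(3) by (simp add: linear_diff[OF \<Phi>(1)])
    then have "\<forall>i\<in>I. F i (u - v) = 0"
      using eq[OF d] by (auto simp: G_def fun_eq_iff zero_fun_def split: if_splits)
    then have "u - v = 0" using neg d spanB by blast
    then show "u = v" by simp
  qed
  then have ind: "independent (\<Phi> ` B)"
    using linear_independent_injective_image[OF \<Phi>(1) B(2)] by blast
  define e :: "'i \<Rightarrow> 'i \<Rightarrow> real" where "e i = (\<lambda>j. if j = i then 1 else 0)" for i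
  have "\<Phi> ` B \<subseteq> span (e ` I)"
  proof
    fix y assume "y \<in> \<Phi> ` B"
    then obtain b where b: "y = G b" using \<Phi>(2) by auto
    have "(\<Sum>i\<in>I. F i b *\<^sub>R e i) j = (\<Sum>i\<in>I. (F i b *\<^sub>R e i) j)" for j
      using I(1) by (induction rule: finite_induct) (auto simp: zero_fun_def plus_fun_def)
    then have "y = (\<Sum>i\<in>I. F i b *\<^sub>R e i)"
      using I(1) by (auto simp: b G_def e_def scaleR_fun_def fun_eq_iff if_distrib cong: if_cong)
    then show "y \<in> span (e ` I)"
      by (simp only:) (intro real_vector.span_sum real_vector.span_scale real_vector.span_base imageI)
  qed
  from real_vector.independent_span_bound[OF finite_imageI[OF I(1)] ind this]
  have "card (\<Phi> ` B) \<le> card (e ` I)" by simp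
  also have "\<dots> \<le> card I" by (rule card_image_le[OF I(1)])
  finally have "card B \<le> card I"
    using card_image[OF inj_on_subset[OF \<open>inj_on \<Phi> (span B)\<close> real_vector.span_superset]] by simp
  then show False using B(4) I(2) by simp
qed

section \<open>The plane as complex numbers, the Hessian of the potential, and loops of class
  H1\<close>

definition to_complex :: "real ^ 2 \<Rightarrow> complex" where "to_complex q = Complex (q $ 1) (q $ 2)"
definition of_complex :: "complex \<Rightarrow> real ^ 2" where "of_complex c = (\<chi> i. if i = 1 then Re c else Im c)"

lemma to_of_complex [simp]: "to_complex (of_complex c) = c"
  by (simp add: to_complex_def of_complex_def)

lemma bounded_linear_to_complex: "bounded_linear to_complex"
  by (intro linear_conv_bounded_linear[THEN iffD1] linearI)
    (auto simp: to_complex_def complex_eq_iff)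

lemma bounded_linear_of_complex: "bounded_linear of_complex"
  by (intro linear_conv_bounded_linear[THEN iffD1] linearI)
    (auto simp: of_complex_def vec_eq_iff)

lemma inner_to_complex: "p \<bullet> q = Re (cnj (to_complex p) * to_complex q)"
  by (simp add: to_complex_def inner_vec_def sum_2)

lemma norm_to_complex: "norm (to_complex q) = norm q"
  by (simp add: to_complex_def norm_vec_def L2_set_def sum_2 cmod_def)

lemma norm_of_complex: "norm (of_complex c) = norm c"
  by (metis norm_to_complex to_of_complex)

lemma U_has_derivative:
  assumes "p \<noteq> 0"
  shows "(U m has_derivative (\<lambda>h. - m * (p \<bullet> h) / norm p ^ 3)) (at p)"
  unfolding U_def[abs_def] using assms
  by (auto intro!: derivative_eq_intros has_derivative_norm[THEN has_derivative_compose] simp: sgn_div_norm field_simps inner_commute power2_eq_square power3_eq_cube)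

lemma D2U_eq:
  assumes "q \<noteq> 0"
  shows "D2U m q \<xi> \<eta> = m * (3 * (q \<bullet> \<xi>) * (q \<bullet> \<eta>) / norm q ^ 5 - (\<xi> \<bullet> \<eta>) / norm q ^ 3)"
proof -
  have dU: "frechet_derivative (U m) (at p) \<eta> = - m * (p \<bullet> \<eta>) / norm p ^ 3" if "p \<noteq> 0" for p
    using fun_cong[OF frechet_derivative_at[OF U_has_derivative[OF that, of m]], of \<eta>] by (rule sym)
  have "((\<lambda>p. - m * (p \<bullet> \<eta>) / norm p ^ 3) has_derivative
      (\<lambda>h. m * (3 * (q \<bullet> h) * (q \<bullet> \<eta>) / norm q ^ 5 - (h \<bullet> \<eta>) / norm q ^ 3))) (at q)"
  proof -
    have N: "(norm has_derivative (\<lambda>h. (q \<bullet> h) / norm q)) (at q)"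
      using has_derivative_norm[OF assms] by (simp add: sgn_div_norm divide_inverse mult.commute inner_commute)
    show ?thesis
      using assms
      by (auto intro!: derivative_eq_intros N simp: fun_eq_iff field_simps inner_commute power_numeral_reduce)
  qed
  \<comment> \<open>The formula for the first derivative holds away from the origin only, so it is
    substituted on the open set \<open>- {0}\<close> around \<open>q\<close> before differentiating
    again.\<close>
  then have "((\<lambda>p. frechet_derivative (U m) (at p) \<eta>) has_derivative
      (\<lambda>h. m * (3 * (q \<bullet> h) * (q \<bullet> \<eta>) / norm q ^ 5 - (h \<bullet> \<eta>) / norm q ^ 3))) (at q)"
    by (rule has_derivative_transform_within_open[where s = "- {0}"]) (use assms dU in auto)
  from fun_cong[OF frechet_derivative_at[OF this], of \<xi>] show ?thesis
    unfolding D2U_def by (rule sym)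
qed

text \<open>On a bounded interval a square-integrable function is integrable, being dominated by 1 +
  |g|^2.\<close>

lemma is_weak_deriv_primitive_on:
  assumes "is_weak_deriv \<tau> \<xi> g"
  shows "primitive_on 0 \<tau> \<xi> g"
proof -
  note w = assms[unfolded is_weak_deriv_def]
  note m = w[THEN conjunct1] and i = w[THEN conjunct2, THEN conjunct1] and p = w[THEN conjunct2, THEN conjunct2]
  have "set_integrable lborel {0..\<tau>} (\<lambda>t. 1 + (norm (g t))\<^sup>2)"
    by (intro set_integral_add(1) i set_integrable_continuous_real continuous_intros)
  then have "set_integrable lborel {0..\<tau>} g"
  proof (rule set_integrable_bound)
    show "set_borel_measurable lborel {0..\<tau>} g"
      unfolding set_borel_measurable_def using m by measurable
    have "x \<le> norm (1 + x\<^sup>2)" if "0 \<le> x" for x :: real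
      using power2_diff[of x 1] zero_le_power2[of "x - 1"] that by simp
    then have "norm (g t) \<le> norm (1 + (norm (g t))\<^sup>2)" for t by simp
    then show "AE t in lborel. t \<in> {0..\<tau>} \<longrightarrow> norm (g t) \<le> norm (1 + (norm (g t))\<^sup>2)" by simp
  qed
  then show ?thesis unfolding primitive_on_def using p by (rule conjI)
qed

lemma weak_deriv_H1_loop:
  assumes "\<xi> \<in> H1_loops \<tau>"
  shows "is_weak_deriv \<tau> \<xi> (weak_deriv \<tau> \<xi>)"
  using assms someI_ex[of "is_weak_deriv \<tau> \<xi>"] unfolding H1_loops_def weak_deriv_def by blast

lemma H1_loop_complex:
  assumes "\<xi> \<in> H1_loops \<tau>"
  shows "primitive_on 0 \<tau> (\<lambda>t. to_complex (\<xi> t)) (\<lambda>t. to_complex (weak_deriv \<tau> \<xi> t))"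
    and "set_integrable lborel {0..\<tau>} (\<lambda>t. (norm (to_complex (weak_deriv \<tau> \<xi> t)))\<^sup>2)"
    and "\<xi> \<tau> = \<xi> 0"
proof -
  note w = weak_deriv_H1_loop[OF assms]
  show "primitive_on 0 \<tau> (\<lambda>t. to_complex (\<xi> t)) (\<lambda>t. to_complex (weak_deriv \<tau> \<xi> t))"
    by (rule primitive_on_linear[OF is_weak_deriv_primitive_on[OF w] bounded_linear_to_complex])
  show "set_integrable lborel {0..\<tau>} (\<lambda>t. (norm (to_complex (weak_deriv \<tau> \<xi> t)))\<^sup>2)"
    unfolding norm_to_complex by (rule w[unfolded is_weak_deriv_def, THEN conjunct2, THEN conjunct1])
  have "\<xi> (0 + \<tau>) = \<xi> 0" using assms unfolding H1_loops_def periodic_def by blast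
  then show "\<xi> \<tau> = \<xi> 0" by simp
qed

lemma C1_periodic_H1_loop:
  fixes f :: "real \<Rightarrow> complex"
  assumes "\<And>t. (f has_vector_derivative g t) (at t)" "continuous_on UNIV g" "\<And>t. f (t + \<tau>) = f t"
  shows "(\<lambda>t. of_complex (f t)) \<in> H1_loops \<tau>"
proof -
  have c: "continuous_on A g" for A using assms(2) continuous_on_subset by blast
  have "primitive_on 0 \<tau> (\<lambda>t. of_complex (f t)) (\<lambda>t. of_complex (g t))"
    by (intro primitive_on_linear[OF _ bounded_linear_of_complex] primitive_on_derivative assms(1) c)
  moreover have "(\<lambda>t. of_complex (g t)) \<in> borel_measurable lborel"
    using continuous_on_compose2[OF linear_continuous_on[OF bounded_linear_of_complex] assms(2)]
    by (auto intro: borel_measurable_continuous_onI)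
  moreover have "set_integrable lborel {0..\<tau>} (\<lambda>t. (norm (of_complex (g t)))\<^sup>2)"
    unfolding norm_of_complex by (intro set_integrable_continuous_real continuous_intros c)
  ultimately have "is_weak_deriv \<tau> (\<lambda>t. of_complex (f t)) (\<lambda>t. of_complex (g t))"
    unfolding is_weak_deriv_def primitive_on_def by (intro conjI) (assumption | erule conjunct2)+
  then show ?thesis using assms(3) unfolding H1_loops_def periodic_def by auto
qed

section \<open>The two bounds on the index of the iterates\<close>

context kepler_orbit
begin

lemma second_variation_eq:
  assumes \<mu>: "\<mu> > 0" "\<kappa> = m / \<mu>" and \<gamma>: "\<And>t. to_complex (\<gamma> t) = z t ^ 2"
  shows "second_variation \<mu> m \<tau> \<gamma> \<xi> \<xi>
    = \<mu> * (LINT t:{0..\<tau>}|lborel. index_form t (\<lambda>t. to_complex (\<xi> t)) (to_complex (weak_deriv \<tau> \<xi> t)))"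
proof -
  have "\<mu> * (weak_deriv \<tau> \<xi> t \<bullet> weak_deriv \<tau> \<xi> t) + D2U m (\<gamma> t) (\<xi> t) (\<xi> t)
     = \<mu> * index_form t (\<lambda>t. to_complex (\<xi> t)) (to_complex (weak_deriv \<tau> \<xi> t))" for t
  proof -
    have n: "norm (\<gamma> t) = r t" using norm_to_complex[of "\<gamma> t"] by (simp add: \<gamma> r_def norm_power)
    then have nz: "\<gamma> t \<noteq> 0" using r_nonzero by auto
    define a where "a = Re (cnj (z t ^ 2) * to_complex (\<xi> t))"
    have a: "\<gamma> t \<bullet> \<xi> t = a"
      unfolding inner_to_complex \<gamma> a_def ..
    show ?thesis
      unfolding index_form_def norm_to_complex D2U_eq[OF nz] a a_def[symmetric] n power2_norm_eq_inner
      using \<mu> by (simp add: distrib_left power2_eq_square mult.assoc)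
  qed
  then show ?thesis by (simp add: second_variation_def)
qed

text \<open>The k - 1 complex defects amount to 2 (k - 1) real functionals. A larger space contains
  a nonzero loop on which all of them vanish, and there the form is nonnegative.\<close>

lemma negative_definite_dim_le:
  assumes \<mu>: "\<mu> > 0" "\<kappa> = m / \<mu>" and \<gamma>: "\<And>t. to_complex (\<gamma> t) = z t ^ 2" and k: "k \<ge> 1"
    and V: "subspace V" "V \<subseteq> H1_loops (real k * T)" "finite B" "V = span B"
    and neg: "negative_definite_on (second_variation \<mu> m (real k * T) \<gamma>) V"
  shows "dim V \<le> 2 * (k - 1)"
proof (rule ccontr)
  assume "\<not> dim V \<le> 2 * (k - 1)"
  define I where "I = {1..<k} \<times> (UNIV :: bool set)"
  have I: "finite I" "card I < dim V"
    using \<open>\<not> dim V \<le> 2 * (k - 1)\<close> by (simp_all add: I_def card_cartesian_product)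
  define F :: "nat \<times> bool \<Rightarrow> (real \<Rightarrow> real ^ 2) \<Rightarrow> real" where
    "F p \<xi> = (if snd p then Re else Im) (anti_defect k (fst p) (\<lambda>t. to_complex (\<xi> t)))" for p \<xi>
  have cont: "continuous_on {0..real k * T} (\<lambda>t. to_complex (\<xi> t))" if "\<xi> \<in> V" for \<xi>
    using primitive_on_continuous_on[OF H1_loop_complex(1)] V(2) that by blast
  have "\<exists>\<xi>\<in>V. \<xi> \<noteq> 0 \<and> (\<forall>p\<in>I. F p \<xi> = 0)"
  proof (rule common_kernel[OF V(1,3,4) I])
    fix p \<xi> \<eta> assume "p \<in> I" and u: "\<xi> \<in> V" "\<eta> \<in> V"
    then have "fst p \<le> k" by (auto simp: I_def)
    from anti_defect_add[OF cont[OF u(1)] cont[OF u(2)] this]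
    show "F p (\<xi> + \<eta>) = F p \<xi> + F p \<eta>"
      by (simp add: F_def plus_fun_def bounded_linear.linear[OF bounded_linear_to_complex, THEN linear_add])
  next
    fix p a \<xi>
    have "to_complex (a *\<^sub>R q) = of_real a * to_complex q" for q
      by (simp add: to_complex_def complex_eq_iff)
    then show "F p (a *\<^sub>R \<xi>) = a * F p \<xi>"
      using anti_defect_scale[of k "fst p" a "\<lambda>t. to_complex (\<xi> t)"]
      by (simp add: F_def scaleR_fun_def)
  qed
  then obtain \<xi> where \<xi>: "\<xi> \<in> V" "\<xi> \<noteq> 0" "\<And>p. p \<in> I \<Longrightarrow> F p \<xi> = 0" by blast
  have H: "\<xi> \<in> H1_loops (real k * T)" using V(2) \<xi>(1) by blast
  have "0 \<le> (LINT t:{0..real k * T}|lborel. index_form t (\<lambda>t. to_complex (\<xi> t)) (to_complex (weak_deriv (real k * T) \<xi> t)))"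
  proof (rule index_form_nonneg[OF H1_loop_complex(1)[OF H] _ k H1_loop_complex(2)[OF H]])
    show "to_complex (\<xi> (real k * T)) = to_complex (\<xi> 0)" using H1_loop_complex(3)[OF H] by simp
    fix j assume "j \<in> {1..<k}"
    then show "anti_defect k j (\<lambda>t. to_complex (\<xi> t)) = 0"
      using \<xi>(3)[of "(j, True)"] \<xi>(3)[of "(j, False)"] by (simp add: I_def F_def complex_eq_iff)
  qed
  then have "0 \<le> second_variation \<mu> m (real k * T) \<gamma> \<xi> \<xi>"
    unfolding second_variation_eq[OF \<mu> \<gamma>] using \<mu>(1) by simp
  then show False using neg \<xi>(1,2) by (force simp: negative_definite_on_def)
qed

text \<open>Linearity over the reals is all that can hold, because \<open>mode_n\<close> takes a
  real part; this is why the modes are counted with real dimension 2.\<close>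

lemma linear_mode_loop: "linear (\<lambda>c t. of_complex (mode_loop k c t))"
proof -
  note lin = bounded_linear.linear[OF bounded_linear_of_complex]
  have m: "mode k (c + d) t = mode k c t + mode k d t" "mode k (a *\<^sub>R c) t = a *\<^sub>R mode k c t"
    and p: "mode_potential k (c + d) t = mode_potential k c t + mode_potential k d t"
      "mode_potential k (a *\<^sub>R c) t = a *\<^sub>R mode_potential k c t" for a c d t
    unfolding mode_def mode_potential_def plus_fun_def scaleR_fun_def
    by (simp_all add: distrib_right sum.distrib scaleR_sum_right)
  have n: "mode_n k (c + d) t = mode_n k c t + mode_n k d t" "mode_n k (a *\<^sub>R c) t = a * mode_n k c t" for a c d t
    by (simp_all add: mode_n_def p add_divide_distrib)
  have "mode_loop k (c + d) t = mode_loop k c t + mode_loop k d t"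
    "mode_loop k (a *\<^sub>R c) t = a *\<^sub>R mode_loop k c t" for a c d t
    unfolding mode_loop_def m n by (simp_all add: scaleR_conv_of_real algebra_simps)
  then show ?thesis
    by (intro linearI) (auto simp: fun_eq_iff scaleR_fun_def linear_add[OF lin] linear_scale[OF lin])
qed

lemma negative_definite_exists:
  assumes \<mu>: "\<mu> > 0" "\<kappa> = m / \<mu>" and \<gamma>: "\<And>t. to_complex (\<gamma> t) = z t ^ 2" and k: "k \<ge> 1"
  shows "\<exists>V B. subspace V \<and> V \<subseteq> H1_loops (real k * T) \<and> finite B \<and> V = span B
    \<and> negative_definite_on (second_variation \<mu> m (real k * T) \<gamma>) V \<and> dim V = 2 * (k - 1)"
proof -
  define \<tau> where "\<tau> = real k * T"
  define I where "I = {1..<k} \<times> (UNIV :: bool set)"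
  \<comment> \<open>A real basis of the coefficient families: the units 1 and \<i> for each
    mode.\<close>
  define e :: "nat \<times> bool \<Rightarrow> nat \<Rightarrow> complex" where
    "e p = (\<lambda>j. if j = fst p then (if snd p then 1 else \<i>) else 0)" for p
  define \<Psi> where "\<Psi> = (\<lambda>c t. of_complex (mode_loop k c t))"
  have lin: "linear \<Psi>" unfolding \<Psi>_def by (rule linear_mode_loop)
  have I: "finite I" "card I = 2 * (k - 1)" by (simp_all add: I_def card_cartesian_product)
  have e_inj: "inj_on e I"
  proof (rule inj_onI)
    fix p q assume "e p = e q"
    then have "e p (fst p) = e q (fst p)" by simp
    then show "p = q" by (auto simp: e_def prod_eq_iff complex_eq_iff split: if_splits)
  qed
  \<comment> \<open>\<open>mode\<close> reads coefficients only at indices in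
    \<open>{1..<k}\<close>, so a nonzero family must be shown to be nonzero there before
    \<open>mode_loop_negative\<close> applies.\<close>
  have supp: "\<exists>j\<in>{1..<k}. c j \<noteq> 0" if "c \<in> span (e ` I)" "c \<noteq> 0" for c
  proof -
    have "span (e ` I) \<subseteq> {c. \<forall>j. j \<notin> {1..<k} \<longrightarrow> c j = 0}"
      by (rule real_vector.span_minimal)
        (auto simp: e_def I_def real_vector.subspace_def scaleR_fun_def plus_fun_def zero_fun_def)
    then have "j \<in> {1..<k}" if "c j \<noteq> 0" for j using that \<open>c \<in> span (e ` I)\<close> by blast
    moreover obtain j where "c j \<noteq> 0" using \<open>c \<noteq> 0\<close> by (auto simp: fun_eq_iff zero_fun_def)
    ultimately show ?thesis by blast
  qed
  have indep: "independent (e ` I)"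
  proof (rule real_vector.independent_if_scalars_zero[OF finite_imageI[OF I(1)]])
    fix f x assume sum: "(\<Sum>x\<in>e ` I. f x *\<^sub>R x) = 0" and "x \<in> e ` I"
    then obtain j b where x: "x = e (j, b)" "(j, b) \<in> I" by auto
    have "(\<Sum>p\<in>J. f (e p) *\<^sub>R e p) j = (\<Sum>p\<in>J. f (e p) *\<^sub>R e p j)" if "finite J" for J
      using that by (induction rule: finite_induct) (auto simp: zero_fun_def plus_fun_def scaleR_fun_def)
    from this[OF I(1)] have "(\<Sum>p\<in>I. f (e p) *\<^sub>R e p j) = 0"
      using sum by (simp add: sum.reindex[OF e_inj] zero_fun_def)
    moreover have "(\<Sum>p\<in>I. f (e p) *\<^sub>R e p j) = (\<Sum>p\<in>{(j, True), (j, False)}. f (e p) *\<^sub>R e p j)"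
      by (rule sum.mono_neutral_right[OF I(1)]) (use x(2) in \<open>auto simp: e_def I_def\<close>)
    ultimately have "of_real (f (e (j, True))) + of_real (f (e (j, False))) * \<i> = 0"
      by (simp add: e_def scaleR_conv_of_real)
    then show "f x = 0" by (cases b) (auto simp: x complex_eq_iff)
  qed
  have mem: "\<Psi> c \<in> H1_loops \<tau>" for c
  proof -
    obtain g where "continuous_on UNIV g" "\<And>t. (mode_loop k c has_vector_derivative g t) (at t)"
      using mode_loop_C1 by blast
    then show ?thesis
      unfolding \<Psi>_def by (intro C1_periodic_H1_loop) (use mode_loop_periodic[OF k] in \<open>auto simp: \<tau>_def\<close>)
  qed
  \<comment> \<open>Injectivity comes from negativity: a nonzero family with vanishing loop would,
    with derivative 0, make the form 0 and negative at once.\<close>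
  have inj: "inj_on \<Psi> (span (e ` I))"
  proof (rule inj_onI)
    fix c d assume cd: "c \<in> span (e ` I)" "d \<in> span (e ` I)" "\<Psi> c = \<Psi> d"
    then have cd_span: "c - d \<in> span (e ` I)" by (intro real_vector.span_diff)
    have "\<Psi> (c - d) = 0" using cd(3) by (simp add: linear_diff[OF lin])
    have "mode_loop k (c - d) t = 0" for t
    proof -
      have "of_complex (mode_loop k (c - d) t) = 0"
        using fun_cong[OF \<open>\<Psi> (c - d) = 0\<close>, of t] by (simp add: \<Psi>_def zero_fun_def)
      then show ?thesis
        using norm_of_complex[of "mode_loop k (c - d) t"] by simp
    qed
    then have zero: "mode_loop k (c - d) = (\<lambda>t. 0)" by (rule ext)
    show "c = d"
    proof (rule ccontr)
      assume "c \<noteq> d"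
      then have ex: "\<exists>j\<in>{1..<k}. (c - d) j \<noteq> 0" by (intro supp[OF cd_span]) simp
      have "primitive_on 0 (real k * T) (mode_loop k (c - d)) (\<lambda>t. 0)"
        unfolding zero by (rule primitive_on_const)
      moreover have "set_integrable lborel {0..real k * T} (\<lambda>t. (norm (0 :: complex))\<^sup>2)"
        by (simp add: set_integrable_def)
      ultimately show False
        using mode_loop_negative[OF k _ _ ex, of "\<lambda>t. 0", unfolded index_form_def zero]
        by (simp add: zero)
    qed
  qed
  define V where "V = span (\<Psi> ` e ` I)"
  have V: "V = \<Psi> ` span (e ` I)"
    unfolding V_def by (rule linear_span_image[OF lin])
  have "negative_definite_on (second_variation \<mu> m \<tau> \<gamma>) V"
    unfolding negative_definite_on_def V
  proof safe
    fix c assume c: "c \<in> span (e ` I)" "\<Psi> c \<noteq> 0"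
    then have "c \<noteq> 0" using linear_0[OF lin] by auto
    from mode_loop_negative[OF k _ _ supp[OF c(1) this]] H1_loop_complex[OF mem[of c]]
    show "second_variation \<mu> m \<tau> \<gamma> (\<Psi> c) (\<Psi> c) < 0"
      unfolding second_variation_eq[OF \<mu> \<gamma>] using \<mu>(1)
      by (auto simp: \<Psi>_def \<tau>_def intro!: mult_pos_neg)
  qed
  moreover have "dim V = 2 * (k - 1)"
  proof -
    have "independent (\<Psi> ` e ` I)"
      by (rule linear_independent_injective_image[OF lin indep inj])
    then have "dim V = card (\<Psi> ` e ` I)"
      unfolding V_def by (rule real_vector.dim_span_eq_card_independent)
    also have "\<dots> = card I"
      using card_image[OF inj_on_subset[OF inj real_vector.span_superset]] card_image[OF e_inj] by simp
    finally show ?thesis by (simp add: I)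
  qed
  moreover have "V \<subseteq> H1_loops \<tau>" unfolding V using mem by blast
  moreover have "subspace V" unfolding V_def by (rule real_vector.subspace_span)
  moreover have "finite (\<Psi> ` e ` I)" using I(1) by simp
  moreover note V_def
  ultimately show ?thesis
    unfolding \<tau>_def by (intro exI[of _ V] exI[of _ "\<Psi> ` e ` I"] conjI)
qed

lemma iteration_index_eq:
  assumes \<mu>: "\<mu> > 0" "\<kappa> = m / \<mu>" and \<gamma>: "\<And>t. to_complex (\<gamma> t) = z t ^ 2" and k: "k \<ge> 1"
  shows "iteration_index \<mu> m T \<gamma> k = enat (2 * (k - 1))"
  unfolding iteration_index_def morse_index_def
proof (rule antisym)
  show "(SUP V \<in> {V. subspace V \<and> V \<subseteq> H1_loops (real k * T) \<and> (\<exists>B. finite B \<and> V = span B)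
      \<and> negative_definite_on (second_variation \<mu> m (real k * T) \<gamma>) V}. enat (dim V)) \<le> enat (2 * (k - 1))"
    using negative_definite_dim_le[OF \<mu> \<gamma> k] by (intro SUP_least) auto
  obtain V B where V: "subspace V" "V \<subseteq> H1_loops (real k * T)" "finite B" "V = span B"
    "negative_definite_on (second_variation \<mu> m (real k * T) \<gamma>) V" "dim V = 2 * (k - 1)"
    using negative_definite_exists[OF \<mu> \<gamma> k] by blast
  then show "enat (2 * (k - 1)) \<le> (SUP V \<in> {V. subspace V \<and> V \<subseteq> H1_loops (real k * T) \<and> (\<exists>B. finite B \<and> V = span B)
      \<and> negative_definite_on (second_variation \<mu> m (real k * T) \<gamma>) V}. enat (dim V))"
    by (intro SUP_upper2[of V]) auto
qed

end

lemma kepler_ellipse_motion: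
  assumes "\<mu> > 0" "m > 0" "kepler_ellipse \<mu> m T \<gamma>"
  shows "\<exists>v. periodic_kepler_motion (\<lambda>t. to_complex (\<gamma> t)) v (m / \<mu>) T"
proof -
  note lin = bounded_linear.linear[OF bounded_linear_to_complex]
  have inj: "to_complex p = to_complex q \<longleftrightarrow> p = q" for p q
    by (auto simp: to_complex_def vec_eq_iff forall_2)
  obtain v a where sol: "\<And>t. \<gamma> t \<noteq> 0" "\<And>t. (\<gamma> has_vector_derivative v t) (at t)"
    "\<And>t. (v has_vector_derivative a t) (at t)" "\<And>t. \<mu> *\<^sub>R a t = - (m / norm (\<gamma> t) ^ 3) *\<^sub>R \<gamma> t"
    using assms(3) unfolding kepler_ellipse_def kepler_solution_def by blast
  have T: "0 < T" "\<And>t. \<gamma> (t + T) = \<gamma> t" "\<And>S. 0 < S \<Longrightarrow> S < T \<Longrightarrow> \<exists>t. \<gamma> (t + S) \<noteq> \<gamma> t"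
    using assms(3) unfolding kepler_ellipse_def prime_period_def periodic_def by blast+
  have "a t = - (m / \<mu> / norm (\<gamma> t) ^ 3) *\<^sub>R \<gamma> t" for t
  proof -
    have "a t = (1 / \<mu>) *\<^sub>R (\<mu> *\<^sub>R a t)" using assms(1) by simp
    also have "\<dots> = - (m / \<mu> / norm (\<gamma> t) ^ 3) *\<^sub>R \<gamma> t" unfolding sol(4) using assms(1) by simp
    finally show ?thesis .
  qed
  then have a: "(v has_vector_derivative - (m / \<mu> / norm (\<gamma> t) ^ 3) *\<^sub>R \<gamma> t) (at t)" for t
    using sol(3)[of t] by simp
  have "periodic_kepler_motion (\<lambda>t. to_complex (\<gamma> t)) (\<lambda>t. to_complex (v t)) (m / \<mu>) T"
  proof
    fix t S
    show "to_complex (\<gamma> t) \<noteq> 0" using sol(1)[of t] norm_to_complex[of "\<gamma> t"] by auto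
    show "((\<lambda>t. to_complex (\<gamma> t)) has_vector_derivative to_complex (v t)) (at t)"
      by (rule bounded_linear.has_vector_derivative[OF bounded_linear_to_complex sol(2)])
    show "((\<lambda>t. to_complex (v t)) has_vector_derivative
        - (m / \<mu> / norm (to_complex (\<gamma> t)) ^ 3) *\<^sub>R to_complex (\<gamma> t)) (at t)"
      using bounded_linear.has_vector_derivative[OF bounded_linear_to_complex a[of t]]
      unfolding linear_scale[OF lin] norm_to_complex .
    show "m / \<mu> > 0" using assms(1,2) by simp
    show "T > 0" by (rule T(1))
    show "to_complex (\<gamma> (t + T)) = to_complex (\<gamma> t)" unfolding T(2) ..
    show "\<exists>t. to_complex (\<gamma> (t + S)) \<noteq> to_complex (\<gamma> t)" if "0 < S" "S < T"
      unfolding inj by (rule T(3)[OF that])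
  qed
  then show ?thesis by blast
qed

theorem theorem4p4:
  fixes \<mu> m T :: real and \<gamma> :: "real \<Rightarrow> real ^ 2"
  assumes "\<mu> > 0" and "m > 0"
    and "kepler_ellipse \<mu> m T \<gamma>"
  shows "(\<forall>k::nat. k \<ge> 1 \<longrightarrow> iteration_index \<mu> m T \<gamma> k = enat (2 * (k - 1)))
    \<and> morse_index \<mu> m T \<gamma> = 0
    \<and> (\<lambda>k::nat. ereal_of_enat (iteration_index \<mu> m T \<gamma> k) / ereal (real k)) \<longlonglongrightarrow> 2"
proof -
  obtain v where "periodic_kepler_motion (\<lambda>t. to_complex (\<gamma> t)) v (m / \<mu>) T"
    using kepler_ellipse_motion[OF assms] by blast
  then interpret K: periodic_kepler_motion "\<lambda>t. to_complex (\<gamma> t)" v "m / \<mu>" T .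
  obtain z w \<psi> P Q where z: "kepler_frame z w K.\<beta> (m / \<mu>)" "\<And>t. (z t)\<^sup>2 = to_complex (\<gamma> t)"
    "\<And>t. (\<psi> has_real_derivative K.\<beta> / (norm (z t))\<^sup>2) (at t)" "\<And>t. \<psi> (t + T) = \<psi> t + pi"
    "\<And>t. z t = P * cis (\<psi> t) + Q * cis (- \<psi> t)"
    "\<And>t. w t = of_real K.\<beta> * (\<i> * P * cis (\<psi> t) - \<i> * Q * cis (- \<psi> t))"
    using K.levi_civita_parametrization by blast
  interpret O: kepler_orbit z w K.\<beta> "m / \<mu>" \<psi> T P Q
    unfolding kepler_orbit_def kepler_orbit_axioms_def using z K.\<beta>_pos K.T_pos by blast
  have index: "iteration_index \<mu> m T \<gamma> k = enat (2 * (k - 1))" if "k \<ge> 1" for k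
    by (rule O.iteration_index_eq[OF assms(1) refl z(2)[symmetric] that])
  have "morse_index \<mu> m T \<gamma> = 0"
    using index[of 1] by (simp add: iteration_index_def zero_enat_def)
  moreover have "(\<lambda>k::nat. ereal_of_enat (iteration_index \<mu> m T \<gamma> k) / ereal (real k)) \<longlonglongrightarrow> ereal 2"
  proof (rule Lim_transform_eventually)
    have "(\<lambda>k. 2 - 2 / real k) \<longlonglongrightarrow> 2 - 0"
      by (intro tendsto_diff tendsto_const lim_const_over_n)
    then show "(\<lambda>k. ereal (2 - 2 / real k)) \<longlonglongrightarrow> ereal 2" by simp
    \<comment> \<open>From k = 1 on the natural-number subtraction is not truncated and the quotient
      equals 2 - 2/k; the term k = 0, with its zero denominator, lies outside the eventual
      range.\<close>
    show "\<forall>\<^sub>F k in sequentially. ereal (2 - 2 / real k) = ereal_of_enat (iteration_index \<mu> m T \<gamma> k) / ereal (real k)"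
      using eventually_ge_at_top[of 1]
    proof eventually_elim
      case (elim k)
      then show ?case by (simp add: index of_nat_diff field_simps)
    qed
  qed
  ultimately show ?thesis using index by simp
qed

end
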